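(* Let $(B,\mathcal S)$ be a triangular Hopf algebra over a field $\Bbbk$ and let $(\mathcal C,\circ,I,\bullet,J)=({}_B\mathfrak M_B,\otimes_B,B,\otimes_\Bbbk,\Bbbk)$ be the $\bullet$-braided duoidal category of $B$-bimodules. Then the coslice category $(B,\mathcal S)/\mathrm{TrHopf}$ of triangular Hopf algebras under $(B,\mathcal S)$ is isomorphic to the category $\mathrm{Grp}(\mathrm{Comon}_{\mathrm{coc}}(\mathcal C^\bullet),\circ,I)$ of internal groups in the monoidal category $(\mathrm{Comon}_{\mathrm{coc}}(\mathcal C^\bullet),\circ,I)$ of cocommutative comonoids.
   Context: A quasitriangular Hopf algebra $(H,\mathcal R)$ is a Hopf algebra with an invertible $\mathcal R\in H\otimes H$ such that $\Delta^{\mathrm{op}}(\cdot)=\mathcal R\Delta(\cdot)\mathcal R^{-1}$, $(\mathrm{Id}\otimes\Delta)(\mathcal R)=\mathcal R_{13}\mathcal R_{12}$, $(\Delta\otimes\mathrm{Id})(\mathcal R)=\mathcal R_{13}\mathcal R_{23}$; it is triangular if moreover $\mathcal R^{-1}=\mathcal R^{\mathrm{op}}$ (flip of $\mathcal R$). Morphisms $f:(A,\mathcal R)\to(H,\mathcal S)$ are bialgebra maps with $(f\otimes f)(\mathcal R)=\mathcal S$; $\mathrm{TrHopf}$ is the category of triangular Hopf algebras. Duoidal structure on ${}_B\mathfrak M_B$: $\circ=\otimes_B$, $I=B$; $\bullet=\otimes_\Bbbk$ with diagonal $B$-bimodule structure $b(x\bullet y)b'=b_1xb_1'\bullet b_2yb_2'$,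 $J=\Bbbk$ a $B$-bimodule via $\varepsilon_B$; interchange law $\zeta_{A,E,C,D}((a\bullet e)\circ(c\bullet d))=(a\circ c)\bullet(e\circ d)$; $\Delta_I=\Delta_B$, $m_J(k\circ k')=kk'$, $\varepsilon_I=u_J=\varepsilon_B$. Braiding for $\bullet$ (a symmetry, since $B$ is triangular): $\sigma_{X,Y}(x\otimes y)=\mathcal S^{-1}(y\otimes x)\mathcal S$. $\mathrm{Comon}_{\mathrm{coc}}(\mathcal C^\bullet)$ is the category of comonoids $(C,\Delta_C,\varepsilon_C)$ in $(\mathcal C,\bullet,J)$ with $\sigma_{C,C}\Delta_C=\Delta_C$. It is closed under $\circ$ (via $\Delta_{C\circ D}=\zeta_{C,C,D,D}(\Delta_C\circ\Delta_D)$, $\varepsilon_{C\circ D}=m_J(\varepsilon_C\circ\varepsilon_D)$, unit $I$) and under $\bullet$ (via $(C\bullet\sigma_{C,D}\bullet D)(\Delta_C\bullet\Delta_D)$, unit $J$), and $\bullet$ is the binary product and $J$ the terminal object of it; so $(\mathrm{Comon}_{\mathrm{coc}}(\mathcal C^\bullet),\circ,I,\bullet,J)$ is a duoidal category with the inherited structure morphisms. It has a reversion inherited from the following one on $\mathcal C$: $X^-$ is the vector space $X$ (elements written $x^-$) with $bx^-b'=(S_B(b')xS_B(b))^-$; $\phi^\circ(x^-\circ y^-)=(y\circ x)^-$, $\phi^\circ_0(b)=S_B(b)^-$, $\phi^\bullet(x^-\bullet y^-)=(y\bullet x)^-$, $\phi^\bullet_0(k)=k^-$; $\gamma(((x\bullet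 y^-)\circ z)\bullet t)=x\circ(z\bullet(y\circ t))$, $\delta(x\bullet(y\circ(z^-\bullet t)))=((x\circ z)\bullet y)\circ t$, $\widetilde\gamma(x^-\bullet((y\bullet z)\circ t))=z\circ((x\circ y)^-\bullet t)$, $\widetilde\delta((x\circ(y\bullet z))\bullet t^-)=(x\bullet(z\circ t)^-)\circ y$; here for a comonoid $C$, $C^-$ is a comonoid via $\Delta_{C^-}(c^-)=c_2^-\bullet c_1^-$, $\varepsilon_{C^-}(c^-)=\varepsilon_C(c)$. Internal groups: for a monoidal category $(\mathcal D,\circ,I)$ with finite products such that the induced duoidal category $(\mathcal D,\circ,I,\times,\mathsf 1)$ has a reversion, $\mathrm{Grp}(\mathcal D,\circ,I)$ is the category of Hopf monoids in $(\mathcal D,\circ,I,\times,\mathsf 1)$. Here $\mathcal D=\mathrm{Comon}_{\mathrm{coc}}(\mathcal C^\bullet)$, $\times=\bullet$, $\mathsf 1=J$. A Hopf monoid is a bimonoid $H$ (a monoid for $\circ$ and comonoid for $\bullet$ with $\Delta_Hm_H=(m_H\bullet m_H)\zeta(\Delta_H\circ\Delta_H)$, $\varepsilon_Hm_H=m_J(\varepsilon_H\circ\varepsilon_H)$, $\Delta_Hu_H=(u_H\bullet u_H)\Delta_I$, $\varepsilon_Hu_H=\varepsilon_I$) in $\mathcal D$ admitting a morphism $\Sigma_H:H\to H^-$ in $\mathcal D$ with, for all $h\in H$, $((m_H\bullet I)\circ J)\varphi_{H,H}(h_1\bullet\Sigma_H(h_2))=\varepsilon_H(h)\,(1_H\bullet1_B)\circ1_\Bbbk$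 and $(J\circ(I\bullet m_H))\psi_{H,H}(\Sigma_H(h_1)\bullet h_2)=\varepsilon_H(h)\,1_\Bbbk\circ(1_B\bullet1_H)$, where $\varphi_{X,Y}(x\bullet y^-)=((x\circ y)\bullet1_B)\circ1_\Bbbk$, $\psi_{X,Y}(x^-\bullet y)=1_\Bbbk\circ(1_B\bullet(x\circ y))$ and $1_H=u_H(1_B)$. Morphisms are bimonoid morphisms. *)

theory Defs
  imports Complex_Main "HOL-Algebra.Group" "HOL-Library.Poly_Mapping"
begin

section \<open>Categories\<close>

text \<open>
  Arrows are only meaningful relative to a source and a target, so identities and composition
  are indexed by objects: \<open>Comp C X Y Z g f\<close> is the composite of \<open>f : X \<rightarrow> Y\<close> and
  \<open>g : Y \<rightarrow> Z\<close>.
\<close>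

record ('o, 'm) precategory =
  Obj :: "'o set"
  Hom :: "'o \<Rightarrow> 'o \<Rightarrow> 'm set"
  Id :: "'o \<Rightarrow> 'm"
  Comp :: "'o \<Rightarrow> 'o \<Rightarrow> 'o \<Rightarrow> 'm \<Rightarrow> 'm \<Rightarrow> 'm"

definition is_category :: "('o, 'm) precategory \<Rightarrow> bool" where
  "is_category C \<longleftrightarrow>
     (\<forall>X\<in>Obj C. Id C X \<in> Hom C X X) \<and>
     (\<forall>X\<in>Obj C. \<forall>Y\<in>Obj C. \<forall>Z\<in>Obj C. \<forall>f\<in>Hom C X Y. \<forall>g\<in>Hom C Y Z.
        Comp C X Y Z g f \<in> Hom C X Z) \<and>
     (\<forall>X\<in>Obj C. \<forall>Y\<in>Obj C. \<forall>f\<in>Hom C X Y.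
        Comp C X X Y f (Id C X) = f \<and> Comp C X Y Y (Id C Y) f = f) \<and>
     (\<forall>W\<in>Obj C. \<forall>X\<in>Obj C. \<forall>Y\<in>Obj C. \<forall>Z\<in>Obj C.
        \<forall>f\<in>Hom C W X. \<forall>g\<in>Hom C X Y. \<forall>h\<in>Hom C Y Z.
          Comp C W Y Z h (Comp C W X Y g f) = Comp C W X Z (Comp C X Y Z h g) f)"

definition is_functor ::
  "('o, 'm) precategory \<Rightarrow> ('p, 'n) precategory \<Rightarrow> ('o \<Rightarrow> 'p) \<Rightarrow> ('o \<Rightarrow> 'o \<Rightarrow> 'm \<Rightarrow> 'n) \<Rightarrow> bool"
where
  "is_functor C D F0 F1 \<longleftrightarrow>
     (\<forall>X\<in>Obj C. F0 X \<in> Obj D) \<and>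
     (\<forall>X\<in>Obj C. \<forall>Y\<in>Obj C. \<forall>f\<in>Hom C X Y. F1 X Y f \<in> Hom D (F0 X) (F0 Y)) \<and>
     (\<forall>X\<in>Obj C. F1 X X (Id C X) = Id D (F0 X)) \<and>
     (\<forall>X\<in>Obj C. \<forall>Y\<in>Obj C. \<forall>Z\<in>Obj C. \<forall>f\<in>Hom C X Y. \<forall>g\<in>Hom C Y Z.
        F1 X Z (Comp C X Y Z g f) = Comp D (F0 X) (F0 Y) (F0 Z) (F1 Y Z g) (F1 X Y f))"

definition isomorphic_categories :: "('o, 'm) precategory \<Rightarrow> ('p, 'n) precategory \<Rightarrow> bool" where
  "isomorphic_categories C D \<longleftrightarrow> is_category C \<and> is_category D \<and>
     (\<exists>F0 F1 G0 G1. is_functor C D F0 F1 \<and> is_functor D C G0 G1 \<and>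
        (\<forall>X\<in>Obj C. G0 (F0 X) = X) \<and>
        (\<forall>X\<in>Obj C. \<forall>Y\<in>Obj C. \<forall>f\<in>Hom C X Y. G1 (F0 X) (F0 Y) (F1 X Y f) = f) \<and>
        (\<forall>X\<in>Obj D. F0 (G0 X) = X) \<and>
        (\<forall>X\<in>Obj D. \<forall>Y\<in>Obj D. \<forall>f\<in>Hom D X Y. F1 (G0 X) (G0 Y) (G1 X Y f) = f))"

definition coslice :: "('o, 'm) precategory \<Rightarrow> 'o \<Rightarrow> ('o \<times> 'm, 'm) precategory" where
  "coslice C A =
     \<lparr>Obj = {(X, f). X \<in> Obj C \<and> f \<in> Hom C A X},
      Hom = (\<lambda>(X, f) (Y, g). {h \<in> Hom C X Y. Comp C A X Y h f = g}),
      Id = (\<lambda>(X, f). Id C X),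
      Comp = (\<lambda>(X, _) (Y, _) (Z, _). Comp C X Y Z)\<rparr>"


section \<open>Vector spaces and linear maps\<close>

text \<open>
  All structure maps are required to be extensional (equal to \<open>undefined\<close> off the carrier), so
  that HOL equality of records, respectively of functions, is equality of the structures,
  respectively of the maps with the given source.
\<close>

record ('k, 'a) vspace = "'a partial_object" +
  vadd :: "'a \<Rightarrow> 'a \<Rightarrow> 'a"
  vzero :: 'a
  vscale :: "'k \<Rightarrow> 'a \<Rightarrow> 'a"

definition add_group :: "('k, 'a, 'm) vspace_scheme \<Rightarrow> 'a monoid" where
  "add_group V = \<lparr>carrier = carrier V, mult = vadd V, one = vzero V\<rparr>"

definition is_vspace :: "('k::field, 'a, 'm) vspace_scheme \<Rightarrow> bool" where
  "is_vspace V \<longleftrightarrow>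
     comm_group (add_group V) \<and>
     vadd V \<in> carrier V \<rightarrow>\<^sub>E carrier V \<rightarrow>\<^sub>E carrier V \<and>
     (\<forall>c. vscale V c \<in> carrier V \<rightarrow>\<^sub>E carrier V) \<and>
     (\<forall>c. \<forall>x\<in>carrier V. \<forall>y\<in>carrier V.
        vscale V c (vadd V x y) = vadd V (vscale V c x) (vscale V c y)) \<and>
     (\<forall>c d. \<forall>x\<in>carrier V. vscale V (c + d) x = vadd V (vscale V c x) (vscale V d x)) \<and>
     (\<forall>c d. \<forall>x\<in>carrier V. vscale V (c * d) x = vscale V c (vscale V d x)) \<and>
     (\<forall>x\<in>carrier V. vscale V 1 x = x)"

definition lin ::
  "('k::field, 'a, 'm) vspace_scheme \<Rightarrow> ('k, 'b, 'n) vspace_scheme \<Rightarrow> ('a \<Rightarrow> 'b) set"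
where
  "lin V W = {f \<in> carrier V \<rightarrow>\<^sub>E carrier W.
     (\<forall>x\<in>carrier V. \<forall>y\<in>carrier V. f (vadd V x y) = vadd W (f x) (f y)) \<and>
     (\<forall>c. \<forall>x\<in>carrier V. f (vscale V c x) = vscale W c (f x))}"

definition bilinear ::
  "('k::field, 'a, 'm) vspace_scheme \<Rightarrow> ('k, 'b, 'n) vspace_scheme \<Rightarrow> ('k, 'c, 'l) vspace_scheme
   \<Rightarrow> ('a \<Rightarrow> 'b \<Rightarrow> 'c) \<Rightarrow> bool"
where
  "bilinear V W U f \<longleftrightarrow>
     f \<in> carrier V \<rightarrow>\<^sub>E carrier W \<rightarrow>\<^sub>E carrier U \<and>
     (\<forall>x\<in>carrier V. f x \<in> lin W U) \<and>
     (\<forall>y\<in>carrier W. (\<lambda>x\<in>carrier V. f x y) \<in> lin V U)"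

definition kspace :: "('k::field, 'k) vspace" where
  "kspace = \<lparr>carrier = UNIV, vadd = (+), vzero = 0, vscale = (*)\<rparr>"


section \<open>Tensor products\<close>

text \<open>
  \<open>tspace E V W\<close> is the free vector space on \<open>carrier V \<times> carrier W\<close> modulo the bilinearity
  relations and the additional relations \<open>E\<close>; its elements are cosets. With \<open>E = {}\<close> this is
  the tensor product over the ground field, with the balancing relations it is the tensor
  product over an algebra.
\<close>

type_synonym ('k, 'a, 'b) tens = "('a \<times> 'b \<Rightarrow>\<^sub>0 'k) set"

definition fscale :: "'k::field \<Rightarrow> ('i \<Rightarrow>\<^sub>0 'k) \<Rightarrow> ('i \<Rightarrow>\<^sub>0 'k)" where
  "fscale c p = Poly_Mapping.map ((*) c) p"

definition gen :: "'a \<Rightarrow> 'b \<Rightarrow> ('a \<times> 'b \<Rightarrow>\<^sub>0 'k::field)" where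
  "gen x y = Poly_Mapping.single (x, y) 1"

definition bilinear_relations ::
  "('k::field, 'a, 'm) vspace_scheme \<Rightarrow> ('k, 'b, 'n) vspace_scheme \<Rightarrow> ('k, 'a, 'b) tens"
where
  "bilinear_relations V W =
     {gen (vadd V x x') y - gen x y - gen x' y | x x' y.
        x \<in> carrier V \<and> x' \<in> carrier V \<and> y \<in> carrier W} \<union>
     {gen x (vadd W y y') - gen x y - gen x y' | x y y'.
        x \<in> carrier V \<and> y \<in> carrier W \<and> y' \<in> carrier W} \<union>
     {gen (vscale V c x) y - fscale c (gen x y) | c x y. x \<in> carrier V \<and> y \<in> carrier W} \<union>
     {gen x (vscale W c y) - fscale c (gen x y) | c x y. x \<in> carrier V \<and> y \<in> carrier W}"

definition tnull ::
  "('k, 'a, 'b) tens \<Rightarrow> ('k::field, 'a, 'm) vspace_scheme \<Rightarrow> ('k, 'b, 'n) vspace_scheme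
   \<Rightarrow> ('k, 'a, 'b) tens"
where
  "tnull E V W = module.span fscale (bilinear_relations V W \<union> E)"

definition tcoset ::
  "('k, 'a, 'b) tens \<Rightarrow> ('k::field, 'a, 'm) vspace_scheme \<Rightarrow> ('k, 'b, 'n) vspace_scheme
   \<Rightarrow> ('a \<times> 'b \<Rightarrow>\<^sub>0 'k) \<Rightarrow> ('k, 'a, 'b) tens"
where
  "tcoset E V W p = {p + n | n. n \<in> tnull E V W}"

definition tspace ::
  "('k, 'a, 'b) tens \<Rightarrow> ('k::field, 'a, 'm) vspace_scheme \<Rightarrow> ('k, 'b, 'n) vspace_scheme
   \<Rightarrow> ('k, ('k, 'a, 'b) tens) vspace"
where
  "tspace E V W =
     (let T = tcoset E V W ` {p. Poly_Mapping.keys p \<subseteq> carrier V \<times> carrier W} in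
      \<lparr>carrier = T,
       vadd = (\<lambda>s\<in>T. \<lambda>t\<in>T. {p + q | p q. p \<in> s \<and> q \<in> t}),
       vzero = tnull E V W,
       vscale = (\<lambda>c. \<lambda>t\<in>T. {fscale c p + n | p n. p \<in> t \<and> n \<in> tnull E V W})\<rparr>)"

definition pure ::
  "('k, 'a, 'b) tens \<Rightarrow> ('k::field, 'a, 'm) vspace_scheme \<Rightarrow> ('k, 'b, 'n) vspace_scheme
   \<Rightarrow> 'a \<Rightarrow> 'b \<Rightarrow> ('k, 'a, 'b) tens"
where
  "pure E V W x y = tcoset E V W (gen x y)"

text \<open>
  The linear map out of a tensor product with prescribed values on pure tensors. It is used
  below only for prescriptions that are bilinear (and balanced, if \<open>E\<close> is not empty), for which
  it exists uniquely by the universal property.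
\<close>

definition lift ::
  "('k, 'a, 'b) tens \<Rightarrow> ('k::field, 'a, 'm) vspace_scheme \<Rightarrow> ('k, 'b, 'n) vspace_scheme
   \<Rightarrow> ('k, 'c, 'l) vspace_scheme \<Rightarrow> ('a \<Rightarrow> 'b \<Rightarrow> 'c) \<Rightarrow> ('k, 'a, 'b) tens \<Rightarrow> 'c"
where
  "lift E V W U f = (THE g. g \<in> lin (tspace E V W) U \<and>
     (\<forall>x\<in>carrier V. \<forall>y\<in>carrier W. g (pure E V W x y) = f x y))"

abbreviation tensor where "tensor V W \<equiv> tspace {} V W"
abbreviation tpure where "tpure V W \<equiv> pure {} V W"
abbreviation tlift where "tlift V W U f \<equiv> lift {} V W U f"

text \<open>The map \<open>f \<otimes> g : V \<otimes> W \<rightarrow> V' \<otimes> W'\<close>.\<close>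
definition tmap ::
  "('k::field, 'a, 'm) vspace_scheme \<Rightarrow> ('k, 'b, 'n) vspace_scheme
   \<Rightarrow> ('k, 'c, 'm2) vspace_scheme \<Rightarrow> ('k, 'd, 'n2) vspace_scheme
   \<Rightarrow> ('a \<Rightarrow> 'c) \<Rightarrow> ('b \<Rightarrow> 'd) \<Rightarrow> ('k, 'a, 'b) tens \<Rightarrow> ('k, 'c, 'd) tens"
where
  "tmap V W V' W' f g = tlift V W (tensor V' W') (\<lambda>x y. tpure V' W' (f x) (g y))"

definition tflip ::
  "('k::field, 'a, 'm) vspace_scheme \<Rightarrow> ('k, 'b, 'n) vspace_scheme
   \<Rightarrow> ('k, 'a, 'b) tens \<Rightarrow> ('k, 'b, 'a) tens"
where
  "tflip V W = tlift V W (tensor W V) (\<lambda>x y. tpure W V y x)"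

definition tassoc ::
  "('k::field, 'a, 'm) vspace_scheme \<Rightarrow> ('k, 'b, 'n) vspace_scheme
   \<Rightarrow> ('k, 'c, 'l) vspace_scheme
   \<Rightarrow> ('k, ('k, 'a, 'b) tens, 'c) tens \<Rightarrow> ('k, 'a, ('k, 'b, 'c) tens) tens"
where
  "tassoc U V W = tlift (tensor U V) W (tensor U (tensor V W))
     (\<lambda>s z. tlift U V (tensor U (tensor V W))
        (\<lambda>x y. tpure U (tensor V W) x (tpure V W y z)) s)"


section \<open>Algebras, coalgebras and Hopf algebras\<close>

record ('k, 'a) alg = "('k, 'a) vspace" +
  amult :: "'a \<Rightarrow> 'a \<Rightarrow> 'a"
  aone :: 'a

record (overloaded) ('k::zero, 'a) bialg = "('k, 'a) alg" +
  bcomult :: "'a \<Rightarrow> ('k, 'a, 'a) tens"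
  bcounit :: "'a \<Rightarrow> 'k"

definition is_algebra :: "('k::field, 'a, 'm) alg_scheme \<Rightarrow> bool" where
  "is_algebra A \<longleftrightarrow> is_vspace A \<and> bilinear A A A (amult A) \<and> aone A \<in> carrier A \<and>
     (\<forall>x\<in>carrier A. \<forall>y\<in>carrier A. \<forall>z\<in>carrier A.
        amult A (amult A x y) z = amult A x (amult A y z)) \<and>
     (\<forall>x\<in>carrier A. amult A (aone A) x = x \<and> amult A x (aone A) = x)"

definition is_coalgebra ::
  "('k::field, 'a, 'm) vspace_scheme \<Rightarrow> ('a \<Rightarrow> ('k, 'a, 'a) tens) \<Rightarrow> ('a \<Rightarrow> 'k) \<Rightarrow> bool"
where
  "is_coalgebra V \<Delta> \<epsilon> \<longleftrightarrow> is_vspace V \<and> \<Delta> \<in> lin V (tensor V V) \<and> \<epsilon> \<in> lin V kspace \<and>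
     (\<forall>x\<in>carrier V.
        tassoc V V V (tmap V V (tensor V V) V \<Delta> (\<lambda>y. y) (\<Delta> x))
          = tmap V V V (tensor V V) (\<lambda>y. y) \<Delta> (\<Delta> x)) \<and>
     (\<forall>x\<in>carrier V. tlift V V V (\<lambda>y z. vscale V (\<epsilon> y) z) (\<Delta> x) = x) \<and>
     (\<forall>x\<in>carrier V. tlift V V V (\<lambda>y z. vscale V (\<epsilon> z) y) (\<Delta> x) = x)"

definition tensor_alg ::
  "('k::field, 'a, 'm) alg_scheme \<Rightarrow> ('k, 'b, 'n) alg_scheme \<Rightarrow> ('k, ('k, 'a, 'b) tens) alg"
where
  "tensor_alg A C = vspace.extend (tensor A C) (alg.fields
     (\<lambda>s\<in>carrier (tensor A C). \<lambda>t\<in>carrier (tensor A C).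
        tlift A C (tensor A C)
          (\<lambda>x y. tlift A C (tensor A C)
             (\<lambda>x' y'. tpure A C (amult A x x') (amult C y y')) t) s)
     (tpure A C (aone A) (aone C)))"

definition is_bialgebra :: "('k::field, 'a, 'm) bialg_scheme \<Rightarrow> bool" where
  "is_bialgebra H \<longleftrightarrow> is_algebra H \<and> is_coalgebra H (bcomult H) (bcounit H) \<and>
     (\<forall>x\<in>carrier H. \<forall>y\<in>carrier H.
        bcomult H (amult H x y) = amult (tensor_alg H H) (bcomult H x) (bcomult H y) \<and>
        bcounit H (amult H x y) = bcounit H x * bcounit H y) \<and>
     bcomult H (aone H) = aone (tensor_alg H H) \<and>
     bcounit H (aone H) = 1"

definition is_antipode :: "('k::field, 'a, 'm) bialg_scheme \<Rightarrow> ('a \<Rightarrow> 'a) \<Rightarrow> bool" where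
  "is_antipode H s \<longleftrightarrow> s \<in> lin H H \<and>
     (\<forall>x\<in>carrier H.
        tlift H H H (\<lambda>y z. amult H (s y) z) (bcomult H x) = vscale H (bcounit H x) (aone H) \<and>
        tlift H H H (\<lambda>y z. amult H y (s z)) (bcomult H x) = vscale H (bcounit H x) (aone H))"

definition is_hopf_algebra :: "('k::field, 'a, 'm) bialg_scheme \<Rightarrow> bool" where
  "is_hopf_algebra H \<longleftrightarrow> is_bialgebra H \<and> (\<exists>s. is_antipode H s)"

definition antipode :: "('k::field, 'a, 'm) bialg_scheme \<Rightarrow> 'a \<Rightarrow> 'a" where
  "antipode H = (THE s. is_antipode H s)"

definition alg_invertible :: "('k::field, 'a, 'm) alg_scheme \<Rightarrow> 'a \<Rightarrow> bool" where
  "alg_invertible A x \<longleftrightarrow> x \<in> carrier A \<and>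
     (\<exists>y\<in>carrier A. amult A x y = aone A \<and> amult A y x = aone A)"

definition alg_inverse :: "('k::field, 'a, 'm) alg_scheme \<Rightarrow> 'a \<Rightarrow> 'a" where
  "alg_inverse A x = (THE y. y \<in> carrier A \<and> amult A x y = aone A \<and> amult A y x = aone A)"

text \<open>
  The threefold tensor power is bracketed as \<open>H \<otimes> (H \<otimes> H)\<close>; \<open>leg12\<close>, \<open>leg13\<close>, \<open>leg23\<close> are the
  maps sending \<open>R\<close> to \<open>R\<^sub>12\<close>, \<open>R\<^sub>13\<close>, \<open>R\<^sub>23\<close>.
\<close>

definition leg12 ::
  "('k::field, 'a, 'm) alg_scheme \<Rightarrow> ('k, 'a, 'a) tens \<Rightarrow> ('k, 'a, ('k, 'a, 'a) tens) tens"
where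
  "leg12 H = tlift H H (tensor H (tensor H H))
     (\<lambda>x y. tpure H (tensor H H) x (tpure H H y (aone H)))"

definition leg13 ::
  "('k::field, 'a, 'm) alg_scheme \<Rightarrow> ('k, 'a, 'a) tens \<Rightarrow> ('k, 'a, ('k, 'a, 'a) tens) tens"
where
  "leg13 H = tlift H H (tensor H (tensor H H))
     (\<lambda>x y. tpure H (tensor H H) x (tpure H H (aone H) y))"

definition leg23 ::
  "('k::field, 'a, 'm) alg_scheme \<Rightarrow> ('k, 'a, 'a) tens \<Rightarrow> ('k, 'a, ('k, 'a, 'a) tens) tens"
where
  "leg23 H = tlift H H (tensor H (tensor H H))
     (\<lambda>x y. tpure H (tensor H H) (aone H) (tpure H H x y))"

definition is_quasitriangular :: "('k::field, 'a, 'm) bialg_scheme \<Rightarrow> ('k, 'a, 'a) tens \<Rightarrow> bool" where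
  "is_quasitriangular H R \<longleftrightarrow>
     is_hopf_algebra H \<and> alg_invertible (tensor_alg H H) R \<and>
     (\<forall>x\<in>carrier H. tflip H H (bcomult H x) =
        amult (tensor_alg H H) (amult (tensor_alg H H) R (bcomult H x))
          (alg_inverse (tensor_alg H H) R)) \<and>
     tmap H H H (tensor H H) (\<lambda>y. y) (bcomult H) R
       = amult (tensor_alg H (tensor_alg H H)) (leg13 H R) (leg12 H R) \<and>
     tassoc H H H (tmap H H (tensor H H) H (bcomult H) (\<lambda>y. y) R)
       = amult (tensor_alg H (tensor_alg H H)) (leg13 H R) (leg23 H R)"

definition is_triangular :: "('k::field, 'a, 'm) bialg_scheme \<Rightarrow> ('k, 'a, 'a) tens \<Rightarrow> bool" where
  "is_triangular H R \<longleftrightarrow>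
     is_quasitriangular H R \<and> alg_inverse (tensor_alg H H) R = tflip H H R"

definition bialg_hom ::
  "('k::field, 'a, 'm) bialg_scheme \<Rightarrow> ('k, 'b, 'n) bialg_scheme \<Rightarrow> ('a \<Rightarrow> 'b) set"
where
  "bialg_hom A H = {f \<in> lin A H.
     (\<forall>x\<in>carrier A. \<forall>y\<in>carrier A. f (amult A x y) = amult H (f x) (f y)) \<and>
     f (aone A) = aone H \<and>
     (\<forall>x\<in>carrier A. bcomult H (f x) = tmap A A H H f f (bcomult A x)) \<and>
     (\<forall>x\<in>carrier A. bcounit H (f x) = bcounit A x)}"

text \<open>
  The type \<open>'a\<close> plays the role of the universe: underlying sets of objects are subsets of it.
\<close>
definition TrHopf ::
  "(('k::field, 'a) bialg \<times> ('k, 'a, 'a) tens, 'a \<Rightarrow> 'a) precategory"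
where
  "TrHopf =
     \<lparr>Obj = {(H, R). is_triangular H R},
      Hom = (\<lambda>(A, R) (H, R'). {f \<in> bialg_hom A H. tmap A A H H f f R = R'}),
      Id = (\<lambda>(A, _). \<lambda>x\<in>carrier A. x),
      Comp = (\<lambda>(A, _) _ _ g f. compose (carrier A) g f)\<rparr>"


section \<open>The duoidal category of bimodules\<close>

record ('k, 'b, 'a) bimod = "('k, 'a) vspace" +
  lact :: "'b \<Rightarrow> 'a \<Rightarrow> 'a"
  ract :: "'a \<Rightarrow> 'b \<Rightarrow> 'a"

definition is_bimodule ::
  "('k::field, 'b, 'm) alg_scheme \<Rightarrow> ('k, 'b, 'a, 'n) bimod_scheme \<Rightarrow> bool"
where
  "is_bimodule B M \<longleftrightarrow>
     is_vspace M \<and> bilinear B M M (lact M) \<and> bilinear M B M (ract M) \<and>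
     (\<forall>a\<in>carrier B. \<forall>b\<in>carrier B. \<forall>x\<in>carrier M.
        lact M (amult B a b) x = lact M a (lact M b x) \<and>
        ract M x (amult B a b) = ract M (ract M x a) b \<and>
        ract M (lact M a x) b = lact M a (ract M x b)) \<and>
     (\<forall>x\<in>carrier M. lact M (aone B) x = x \<and> ract M x (aone B) = x)"

definition bimod_hom ::
  "('k::field, 'b, 'm) alg_scheme \<Rightarrow> ('k, 'b, 'a, 'n) bimod_scheme \<Rightarrow> ('k, 'b, 'c, 'l) bimod_scheme
   \<Rightarrow> ('a \<Rightarrow> 'c) set"
where
  "bimod_hom B M N = {f \<in> lin M N. \<forall>b\<in>carrier B. \<forall>x\<in>carrier M.
     f (lact M b x) = lact N b (f x) \<and> f (ract M x b) = ract N (f x) b}"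

definition balanced_relations ::
  "('k::field, 'b, 'm) alg_scheme \<Rightarrow> ('k, 'b, 'a, 'n) bimod_scheme \<Rightarrow> ('k, 'b, 'c, 'l) bimod_scheme
   \<Rightarrow> ('k, 'a, 'c) tens"
where
  "balanced_relations B M N = {gen (ract M x b) y - gen x (lact N b y) | x b y.
     x \<in> carrier M \<and> b \<in> carrier B \<and> y \<in> carrier N}"

text \<open>
  For the two monoidal products \<open>M \<circ> N = M \<otimes>\<^sub>B N\<close> (prefix \<open>o\<close>) and \<open>M \<bullet> N = M \<otimes>\<^sub>k N\<close> (prefix
  \<open>t\<close>) the prefix versions of \<open>pure\<close>, \<open>lift\<close> and \<open>map\<close> are pure tensors, maps given on pure
  tensors, and products of maps.
\<close>

abbreviation ospace where "ospace B M N \<equiv> tspace (balanced_relations B M N) M N"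
abbreviation opure where "opure B M N \<equiv> pure (balanced_relations B M N) M N"
abbreviation olift where "olift B M N U f \<equiv> lift (balanced_relations B M N) M N U f"

definition omap ::
  "('k::field, 'b, 'm) alg_scheme \<Rightarrow> ('k, 'b, 'a, 'n) bimod_scheme \<Rightarrow> ('k, 'b, 'c, 'l) bimod_scheme
   \<Rightarrow> ('k, 'b, 'd, 'n2) bimod_scheme \<Rightarrow> ('k, 'b, 'e, 'l2) bimod_scheme
   \<Rightarrow> ('a \<Rightarrow> 'd) \<Rightarrow> ('c \<Rightarrow> 'e) \<Rightarrow> ('k, 'a, 'c) tens \<Rightarrow> ('k, 'd, 'e) tens"
where
  "omap B M N M' N' f g = olift B M N (ospace B M' N') (\<lambda>x y. opure B M' N' (f x) (g y))"

definition circ ::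
  "('k::field, 'b, 'm) alg_scheme \<Rightarrow> ('k, 'b, 'a, 'n) bimod_scheme \<Rightarrow> ('k, 'b, 'c, 'l) bimod_scheme
   \<Rightarrow> ('k, 'b, ('k, 'a, 'c) tens) bimod"
where
  "circ B M N = vspace.extend (ospace B M N) (bimod.fields
     (\<lambda>b\<in>carrier B. olift B M N (ospace B M N) (\<lambda>x y. opure B M N (lact M b x) y))
     (\<lambda>t\<in>carrier (ospace B M N). \<lambda>b\<in>carrier B.
        olift B M N (ospace B M N) (\<lambda>x y. opure B M N x (ract N y b)) t))"

text \<open>
  The componentwise actions of \<open>B \<otimes> B\<close> on \<open>M \<otimes> N\<close>:
  \<open>(b \<otimes> b') \<cdot> (x \<otimes> y) = b x \<otimes> b' y\<close> and \<open>(x \<otimes> y) \<cdot> (b \<otimes> b') = x b \<otimes> y b'\<close>.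
\<close>

definition lact2 ::
  "('k::field, 'b, 'm) alg_scheme \<Rightarrow> ('k, 'b, 'a, 'n) bimod_scheme \<Rightarrow> ('k, 'b, 'c, 'l) bimod_scheme
   \<Rightarrow> ('k, 'b, 'b) tens \<Rightarrow> ('k, 'a, 'c) tens \<Rightarrow> ('k, 'a, 'c) tens"
where
  "lact2 B M N s t =
     tlift B B (tensor M N) (\<lambda>b b'. tmap M N M N (lact M b) (lact N b') t) s"

definition ract2 ::
  "('k::field, 'b, 'm) alg_scheme \<Rightarrow> ('k, 'b, 'a, 'n) bimod_scheme \<Rightarrow> ('k, 'b, 'c, 'l) bimod_scheme
   \<Rightarrow> ('k, 'a, 'c) tens \<Rightarrow> ('k, 'b, 'b) tens \<Rightarrow> ('k, 'a, 'c) tens"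
where
  "ract2 B M N t s =
     tlift B B (tensor M N)
       (\<lambda>b b'. tmap M N M N (\<lambda>x. ract M x b) (\<lambda>y. ract N y b') t) s"

definition bullet ::
  "('k::field, 'b, 'm) bialg_scheme \<Rightarrow> ('k, 'b, 'a, 'n) bimod_scheme \<Rightarrow> ('k, 'b, 'c, 'l) bimod_scheme
   \<Rightarrow> ('k, 'b, ('k, 'a, 'c) tens) bimod"
where
  "bullet B M N = vspace.extend (tensor M N) (bimod.fields
     (\<lambda>b\<in>carrier B. \<lambda>t\<in>carrier (tensor M N). lact2 B M N (bcomult B b) t)
     (\<lambda>t\<in>carrier (tensor M N). \<lambda>b\<in>carrier B. ract2 B M N t (bcomult B b)))"

definition unit_I :: "('k::field, 'b, 'm) alg_scheme \<Rightarrow> ('k, 'b, 'b) bimod" where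
  "unit_I B = vspace.extend (vspace.truncate B) (bimod.fields (amult B) (amult B))"

definition unit_J :: "('k::field, 'b, 'm) bialg_scheme \<Rightarrow> ('k, 'b, 'k) bimod" where
  "unit_J B = vspace.extend kspace (bimod.fields
     (\<lambda>b\<in>carrier B. \<lambda>k. bcounit B b * k) (\<lambda>k. \<lambda>b\<in>carrier B. k * bcounit B b))"

text \<open>Interchange law \<open>(A \<bullet> E) \<circ> (C \<bullet> D) \<rightarrow> (A \<circ> C) \<bullet> (E \<circ> D)\<close>.\<close>
definition zeta ::
  "('k::field, 'b, 'm) bialg_scheme \<Rightarrow> ('k, 'b, 'a, 'm1) bimod_scheme
   \<Rightarrow> ('k, 'b, 'e, 'm2) bimod_scheme \<Rightarrow> ('k, 'b, 'c, 'm3) bimod_scheme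
   \<Rightarrow> ('k, 'b, 'd, 'm4) bimod_scheme
   \<Rightarrow> ('k, ('k, 'a, 'e) tens, ('k, 'c, 'd) tens) tens
   \<Rightarrow> ('k, ('k, 'a, 'c) tens, ('k, 'e, 'd) tens) tens"
where
  "zeta B A E C D =
     (let T = tensor (circ B A C) (circ B E D) in
      olift B (bullet B A E) (bullet B C D) T
        (\<lambda>s t. tlift A E T
           (\<lambda>a e. tlift C D T
              (\<lambda>c d. tpure (circ B A C) (circ B E D) (opure B A C a c) (opure B E D e d)) t) s))"

text \<open>\<open>m\<^sub>J : J \<circ> J \<rightarrow> J\<close>.\<close>
definition mult_J :: "('k::field, 'b, 'm) bialg_scheme \<Rightarrow> ('k, 'k, 'k) tens \<Rightarrow> 'k" where
  "mult_J B = olift B (unit_J B) (unit_J B) kspace (\<lambda>k k'. k * k')"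

text \<open>The braiding \<open>\<sigma>(x \<otimes> y) = S\<^sup>-\<^sup>1 (y \<otimes> x) S\<close> for \<open>\<bullet>\<close>.\<close>
definition braiding ::
  "('k::field, 'b, 'm) bialg_scheme \<Rightarrow> ('k, 'b, 'b) tens
   \<Rightarrow> ('k, 'b, 'a, 'n) bimod_scheme \<Rightarrow> ('k, 'b, 'c, 'l) bimod_scheme
   \<Rightarrow> ('k, 'a, 'c) tens \<Rightarrow> ('k, 'c, 'a) tens"
where
  "braiding B S M N = (\<lambda>t\<in>carrier (tensor M N).
     lact2 B N M (alg_inverse (tensor_alg B B) S) (ract2 B N M (tflip M N t) S))"


section \<open>Cocommutative comonoids\<close>

record (overloaded) ('k::zero, 'b, 'a) comon = "('k, 'b, 'a) bimod" +
  comult :: "'a \<Rightarrow> ('k, 'a, 'a) tens"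
  counit :: "'a \<Rightarrow> 'k"

definition is_comon_coc ::
  "('k::field, 'b, 'm) bialg_scheme \<Rightarrow> ('k, 'b, 'b) tens \<Rightarrow> ('k, 'b, 'a, 'n) comon_scheme \<Rightarrow> bool"
where
  "is_comon_coc B S C \<longleftrightarrow>
     is_bimodule B C \<and>
     comult C \<in> bimod_hom B C (bullet B C C) \<and> counit C \<in> bimod_hom B C (unit_J B) \<and>
     is_coalgebra C (comult C) (counit C) \<and>
     (\<forall>x\<in>carrier C. braiding B S C C (comult C x) = comult C x)"

definition comon_hom ::
  "('k::field, 'b, 'm) bialg_scheme \<Rightarrow> ('k, 'b, 'a, 'n) comon_scheme \<Rightarrow> ('k, 'b, 'c, 'l) comon_scheme
   \<Rightarrow> ('a \<Rightarrow> 'c) set"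
where
  "comon_hom B C D = {f \<in> bimod_hom B C D. \<forall>x\<in>carrier C.
     comult D (f x) = tmap C C D D f f (comult C x) \<and> counit D (f x) = counit C x}"

definition comon_circ ::
  "('k::field, 'b, 'm) bialg_scheme \<Rightarrow> ('k, 'b, 'a, 'n) comon_scheme \<Rightarrow> ('k, 'b, 'c, 'l) comon_scheme
   \<Rightarrow> ('k, 'b, ('k, 'a, 'c) tens) comon"
where
  "comon_circ B C D = bimod.extend (circ B C D) (comon.fields
     (compose (carrier (circ B C D)) (zeta B C C D D)
        (omap B C D (bullet B C C) (bullet B D D) (comult C) (comult D)))
     (compose (carrier (circ B C D)) (mult_J B)
        (omap B C D (unit_J B) (unit_J B) (counit C) (counit D))))"

definition comon_I :: "('k::field, 'b, 'm) bialg_scheme \<Rightarrow> ('k, 'b, 'b) comon" where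
  "comon_I B = bimod.extend (unit_I B) (comon.fields (bcomult B) (bcounit B))"

text \<open>The map \<open>C \<bullet> \<sigma> \<bullet> D : (C \<bullet> C) \<bullet> (D \<bullet> D) \<rightarrow> (C \<bullet> D) \<bullet> (C \<bullet> D)\<close>.\<close>
definition mid_braiding ::
  "('k::field, 'b, 'm) bialg_scheme \<Rightarrow> ('k, 'b, 'b) tens
   \<Rightarrow> ('k, 'b, 'a, 'n) bimod_scheme \<Rightarrow> ('k, 'b, 'c, 'l) bimod_scheme
   \<Rightarrow> ('k, ('k, 'a, 'a) tens, ('k, 'c, 'c) tens) tens
   \<Rightarrow> ('k, ('k, 'a, 'c) tens, ('k, 'a, 'c) tens) tens"
where
  "mid_braiding B S C D =
     (let T = tensor (tensor C D) (tensor C D) in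
      tlift (tensor C C) (tensor D D) T
        (\<lambda>s t. tlift C C T
           (\<lambda>c c'. tlift D D T
              (\<lambda>d d'. tlift D C T
                 (\<lambda>y x. tpure (tensor C D) (tensor C D) (tpure C D c y) (tpure C D x d'))
                 (braiding B S C D (tpure C D c' d))) t) s))"

definition comon_bullet ::
  "('k::field, 'b, 'm) bialg_scheme \<Rightarrow> ('k, 'b, 'b) tens
   \<Rightarrow> ('k, 'b, 'a, 'n) comon_scheme \<Rightarrow> ('k, 'b, 'c, 'l) comon_scheme
   \<Rightarrow> ('k, 'b, ('k, 'a, 'c) tens) comon"
where
  "comon_bullet B S C D = bimod.extend (bullet B C D) (comon.fields
     (compose (carrier (bullet B C D)) (mid_braiding B S C D)
        (tmap C D (tensor C C) (tensor D D) (comult C) (comult D)))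
     (tlift C D kspace (\<lambda>x y. counit C x * counit D y)))"

definition comon_J :: "('k::field, 'b, 'm) bialg_scheme \<Rightarrow> ('k, 'b, 'k) comon" where
  "comon_J B = bimod.extend (unit_J B)
     (comon.fields (\<lambda>k. tpure kspace kspace k 1) (\<lambda>k. k))"

text \<open>The reversion \<open>C\<^sup>-\<close>; the element \<open>c\<^sup>-\<close> of \<open>C\<^sup>-\<close> is encoded as \<open>c\<close> itself.\<close>
definition bimod_rev ::
  "('k::field, 'b, 'm) bialg_scheme \<Rightarrow> ('k, 'b, 'a, 'n) bimod_scheme \<Rightarrow> ('k, 'b, 'a) bimod"
where
  "bimod_rev B M = vspace.extend (vspace.truncate M) (bimod.fields
     (\<lambda>b\<in>carrier B. \<lambda>x\<in>carrier M. ract M x (antipode B b))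
     (\<lambda>x\<in>carrier M. \<lambda>b\<in>carrier B. lact M (antipode B b) x))"

definition comon_rev ::
  "('k::field, 'b, 'm) bialg_scheme \<Rightarrow> ('k, 'b, 'a, 'n) comon_scheme \<Rightarrow> ('k, 'b, 'a) comon"
where
  "comon_rev B C = bimod.extend (bimod_rev B C) (comon.fields
     (compose (carrier C) (tflip C C) (comult C)) (counit C))"


section \<open>Internal groups in cocommutative comonoids\<close>

text \<open>
  A bimonoid in the duoidal category of cocommutative comonoids: an object of that category
  (with its own \<open>comult\<close> and \<open>counit\<close>) together with a multiplication and unit for \<open>\<circ>\<close> and a
  second, a priori different, comultiplication and counit for \<open>\<bullet>\<close>, all of them morphisms of
  comonoids.
\<close>

record (overloaded) ('k::zero, 'b, 'a) bimon = "('k, 'b, 'a) comon" +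
  hmult :: "('k, 'a, 'a) tens \<Rightarrow> 'a"
  hunit :: "'b \<Rightarrow> 'a"
  hcomult :: "'a \<Rightarrow> ('k, 'a, 'a) tens"
  hcounit :: "'a \<Rightarrow> 'k"

definition is_bimonoid ::
  "('k::field, 'b, 'm) bialg_scheme \<Rightarrow> ('k, 'b, 'b) tens \<Rightarrow> ('k, 'b, 'a, 'n) bimon_scheme \<Rightarrow> bool"
where
  "is_bimonoid B S H \<longleftrightarrow>
     is_comon_coc B S H \<and>
     \<comment> \<open>monoid for \<open>\<circ>\<close>\<close>
     hmult H \<in> comon_hom B (comon_circ B H H) H \<and>
     hunit H \<in> comon_hom B (comon_I B) H \<and>
     (\<forall>x\<in>carrier H. \<forall>y\<in>carrier H. \<forall>z\<in>carrier H.
        hmult H (opure B H H (hmult H (opure B H H x y)) z)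
          = hmult H (opure B H H x (hmult H (opure B H H y z)))) \<and>
     (\<forall>b\<in>carrier B. \<forall>x\<in>carrier H.
        hmult H (opure B H H (hunit H b) x) = lact H b x \<and>
        hmult H (opure B H H x (hunit H b)) = ract H x b) \<and>
     \<comment> \<open>comonoid for \<open>\<bullet>\<close>\<close>
     hcomult H \<in> comon_hom B H (comon_bullet B S H H) \<and>
     hcounit H \<in> comon_hom B H (comon_J B) \<and>
     is_coalgebra H (hcomult H) (hcounit H) \<and>
     \<comment> \<open>compatibility\<close>
     (\<forall>t\<in>carrier (circ B H H).
        hcomult H (hmult H t)
          = tmap (circ B H H) (circ B H H) H H (hmult H) (hmult H)
              (zeta B H H H H
                 (omap B H H (bullet B H H) (bullet B H H) (hcomult H) (hcomult H) t)) \<and>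
        hcounit H (hmult H t)
          = mult_J B (omap B H H (unit_J B) (unit_J B) (hcounit H) (hcounit H) t)) \<and>
     (\<forall>b\<in>carrier B.
        hcomult H (hunit H b) = tmap B B H H (hunit H) (hunit H) (bcomult B b) \<and>
        hcounit H (hunit H b) = bcounit B b)"

definition bimonoid_hom ::
  "('k::field, 'b, 'm) bialg_scheme \<Rightarrow> ('k, 'b, 'a, 'n) bimon_scheme \<Rightarrow> ('k, 'b, 'c, 'l) bimon_scheme
   \<Rightarrow> ('a \<Rightarrow> 'c) set"
where
  "bimonoid_hom B H K = {f \<in> comon_hom B H K.
     (\<forall>t\<in>carrier (circ B H H). f (hmult H t) = hmult K (omap B H H K K f f t)) \<and>
     (\<forall>b\<in>carrier B. f (hunit H b) = hunit K b) \<and>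
     (\<forall>x\<in>carrier H. hcomult K (f x) = tmap H H K K f f (hcomult H x)) \<and>
     (\<forall>x\<in>carrier H. hcounit K (f x) = hcounit H x)}"

text \<open>\<open>\<phi> : X \<bullet> Y\<^sup>- \<rightarrow> ((X \<circ> Y) \<bullet> I) \<circ> J\<close> and \<open>\<psi> : X\<^sup>- \<bullet> Y \<rightarrow> J \<circ> (I \<bullet> (X \<circ> Y))\<close>.\<close>

definition rev_phi ::
  "('k::field, 'b, 'm) bialg_scheme \<Rightarrow> ('k, 'b, 'a, 'n) bimod_scheme \<Rightarrow> ('k, 'b, 'c, 'l) bimod_scheme
   \<Rightarrow> ('k, 'a, 'c) tens \<Rightarrow> ('k, ('k, ('k, 'a, 'c) tens, 'b) tens, 'k) tens"
where
  "rev_phi B X Y =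
     tlift X (bimod_rev B Y) (ospace B (bullet B (circ B X Y) (unit_I B)) (unit_J B))
       (\<lambda>x y. opure B (bullet B (circ B X Y) (unit_I B)) (unit_J B)
          (tpure (circ B X Y) (unit_I B) (opure B X Y x y) (aone B)) 1)"

definition rev_psi ::
  "('k::field, 'b, 'm) bialg_scheme \<Rightarrow> ('k, 'b, 'a, 'n) bimod_scheme \<Rightarrow> ('k, 'b, 'c, 'l) bimod_scheme
   \<Rightarrow> ('k, 'a, 'c) tens \<Rightarrow> ('k, 'k, ('k, 'b, ('k, 'a, 'c) tens) tens) tens"
where
  "rev_psi B X Y =
     tlift (bimod_rev B X) Y (ospace B (unit_J B) (bullet B (unit_I B) (circ B X Y)))
       (\<lambda>x y. opure B (unit_J B) (bullet B (unit_I B) (circ B X Y)) 1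
          (tpure (unit_I B) (circ B X Y) (aone B) (opure B X Y x y)))"

definition is_hopf_monoid ::
  "('k::field, 'b, 'm) bialg_scheme \<Rightarrow> ('k, 'b, 'b) tens \<Rightarrow> ('k, 'b, 'a, 'n) bimon_scheme \<Rightarrow> bool"
where
  "is_hopf_monoid B S H \<longleftrightarrow> is_bimonoid B S H \<and>
     (\<exists>\<Sigma>\<in>comon_hom B H (comon_rev B H). \<forall>h\<in>carrier H.
        \<comment> \<open>\<open>((m \<bullet> I) \<circ> J) \<phi> (h\<^sub>1 \<bullet> \<Sigma> h\<^sub>2) = \<epsilon>(h) (1\<^sub>H \<bullet> 1\<^sub>B) \<circ> 1\<close>\<close>
        omap B (bullet B (circ B H H) (unit_I B)) (unit_J B) (bullet B H (unit_I B)) (unit_J B)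
          (tmap (circ B H H) (unit_I B) H (unit_I B) (hmult H) (\<lambda>b. b)) (\<lambda>k. k)
          (rev_phi B H H (tmap H H H (bimod_rev B H) (\<lambda>x. x) \<Sigma> (hcomult H h)))
        = vscale (circ B (bullet B H (unit_I B)) (unit_J B)) (hcounit H h)
            (opure B (bullet B H (unit_I B)) (unit_J B)
               (tpure H (unit_I B) (hunit H (aone B)) (aone B)) 1) \<and>
        \<comment> \<open>\<open>(J \<circ> (I \<bullet> m)) \<psi> (\<Sigma> h\<^sub>1 \<bullet> h\<^sub>2) = \<epsilon>(h) 1 \<circ> (1\<^sub>B \<bullet> 1\<^sub>H)\<close>\<close>
        omap B (unit_J B) (bullet B (unit_I B) (circ B H H)) (unit_J B) (bullet B (unit_I B) H)
          (\<lambda>k. k) (tmap (unit_I B) (circ B H H) (unit_I B) H (\<lambda>b. b) (hmult H))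
          (rev_psi B H H (tmap H H (bimod_rev B H) H \<Sigma> (\<lambda>x. x) (hcomult H h)))
        = vscale (circ B (unit_J B) (bullet B (unit_I B) H)) (hcounit H h)
            (opure B (unit_J B) (bullet B (unit_I B) H) 1
               (tpure (unit_I B) H (aone B) (hunit H (aone B)))))"

text \<open>\<open>Grp(Comon\<^sub>c\<^sub>o\<^sub>c(C\<^sup>\<bullet>), \<circ>, I)\<close> for the bimodules over \<open>(B, S)\<close> with underlying sets in \<open>'a\<close>.\<close>
definition Grp_Comon_coc ::
  "('k::field, 'b) bialg \<Rightarrow> ('k, 'b, 'b) tens \<Rightarrow> (('k, 'b, 'a) bimon, 'a \<Rightarrow> 'a) precategory"
where
  "Grp_Comon_coc B S =
     \<lparr>Obj = {H. is_hopf_monoid B S H},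
      Hom = bimonoid_hom B,
      Id = (\<lambda>H. \<lambda>x\<in>carrier H. x),
      Comp = (\<lambda>H _ _ g f. compose (carrier H) g f)\<rparr>"

end

theory Submission
  imports Defs "HOL-Algebra.FiniteProduct"
begin

text \<open>
  A monoid for \<open>\<circ>\<close> in the bimodules over \<open>B\<close> is an algebra \<open>H\<close> with an algebra map \<open>f : B \<rightarrow> H\<close>, and
  the unit laws force both actions of \<open>B\<close> to come from \<open>f\<close>. Multiplication and unit being
  morphisms of comonoids makes \<open>H\<close> a bialgebra and \<open>f\<close> a bialgebra map. The second comonoid structure
  of an internal bimonoid coincides with the given one by an Eckmann--Hilton argument, which uses
  \<open>(\<epsilon> \<otimes> \<epsilon>)(S) = 1\<close>.

  Put \<open>R = (f \<otimes> f)(S)\<close>. Cocommutativity with respect to the braiding says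
  \<open>R\<^sup>-\<^sup>1 \<Delta>\<^sup>o\<^sup>p R = \<Delta>\<close>, the only axiom of a triangular structure on \<open>H\<close> that is not inherited from \<open>S\<close>.
  The linear maps \<open>(h \<bullet> b) \<circ> k \<mapsto> k h f(b')\<close> and \<open>k \<circ> (b \<bullet> h) \<mapsto> k f(b') h\<close>, where \<open>b'\<close> is the
  antipode of \<open>b\<close>, turn the two antipode axioms of a Hopf monoid into the usual ones. Conversely the
  antipode of \<open>H\<close> is a morphism \<open>H \<rightarrow> H\<^sup>-\<close> because it reverses products and coproducts and commutes with \<open>f\<close>.

  Identities between maps on tensor products are proved in Sweedler style: \<open>\<Sum> F h\<^sub>1 h\<^sub>2\<close> is
  \<open>tlift H H U F (bcomult H h)\<close>, iterated coproducts are nested \<open>tlift\<close>s, and linear maps commute with \<open>tlift\<close>.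
\<close>

section \<open>Vector spaces\<close>

text \<open>The isomorphism is strict: objects must agree as records and arrows as functions. Arrows
  never change, since morphisms on both sides turn out to be the same functions; the categorical
  part is thus a bijection of objects and an equality of homsets. That the bijection holds on the
  nose rests on the extensionality of all structure maps. Two obstacles shape the preparations.
  First, \<open>lift\<close> is a definite description and says nothing until a linear map with the
  prescribed values exists; \<open>adm\<close> asserts this existence, and every Sweedler
  manipulation is conditional on it. Second, one vector space underlies records of many types, and
  tensor products formed from them have to be recognised as equal; \<open>same_vs\<close> serves for
  that. The condition on \<open>\<Delta>\<close> is the one not inherited because it ranges over all
  of \<open>H\<close>, whereas the other axioms concern \<open>R\<close> alone, which comes from
  \<open>S\<close>. The antipode of \<open>B\<close> enters the two splitting maps because it makes
  them balanced over \<open>J\<close>: it turns the action of \<open>b\<close> into multiplication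
  by \<open>\<epsilon>(b)\<close>.\<close>

lemma add_group_simps [simp]:
  "carrier (add_group V) = carrier V" "mult (add_group V) = vadd V" "one (add_group V) = vzero V"
  by (simp_all add: add_group_def)

lemma vspace_comm_group: "is_vspace V \<Longrightarrow> comm_group (add_group V)"
  by (simp add: is_vspace_def)

lemma vadd_closed [simp]:
  "is_vspace V \<Longrightarrow> x \<in> carrier V \<Longrightarrow> y \<in> carrier V \<Longrightarrow> vadd V x y \<in> carrier V"
  by (auto simp: is_vspace_def PiE_iff)

lemma vscale_closed [simp]:
  "is_vspace V \<Longrightarrow> x \<in> carrier V \<Longrightarrow> vscale V c x \<in> carrier V"
  by (auto simp: is_vspace_def PiE_iff)

lemma vzero_closed [simp]: "is_vspace V \<Longrightarrow> vzero V \<in> carrier V"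
  using monoid.one_closed[of "add_group V"]
  by (simp add: is_vspace_def comm_group_def group.is_monoid)

lemma vadd_assoc:
  "is_vspace V \<Longrightarrow> x \<in> carrier V \<Longrightarrow> y \<in> carrier V \<Longrightarrow> z \<in> carrier V \<Longrightarrow>
    vadd V (vadd V x y) z = vadd V x (vadd V y z)"
proof -
  assume V: "is_vspace V" and *: "x \<in> carrier V" "y \<in> carrier V" "z \<in> carrier V"
  interpret comm_group "add_group V" using V by (rule vspace_comm_group)
  show ?thesis using m_assoc[of x y z] * by simp
qed

lemma vadd_comm:
  "is_vspace V \<Longrightarrow> x \<in> carrier V \<Longrightarrow> y \<in> carrier V \<Longrightarrow> vadd V x y = vadd V y x"
proof -
  assume V: "is_vspace V" and *: "x \<in> carrier V" "y \<in> carrier V"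
  interpret comm_group "add_group V" using V by (rule vspace_comm_group)
  show ?thesis using m_comm[of x y] * by simp
qed

lemma vadd_left_comm:
  assumes "is_vspace V" "x \<in> carrier V" "y \<in> carrier V" "z \<in> carrier V"
  shows "vadd V x (vadd V y z) = vadd V y (vadd V x z)"
  using vadd_assoc[OF assms] vadd_assoc[OF assms(1,3,2,4)] vadd_comm[OF assms(1-3)] by simp

lemma vadd_zero [simp]:
  assumes "is_vspace V" "x \<in> carrier V"
  shows "vadd V (vzero V) x = x" "vadd V x (vzero V) = x"
proof -
  interpret comm_group "add_group V" using assms by (simp add: vspace_comm_group)
  show "vadd V (vzero V) x = x" "vadd V x (vzero V) = x" using l_one[of x] r_one[of x] assms by simp_all
qed

lemma vadd_eq_self:
  assumes "is_vspace V" "x \<in> carrier V" "y \<in> carrier V" "vadd V x y = y"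
  shows "x = vzero V"
proof -
  interpret comm_group "add_group V" using assms by (simp add: vspace_comm_group)
  show ?thesis using r_cancel_one[of y x] assms by simp
qed

lemma vscale_add:
  "is_vspace V \<Longrightarrow> x \<in> carrier V \<Longrightarrow> y \<in> carrier V \<Longrightarrow>
    vscale V c (vadd V x y) = vadd V (vscale V c x) (vscale V c y)"
  by (simp add: is_vspace_def)

lemma vscale_add_left:
  "is_vspace V \<Longrightarrow> x \<in> carrier V \<Longrightarrow> vscale V (c + d) x = vadd V (vscale V c x) (vscale V d x)"
  by (simp add: is_vspace_def)

lemma vscale_mult:
  "is_vspace V \<Longrightarrow> x \<in> carrier V \<Longrightarrow> vscale V (c * d) x = vscale V c (vscale V d x)"
  by (simp add: is_vspace_def)

lemma vscale_commute:
  "is_vspace V \<Longrightarrow> x \<in> carrier V \<Longrightarrow> vscale V c (vscale V d x) = vscale V d (vscale V c x)"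
  by (simp add: mult.commute flip: vscale_mult)

lemma vscale_one [simp]: "is_vspace V \<Longrightarrow> x \<in> carrier V \<Longrightarrow> vscale V 1 x = x"
  by (simp add: is_vspace_def)

lemma vscale_0 [simp]: "is_vspace V \<Longrightarrow> x \<in> carrier V \<Longrightarrow> vscale V 0 x = vzero V"
  using vscale_add_left[of V x 0 0] vadd_eq_self[of V "vscale V 0 x" "vscale V 0 x"] by simp

lemma vscale_zero [simp]: "is_vspace V \<Longrightarrow> vscale V c (vzero V) = vzero V"
  using vscale_mult[of V "vzero V" c 0] by simp

lemma is_vspace_kspace [simp]: "is_vspace (kspace :: ('k::field, 'k) vspace)"
proof -
  have "comm_group (add_group (kspace :: ('k, 'k) vspace))"
  proof (rule comm_groupI)
    fix x :: 'k
    show "\<exists>y\<in>carrier (add_group kspace). y \<otimes>\<^bsub>add_group kspace\<^esub> x = \<one>\<^bsub>add_group kspace\<^esub>"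
      by (rule bexI[of _ "- x"]) (simp_all add: kspace_def)
  qed (simp_all add: kspace_def)
  then show ?thesis
    by (simp add: is_vspace_def) (simp add: kspace_def distrib_left distrib_right)
qed

lemma kspace_simps [simp]:
  "carrier kspace = UNIV" "vadd kspace = (+)" "vzero kspace = 0" "vscale kspace = (*)"
  by (simp_all add: kspace_def)

text \<open>
  Linearity on the carrier, without extensionality, and with the vector space axioms for source
  and target built in, so that checking linearity of a composite is purely syntax directed.
\<close>

definition lmap ::
  "('k::field, 'a, 'm) vspace_scheme \<Rightarrow> ('k, 'b, 'n) vspace_scheme \<Rightarrow> ('a \<Rightarrow> 'b) \<Rightarrow> bool"
where
  "lmap V W f \<longleftrightarrow> is_vspace V \<and> is_vspace W \<and> (\<forall>x\<in>carrier V. f x \<in> carrier W) \<and>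
     (\<forall>x\<in>carrier V. \<forall>y\<in>carrier V. f (vadd V x y) = vadd W (f x) (f y)) \<and>
     (\<forall>c. \<forall>x\<in>carrier V. f (vscale V c x) = vscale W c (f x))"

definition bil ::
  "('k::field, 'a, 'm) vspace_scheme \<Rightarrow> ('k, 'b, 'n) vspace_scheme \<Rightarrow> ('k, 'c, 'l) vspace_scheme
   \<Rightarrow> ('a \<Rightarrow> 'b \<Rightarrow> 'c) \<Rightarrow> bool"
where
  "bil V W U f \<longleftrightarrow> (\<forall>x\<in>carrier V. lmap W U (\<lambda>y. f x y)) \<and> (\<forall>y\<in>carrier W. lmap V U (\<lambda>x. f x y))"

lemma lmap_vspace: "lmap V W f \<Longrightarrow> is_vspace V" "lmap V W f \<Longrightarrow> is_vspace W"
  by (simp_all add: lmap_def)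

lemma lmap_closed: "lmap V W f \<Longrightarrow> x \<in> carrier V \<Longrightarrow> f x \<in> carrier W"
  by (simp add: lmap_def)

lemma lmap_add:
  "lmap V W f \<Longrightarrow> x \<in> carrier V \<Longrightarrow> y \<in> carrier V \<Longrightarrow> f (vadd V x y) = vadd W (f x) (f y)"
  by (simp add: lmap_def)

lemma lmap_scale: "lmap V W f \<Longrightarrow> x \<in> carrier V \<Longrightarrow> f (vscale V c x) = vscale W c (f x)"
  by (simp add: lmap_def)

lemma lmap_zero: "lmap V W f \<Longrightarrow> f (vzero V) = vzero W"
  using lmap_scale[of V W f "vzero V" 0] lmap_closed[of V W f "vzero V"] lmap_vspace[of V W f] by simp

lemma lin_iff_lmap:
  "is_vspace V \<Longrightarrow> is_vspace W \<Longrightarrow> f \<in> lin V W \<longleftrightarrow> lmap V W f \<and> f \<in> extensional (carrier V)"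
  by (auto simp: lin_def lmap_def PiE_iff)

lemma lmap_of_lin: "f \<in> lin V W \<Longrightarrow> is_vspace V \<Longrightarrow> is_vspace W \<Longrightarrow> lmap V W f"
  by (simp add: lin_iff_lmap)

lemma lmap_cong: "lmap V W f \<Longrightarrow> (\<And>x. x \<in> carrier V \<Longrightarrow> f x = g x) \<Longrightarrow> lmap V W g"
  by (auto simp: lmap_def)

lemma lmap_id: "is_vspace V \<Longrightarrow> lmap V V (\<lambda>x. x)"
  by (simp add: lmap_def)

lemma lmap_comp: "lmap V W g \<Longrightarrow> lmap X V h \<Longrightarrow> lmap X W (\<lambda>x. g (h x))"
  by (auto simp: lmap_def)

lemma lmap_vscale: "lmap X V h \<Longrightarrow> lmap X V (\<lambda>x. vscale V c (h x))"
  by (simp add: lmap_def vscale_add vscale_commute[of V _ c])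

lemma lmap_vscale_left: "lmap X kspace h \<Longrightarrow> v \<in> carrier V \<Longrightarrow> is_vspace V \<Longrightarrow> lmap X V (\<lambda>x. vscale V (h x) v)"
  by (auto simp: lmap_def vscale_add_left vscale_mult)

lemma lmap_vadd:
  assumes "lmap X V g" "lmap X V h"
  shows "lmap X V (\<lambda>x. vadd V (g x) (h x))"
proof -
  have V: "is_vspace V" using assms by (simp add: lmap_def)
  have *: "vadd V (vadd V a b) (vadd V c d) = vadd V (vadd V a c) (vadd V b d)"
    if "a \<in> carrier V" "b \<in> carrier V" "c \<in> carrier V" "d \<in> carrier V" for a b c d
    using that V vadd_left_comm[OF V that(2,3,4)] by (simp add: vadd_assoc)
  show ?thesis using assms V by (simp add: lmap_def vscale_add *)
qed

lemma lmap_times: "lmap X kspace h \<Longrightarrow> lmap X kspace (\<lambda>x. c * h x)"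
  "lmap X kspace h \<Longrightarrow> lmap X kspace (\<lambda>x. h x * c)"
  by (simp_all add: lmap_def distrib_left distrib_right mult.assoc mult.left_commute)

lemma bilI:
  "(\<And>x. x \<in> carrier V \<Longrightarrow> lmap W U (\<lambda>y. f x y)) \<Longrightarrow>
   (\<And>y. y \<in> carrier W \<Longrightarrow> lmap V U (\<lambda>x. f x y)) \<Longrightarrow> bil V W U f"
  by (simp add: bil_def)

lemma bil_lmap1: "bil V W U f \<Longrightarrow> y \<in> carrier W \<Longrightarrow> lmap V U (\<lambda>x. f x y)"
  by (simp add: bil_def)

lemma bil_lmap2: "bil V W U f \<Longrightarrow> x \<in> carrier V \<Longrightarrow> lmap W U (\<lambda>y. f x y)"
  by (simp add: bil_def)

lemma bil_closed: "bil V W U f \<Longrightarrow> x \<in> carrier V \<Longrightarrow> y \<in> carrier W \<Longrightarrow> f x y \<in> carrier U"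
  by (simp add: bil_def lmap_def)

lemma bilinear_iff_bil:
  assumes "is_vspace V" "is_vspace W" "is_vspace U"
  shows "bilinear V W U f \<longleftrightarrow> bil V W U f \<and> f \<in> carrier V \<rightarrow>\<^sub>E carrier W \<rightarrow>\<^sub>E carrier U"
proof -
  have 1: "(\<lambda>x\<in>carrier V. f x y) \<in> lin V U \<longleftrightarrow> lmap V U (\<lambda>x. f x y)" for y
    using lmap_cong[of V U "\<lambda>x\<in>carrier V. f x y" "\<lambda>x. f x y"]
      lmap_cong[of V U "\<lambda>x. f x y" "\<lambda>x\<in>carrier V. f x y"]
    by (simp add: lin_iff_lmap assms) blast
  have 2: "f x \<in> lin W U \<longleftrightarrow> lmap W U (f x)" if "f \<in> carrier V \<rightarrow>\<^sub>E carrier W \<rightarrow>\<^sub>E carrier U" "x \<in> carrier V" for x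
    using that by (simp add: lin_iff_lmap assms PiE_iff)
  show ?thesis
    unfolding bilinear_def bil_def 1 using 2 by blast
qed

section \<open>Tensor products\<close>

lemma lookup_fscale [simp]: "Poly_Mapping.lookup (fscale c p) k = c * Poly_Mapping.lookup p k"
  by (cases "Poly_Mapping.lookup p k = 0") (simp_all add: fscale_def Poly_Mapping.map.rep_eq when_def)

interpretation fs: module "fscale :: 'k::field \<Rightarrow> ('i \<Rightarrow>\<^sub>0 'k) \<Rightarrow> _"
  by unfold_locales (auto intro!: poly_mapping_eqI simp: lookup_add algebra_simps)

lemma keys_fscale: "Poly_Mapping.keys (fscale c p) \<subseteq> Poly_Mapping.keys p"
  by (auto simp: in_keys_iff)

lemma keys_gen [simp]: "Poly_Mapping.keys (gen x y :: _ \<Rightarrow>\<^sub>0 'k::field) = {(x, y)}"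
  by (simp add: gen_def)

text \<open>Terms with a key outside the carriers are dropped. The value then lies in
  \<open>carrier U\<close> for every formal sum, and additivity and homogeneity hold without a
  condition on the keys, which suits the span induction over \<open>tnull\<close>.\<close>

definition free_ext ::
  "('k::field, 'a, 'm) vspace_scheme \<Rightarrow> ('k, 'b, 'n) vspace_scheme \<Rightarrow> ('k, 'c, 'l) vspace_scheme
   \<Rightarrow> ('a \<Rightarrow> 'b \<Rightarrow> 'c) \<Rightarrow> ('a \<times> 'b \<Rightarrow>\<^sub>0 'k) \<Rightarrow> 'c"
where
  "free_ext V W U f p = finprod (add_group U)
     (\<lambda>k. vscale U (Poly_Mapping.lookup p k) (f (fst k) (snd k)))
     (Poly_Mapping.keys p \<inter> carrier V \<times> carrier W)"

context
  fixes V :: "('k::field, 'a, 'm) vspace_scheme" and W :: "('k, 'b, 'n) vspace_scheme"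
    and U :: "('k, 'c, 'l) vspace_scheme" and f
  assumes U: "is_vspace U" and f: "\<And>x y. x \<in> carrier V \<Longrightarrow> y \<in> carrier W \<Longrightarrow> f x y \<in> carrier U"
begin

interpretation comm_group "add_group U" using U by (rule vspace_comm_group)

text \<open>Two formal sums have different supports; enlarging both to a common finite index set
  costs only zero summands and makes their values comparable.\<close>

lemma free_ext_superset:
  assumes "finite A" "Poly_Mapping.keys p \<subseteq> A"
  shows "free_ext V W U f p = finprod (add_group U)
     (\<lambda>k. vscale U (Poly_Mapping.lookup p k) (f (fst k) (snd k))) (A \<inter> carrier V \<times> carrier W)"
  unfolding free_ext_def
  by (rule finprod_mono_neutral_cong_left) (use assms U f in \<open>auto simp: in_keys_iff\<close>)

lemma free_ext_term_closed:
  "(\<lambda>k. vscale U (Poly_Mapping.lookup p k) (f (fst k) (snd k))) \<in> A \<inter> carrier V \<times> carrier W \<rightarrow> carrier U"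
  using U f by auto

lemma free_ext_closed: "free_ext V W U f p \<in> carrier U"
  using finprod_closed[of "\<lambda>k. vscale U (Poly_Mapping.lookup p k) (f (fst k) (snd k))"
      "Poly_Mapping.keys p \<inter> carrier V \<times> carrier W"] free_ext_term_closed[of p]
  by (simp add: free_ext_def)

lemma free_ext_add: "free_ext V W U f (p + q) = vadd U (free_ext V W U f p) (free_ext V W U f q)"
proof -
  let ?A = "Poly_Mapping.keys p \<union> Poly_Mapping.keys q"
  let ?g = "\<lambda>p k. vscale U (Poly_Mapping.lookup p k) (f (fst k) (snd k))"
  let ?D = "?A \<inter> carrier V \<times> carrier W"
  have "free_ext V W U f (p + q) = finprod (add_group U) (?g (p + q)) ?D"
    by (rule free_ext_superset) (simp_all add: Poly_Mapping.keys_add)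
  also have "\<dots> = finprod (add_group U) (\<lambda>k. vadd U (?g p k) (?g q k)) ?D"
    using U f by (intro finprod_cong') (auto simp: lookup_add vscale_add_left)
  also have "\<dots> = vadd U (finprod (add_group U) (?g p) ?D) (finprod (add_group U) (?g q) ?D)"
    using finprod_multf[of "?g p" ?D "?g q"] free_ext_term_closed by simp
  also have "finprod (add_group U) (?g p) ?D = free_ext V W U f p"
    by (rule free_ext_superset[symmetric]) simp_all
  also have "finprod (add_group U) (?g q) ?D = free_ext V W U f q"
    by (rule free_ext_superset[symmetric]) simp_all
  finally show ?thesis .
qed

lemma free_ext_fscale: "free_ext V W U f (fscale c p) = vscale U c (free_ext V W U f p)"
proof -
  have *: "vscale U c (finprod (add_group U) g A) = finprod (add_group U) (\<lambda>k. vscale U c (g k)) A"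
    if "finite A" "\<forall>k\<in>A. g k \<in> carrier U" for A :: "('a \<times> 'b) set" and g
    using that
  proof (induction A)
    case (insert a A)
    then have "finprod (add_group U) g A \<in> carrier U"
      using finprod_closed[of g A] by auto
    then show ?case using insert U by (auto simp: finprod_insert Pi_iff vscale_add)
  qed (use U in simp)
  have "free_ext V W U f (fscale c p) = finprod (add_group U)
     (\<lambda>k. vscale U (Poly_Mapping.lookup (fscale c p) k) (f (fst k) (snd k)))
     (Poly_Mapping.keys p \<inter> carrier V \<times> carrier W)"
    by (rule free_ext_superset) (simp_all add: keys_fscale)
  also have "\<dots> = finprod (add_group U)
     (\<lambda>k. vscale U c (vscale U (Poly_Mapping.lookup p k) (f (fst k) (snd k))))
     (Poly_Mapping.keys p \<inter> carrier V \<times> carrier W)"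
    using U f by (intro finprod_cong') (auto simp: vscale_mult)
  also have "\<dots> = vscale U c (free_ext V W U f p)"
    unfolding free_ext_def by (rule *[symmetric]) (use U f in auto)
  finally show ?thesis .
qed

lemma free_ext_gen:
  "x \<in> carrier V \<Longrightarrow> y \<in> carrier W \<Longrightarrow> free_ext V W U f (gen x y) = f x y"
proof -
  assume *: "x \<in> carrier V" "y \<in> carrier W"
  then have "{(x, y)} \<inter> carrier V \<times> carrier W = {(x, y)}" by auto
  then show ?thesis using * U f
    by (simp add: free_ext_def finprod_insert Pi_iff) (simp add: gen_def)
qed

lemma free_ext_zero: "free_ext V W U f 0 = vzero U"
  by (simp add: free_ext_def)

text \<open>Each generating relation \<open>r\<close> is a difference of formal sums, while
  \<open>vspace\<close> has no field for subtraction. Writing it as \<open>r + p = q\<close> lets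
  cancellation in \<open>U\<close> show that \<open>r\<close> is sent to zero.\<close>

lemma free_ext_eq_zero:
  assumes "r + p = q" "free_ext V W U f q = free_ext V W U f p"
  shows "free_ext V W U f r = vzero U"
  using assms free_ext_add[of r p] U free_ext_closed
  by (intro vadd_eq_self[of U _ "free_ext V W U f p"]) simp_all

end

section \<open>Cosets modulo the relations\<close>

lemma tnull_zero: "0 \<in> tnull E V W"
  by (simp add: tnull_def fs.span_zero)

lemma tnull_add: "m \<in> tnull E V W \<Longrightarrow> n \<in> tnull E V W \<Longrightarrow> m + n \<in> tnull E V W"
  by (simp add: tnull_def fs.span_add)

lemma tnull_diff: "m \<in> tnull E V W \<Longrightarrow> n \<in> tnull E V W \<Longrightarrow> m - n \<in> tnull E V W"
  by (simp add: tnull_def fs.span_diff)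

lemma tnull_fscale: "m \<in> tnull E V W \<Longrightarrow> fscale c m \<in> tnull E V W"
  by (simp add: tnull_def fs.span_scale)

lemma tcoset_eq_iff: "tcoset E V W p = tcoset E V W q \<longleftrightarrow> p - q \<in> tnull E V W"
proof
  assume "tcoset E V W p = tcoset E V W q"
  moreover have "p \<in> tcoset E V W p" using tnull_zero by (force simp: tcoset_def)
  ultimately show "p - q \<in> tnull E V W" by (auto simp: tcoset_def)
next
  assume *: "p - q \<in> tnull E V W"
  have "p + n \<in> tcoset E V W q" if "n \<in> tnull E V W" for n
  proof -
    have "p + n = q + (p - q + n)" by simp
    then show ?thesis using tnull_add[OF * that] unfolding tcoset_def by blast
  qed
  moreover have "q + n \<in> tcoset E V W p" if "n \<in> tnull E V W" for n
  proof -
    have "q + n = p + (n - (p - q))" by simp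
    then show ?thesis using tnull_diff[OF that *] unfolding tcoset_def by blast
  qed
  ultimately show "tcoset E V W p = tcoset E V W q" by (auto simp: tcoset_def)
qed

lemma mem_tcoset_iff: "p \<in> tcoset E V W q \<longleftrightarrow> p - q \<in> tnull E V W"
  unfolding tcoset_def by (auto intro: exI[of _ "p - q"])

lemma tcoset_add: "{p + q | p q. p \<in> tcoset E V W a \<and> q \<in> tcoset E V W b} = tcoset E V W (a + b)"
proof (intro equalityI subsetI)
  fix r assume "r \<in> {p + q | p q. p \<in> tcoset E V W a \<and> q \<in> tcoset E V W b}"
  then obtain p q where r: "r = p + q" "p - a \<in> tnull E V W" "q - b \<in> tnull E V W"
    by (auto simp: mem_tcoset_iff)
  then have "r - (a + b) = (p - a) + (q - b)" by simp
  then show "r \<in> tcoset E V W (a + b)" using r tnull_add by (metis mem_tcoset_iff)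
next
  fix r assume "r \<in> tcoset E V W (a + b)"
  then have "r - b \<in> tcoset E V W a" by (simp add: mem_tcoset_iff diff_diff_eq add.commute)
  moreover have "b \<in> tcoset E V W b" by (simp add: mem_tcoset_iff tnull_zero)
  ultimately show "r \<in> {p + q | p q. p \<in> tcoset E V W a \<and> q \<in> tcoset E V W b}"
    by (intro CollectI exI[of _ "r - b"] exI[of _ b]) simp
qed

lemma tcoset_fscale:
  "{fscale c p + n | p n. p \<in> tcoset E V W a \<and> n \<in> tnull E V W} = tcoset E V W (fscale c a)"
proof (intro equalityI subsetI)
  fix r assume "r \<in> {fscale c p + n | p n. p \<in> tcoset E V W a \<and> n \<in> tnull E V W}"
  then obtain p n where r: "r = fscale c p + n" "p - a \<in> tnull E V W" "n \<in> tnull E V W"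
    by (auto simp: mem_tcoset_iff)
  then have "r - fscale c a = fscale c (p - a) + n" by (simp add: fs.scale_right_diff_distrib)
  then show "r \<in> tcoset E V W (fscale c a)" using r tnull_add tnull_fscale by (metis mem_tcoset_iff)
next
  fix r assume "r \<in> tcoset E V W (fscale c a)"
  moreover have "a \<in> tcoset E V W a" by (simp add: mem_tcoset_iff tnull_zero)
  ultimately show "r \<in> {fscale c p + n | p n. p \<in> tcoset E V W a \<and> n \<in> tnull E V W}"
    by (intro CollectI exI[of _ "a"] exI[of _ "r - fscale c a"]) (simp add: mem_tcoset_iff)
qed

lemma carrier_tspace:
  "carrier (tspace E V W) = tcoset E V W ` {p. Poly_Mapping.keys p \<subseteq> carrier V \<times> carrier W}"
  by (simp add: tspace_def Let_def)

lemma vzero_tspace: "vzero (tspace E V W) = tcoset E V W 0"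
  by (simp add: tspace_def Let_def tcoset_def)

lemma vadd_tspace:
  "Poly_Mapping.keys p \<subseteq> carrier V \<times> carrier W \<Longrightarrow> Poly_Mapping.keys q \<subseteq> carrier V \<times> carrier W \<Longrightarrow>
   vadd (tspace E V W) (tcoset E V W p) (tcoset E V W q) = tcoset E V W (p + q)"
  by (simp add: tspace_def Let_def tcoset_add)

lemma vscale_tspace:
  "Poly_Mapping.keys p \<subseteq> carrier V \<times> carrier W \<Longrightarrow>
   vscale (tspace E V W) c (tcoset E V W p) = tcoset E V W (fscale c p)"
  by (simp add: tspace_def Let_def tcoset_fscale)

lemma keys_add_subset: "Poly_Mapping.keys p \<subseteq> A \<Longrightarrow> Poly_Mapping.keys q \<subseteq> A \<Longrightarrow> Poly_Mapping.keys (p + q) \<subseteq> A"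
  using Poly_Mapping.keys_add[of p q] by blast

lemma keys_fscale_subset: "Poly_Mapping.keys p \<subseteq> A \<Longrightarrow> Poly_Mapping.keys (fscale c p) \<subseteq> A"
  using keys_fscale[of c p] by blast

lemma tcoset_closed:
  "Poly_Mapping.keys p \<subseteq> carrier V \<times> carrier W \<Longrightarrow> tcoset E V W p \<in> carrier (tspace E V W)"
  by (simp add: carrier_tspace)

lemma tspace_extensional:
  "vadd (tspace E V W) \<in> extensional (carrier (tspace E V W))"
  "s \<in> carrier (tspace E V W) \<Longrightarrow> vadd (tspace E V W) s \<in> extensional (carrier (tspace E V W))"
  "vscale (tspace E V W) c \<in> extensional (carrier (tspace E V W))"
  by (simp_all add: tspace_def Let_def)

lemma is_vspace_tspace [simp]: "is_vspace (tspace E V W)"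
proof -
  let ?T = "tspace E V W"
  let ?K = "\<lambda>p. Poly_Mapping.keys p \<subseteq> carrier V \<times> carrier W"
  note [simp] = vadd_tspace vscale_tspace vzero_tspace keys_add_subset keys_fscale_subset tcoset_closed
  have cases: "\<exists>p. x = tcoset E V W p \<and> ?K p" if "x \<in> carrier ?T" for x
    using that by (auto simp: carrier_tspace)
  have "comm_group (add_group ?T)"
  proof (rule comm_groupI)
    fix x y assume "x \<in> carrier (add_group ?T)" "y \<in> carrier (add_group ?T)"
    with cases[of x] cases[of y] obtain p q where "x = tcoset E V W p" "y = tcoset E V W q" "?K p" "?K q"
      by auto
    then show "x \<otimes>\<^bsub>add_group ?T\<^esub> y \<in> carrier (add_group ?T)"
      and "x \<otimes>\<^bsub>add_group ?T\<^esub> y = y \<otimes>\<^bsub>add_group ?T\<^esub> x"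
      by (simp_all add: add.commute)
    fix z assume "z \<in> carrier (add_group ?T)"
    with cases[of z] obtain r where "z = tcoset E V W r" "?K r" by auto
    then show "x \<otimes>\<^bsub>add_group ?T\<^esub> y \<otimes>\<^bsub>add_group ?T\<^esub> z =
        x \<otimes>\<^bsub>add_group ?T\<^esub> (y \<otimes>\<^bsub>add_group ?T\<^esub> z)"
      using \<open>x = _\<close> \<open>y = _\<close> \<open>?K p\<close> \<open>?K q\<close> by (simp add: add.assoc)
  next
    show "\<one>\<^bsub>add_group ?T\<^esub> \<in> carrier (add_group ?T)" by simp
  next
    fix x assume "x \<in> carrier (add_group ?T)"
    with cases[of x] obtain p where p: "x = tcoset E V W p" "?K p" by auto
    then show "\<one>\<^bsub>add_group ?T\<^esub> \<otimes>\<^bsub>add_group ?T\<^esub> x = x" by simp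
    have "?K (- p)" using p by (simp add: keys_minus)
    then show "\<exists>y\<in>carrier (add_group ?T). y \<otimes>\<^bsub>add_group ?T\<^esub> x = \<one>\<^bsub>add_group ?T\<^esub>"
      using p by (intro bexI[of _ "tcoset E V W (- p)"]) simp_all
  qed
  moreover have "vadd ?T x y \<in> carrier ?T" "vscale ?T c (vadd ?T x y) = vadd ?T (vscale ?T c x) (vscale ?T c y)"
    if "x \<in> carrier ?T" "y \<in> carrier ?T" for x y c
  proof -
    from that cases[of x] cases[of y] obtain p q where
      "x = tcoset E V W p" "y = tcoset E V W q" "?K p" "?K q" by auto
    then show "vadd ?T x y \<in> carrier ?T" "vscale ?T c (vadd ?T x y) = vadd ?T (vscale ?T c x) (vscale ?T c y)"
      by (simp_all add: fs.scale_right_distrib)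
  qed
  moreover have "vscale ?T c x \<in> carrier ?T" "vscale ?T 1 x = x"
    "vscale ?T (c + d) x = vadd ?T (vscale ?T c x) (vscale ?T d x)"
    "vscale ?T (c * d) x = vscale ?T c (vscale ?T d x)"
    if "x \<in> carrier ?T" for x c d
  proof -
    from that cases[of x] obtain p where "x = tcoset E V W p" "?K p" by auto
    then show "vscale ?T c x \<in> carrier ?T" "vscale ?T 1 x = x"
      "vscale ?T (c + d) x = vadd ?T (vscale ?T c x) (vscale ?T d x)"
      "vscale ?T (c * d) x = vscale ?T c (vscale ?T d x)"
      by (simp_all add: fs.scale_left_distrib)
  qed
  ultimately show ?thesis
    unfolding is_vspace_def by (simp add: PiE_iff tspace_extensional)
qed

section \<open>Pure tensors and the universal property\<close>

lemma pure_closed [simp]: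
  "x \<in> carrier V \<Longrightarrow> y \<in> carrier W \<Longrightarrow> pure E V W x y \<in> carrier (tspace E V W)"
  by (auto simp: pure_def carrier_tspace intro!: imageI)

lemma bil_pure:
  assumes V: "is_vspace V" and W: "is_vspace W"
  shows "bil V W (tspace E V W) (pure E V W)"
proof -
  have rel: "r \<in> tnull E V W" if "r \<in> bilinear_relations V W" for r
    using that by (simp add: tnull_def fs.span_base)
  have "pure E V W (vadd V x x') y = vadd (tspace E V W) (pure E V W x y) (pure E V W x' y)"
    if "x \<in> carrier V" "x' \<in> carrier V" "y \<in> carrier W" for x x' y
    using that unfolding pure_def
    by (simp add: vadd_tspace tcoset_eq_iff, intro rel)
      (auto simp: bilinear_relations_def diff_diff_eq)
  moreover have "pure E V W x (vadd W y y') = vadd (tspace E V W) (pure E V W x y) (pure E V W x y')"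
    if "x \<in> carrier V" "y' \<in> carrier W" "y \<in> carrier W" for x y y'
    using that unfolding pure_def
    by (simp add: vadd_tspace tcoset_eq_iff, intro rel)
      (auto simp: bilinear_relations_def diff_diff_eq)
  moreover have "pure E V W (vscale V c x) y = vscale (tspace E V W) c (pure E V W x y)"
    if "x \<in> carrier V" "y \<in> carrier W" for x y c
    using that unfolding pure_def
    by (simp add: vscale_tspace tcoset_eq_iff, intro rel)
      (auto simp: bilinear_relations_def)
  moreover have "pure E V W x (vscale W c y) = vscale (tspace E V W) c (pure E V W x y)"
    if "x \<in> carrier V" "y \<in> carrier W" for x y c
    using that unfolding pure_def
    by (simp add: vscale_tspace tcoset_eq_iff, intro rel)
      (auto simp: bilinear_relations_def)
  ultimately show ?thesis
    using V W by (auto simp: bil_def lmap_def)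
qed

text \<open>Induction on the support of a representative: each step adds one fresh key
  \<open>(x, y)\<close> with coefficient \<open>c\<close>, which for cosets means adding a scaled
  pure tensor.\<close>

lemma tspace_induct [consumes 1, case_names zero add]:
  assumes t: "t \<in> carrier (tspace E V W)"
    and zero: "P (vzero (tspace E V W))"
    and add: "\<And>x y c s. x \<in> carrier V \<Longrightarrow> y \<in> carrier W \<Longrightarrow> s \<in> carrier (tspace E V W) \<Longrightarrow> P s \<Longrightarrow>
      P (vadd (tspace E V W) (vscale (tspace E V W) c (pure E V W x y)) s)"
  shows "P t"
proof -
  have "Poly_Mapping.keys p \<subseteq> carrier V \<times> carrier W \<Longrightarrow> P (tcoset E V W p)" for p
  proof (induction p rule: Poly_Mapping.update_induct)
    case const
    show ?case using zero by (simp add: vzero_tspace)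
  next
    case (update p a c)
    obtain x y where a: "a = (x, y)" by (cases a)
    \<comment> \<open>The key is fresh, so overwriting its coefficient amounts to addition.\<close>
    have eq: "Poly_Mapping.update a c p = fscale c (gen x y) + p"
      using update.hyps
      by (auto intro!: poly_mapping_eqI
          simp: a gen_def lookup_add Poly_Mapping.update.rep_eq lookup_single when_def in_keys_iff)
    have "Poly_Mapping.keys (Poly_Mapping.update a c p) = insert a (Poly_Mapping.keys p)"
      using update.hyps by (auto simp: in_keys_iff Poly_Mapping.update.rep_eq split: if_splits)
    then have k: "x \<in> carrier V" "y \<in> carrier W" "Poly_Mapping.keys p \<subseteq> carrier V \<times> carrier W"
      using update.prems a by auto
    then have "P (vadd (tspace E V W) (vscale (tspace E V W) c (pure E V W x y)) (tcoset E V W p))"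
      using update.IH by (intro add) (auto simp: carrier_tspace)
    then show ?case using k by (simp add: eq pure_def vscale_tspace vadd_tspace keys_fscale_subset)
  qed
  then show ?thesis using t by (auto simp: carrier_tspace)
qed

text \<open>The conclusion is a bounded quantification because equations in several tensor variables
  are proved by nesting: one variable is generalised and reduced to a pure tensor, then the next one
  follows.\<close>

lemma tspace_eqI:
  assumes F: "lmap (tspace E V W) U F" and G: "lmap (tspace E V W) U G"
    and eq: "\<And>x y. x \<in> carrier V \<Longrightarrow> y \<in> carrier W \<Longrightarrow> F (pure E V W x y) = G (pure E V W x y)"
  shows "\<forall>t\<in>carrier (tspace E V W). F t = G t"
proof
  fix t assume "t \<in> carrier (tspace E V W)"
  then show "F t = G t"
  proof (induction rule: tspace_induct)
    case zero
    show ?case using lmap_zero[OF F] lmap_zero[OF G] by simp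
  next
    case (add x y c s)
    then show ?case
      using eq by (simp add: lmap_add[OF F] lmap_add[OF G] lmap_scale[OF F] lmap_scale[OF G])
  qed
qed

text \<open>Existence half of the universal property, for arbitrary extra relations
  \<open>E\<close>: the linear extension kills the generators of \<open>tnull\<close>, hence their
  span, hence descends to cosets.\<close>

lemma free_ext_lift:
  assumes U: "is_vspace U" and V: "is_vspace V" and W: "is_vspace W" and f: "bil V W U f"
    and E: "\<forall>e\<in>E. free_ext V W U f e = vzero U"
  shows "\<exists>g. lmap (tspace E V W) U g \<and>
    (\<forall>x\<in>carrier V. \<forall>y\<in>carrier W. g (pure E V W x y) = f x y)"
proof -
  let ?F = "free_ext V W U f"
  have fc: "f x y \<in> carrier U" if "x \<in> carrier V" "y \<in> carrier W" for x y
    using f that by (rule bil_closed)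
  note Fadd = free_ext_add[of U V W f, OF U fc] and Fsc = free_ext_fscale[of U V W f, OF U fc]
    and Fgen = free_ext_gen[of U V W f, OF U fc] and F0 = free_ext_zero[of U V W f, OF U fc]
    and Feq0 = free_ext_eq_zero[of U V W f, OF U fc] and Fc = free_ext_closed[of U V W f, OF U fc]
  have add1: "f (vadd V x x') y = vadd U (f x y) (f x' y)"
    if "x \<in> carrier V" "x' \<in> carrier V" "y \<in> carrier W" for x x' y
    using f that by (simp add: bil_def lmap_def)
  have add2: "f x (vadd W y y') = vadd U (f x y) (f x y')"
    if "x \<in> carrier V" "y' \<in> carrier W" "y \<in> carrier W" for x y y'
    using f that by (simp add: bil_def lmap_def)
  have sc: "f (vscale V c x) y = vscale U c (f x y)" "f x (vscale W c y) = vscale U c (f x y)"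
    if "x \<in> carrier V" "y \<in> carrier W" for x y c
    using f that by (simp_all add: bil_def lmap_def)
  have rel: "?F r = vzero U" if "r \<in> bilinear_relations V W" for r
    using that unfolding bilinear_relations_def
  proof (elim UnE CollectE exE conjE)
    fix x x' y assume "r = gen (vadd V x x') y - gen x y - gen x' y"
      and "x \<in> carrier V" "x' \<in> carrier V" "y \<in> carrier W"
    then show ?thesis
      by (intro Feq0[of r "gen x y + gen x' y" "gen (vadd V x x') y"])
        (simp_all add: Fadd Fgen V W add1 add2 sc)
  next
    fix x y y' assume "r = gen x (vadd W y y') - gen x y - gen x y'"
      and "x \<in> carrier V" "y \<in> carrier W" "y' \<in> carrier W"
    then show ?thesis
      by (intro Feq0[of r "gen x y + gen x y'" "gen x (vadd W y y')"])
        (simp_all add: Fadd Fgen V W add1 add2 sc)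
  next
    fix c x y assume "r = gen (vscale V c x) y - fscale c (gen x y)"
      and "x \<in> carrier V" "y \<in> carrier W"
    then show ?thesis
      by (intro Feq0[of r "fscale c (gen x y)" "gen (vscale V c x) y"])
        (simp_all add: Fsc Fgen V W add1 add2 sc)
  next
    fix c x y assume "r = gen x (vscale W c y) - fscale c (gen x y)"
      and "x \<in> carrier V" "y \<in> carrier W"
    then show ?thesis
      by (intro Feq0[of r "fscale c (gen x y)" "gen x (vscale W c y)"])
        (simp_all add: Fsc Fgen V W add1 add2 sc)
  qed
  have null: "?F n = vzero U" if "n \<in> tnull E V W" for n
    using that unfolding tnull_def
  proof (rule fs.span_induct)
    show "fs.subspace {n. ?F n = vzero U}"
      using U by (intro fs.subspaceI) (simp_all add: F0 Fadd Fsc)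
  qed (use rel E in auto)
  \<comment> \<open>Any representative will do, since two of them differ by an element of
    \<open>tnull\<close>, on which \<open>?F\<close> vanishes.\<close>
  define g where "g = (\<lambda>t. ?F (SOME p. p \<in> t))"
  have g: "g (tcoset E V W p) = ?F p" for p
  proof -
    have "p \<in> tcoset E V W p" by (simp add: mem_tcoset_iff tnull_zero)
    then have "(SOME q. q \<in> tcoset E V W p) \<in> tcoset E V W p" by (rule someI)
    then obtain n where n: "n \<in> tnull E V W" "(SOME q. q \<in> tcoset E V W p) = p + n"
      by (auto simp: tcoset_def)
    then show ?thesis using U Fc by (simp add: g_def Fadd null)
  qed
  have "lmap (tspace E V W) U g"
    using U by (auto simp: lmap_def carrier_tspace vadd_tspace vscale_tspace g Fadd Fsc Fc)
  then show ?thesis by (auto simp: pure_def g Fgen)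
qed

text \<open>Existence of the map that \<open>lift\<close> describes; uniqueness is automatic by
  \<open>tspace_eqI\<close>. Stating it semantically treats the plain tensor product (bilinear
  \<open>f\<close>) and the product over \<open>B\<close> (bilinear and balanced \<open>f\<close>)
  alike.\<close>

definition adm ::
  "('k, 'a, 'b) tens \<Rightarrow> ('k::field, 'a, 'm) vspace_scheme \<Rightarrow> ('k, 'b, 'n) vspace_scheme
   \<Rightarrow> ('k, 'c, 'l) vspace_scheme \<Rightarrow> ('a \<Rightarrow> 'b \<Rightarrow> 'c) \<Rightarrow> bool"
where
  "adm E V W U f \<longleftrightarrow> (\<exists>g. lmap (tspace E V W) U g \<and>
     (\<forall>x\<in>carrier V. \<forall>y\<in>carrier W. g (pure E V W x y) = f x y))"

lemma adm_bil:
  assumes "bil V W U f" "is_vspace V" "is_vspace W"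
  shows "adm {} V W U f"
proof -
  have "is_vspace U"
    using bil_lmap1[OF assms(1) vzero_closed[OF assms(3)]] by (rule lmap_vspace)
  then show ?thesis unfolding adm_def using assms by (intro free_ext_lift) auto
qed

lemma adm_balanced:
  assumes f: "bil M N U f" and V: "is_vspace M" and W: "is_vspace N"
    and bal: "\<And>x b y. x \<in> carrier M \<Longrightarrow> b \<in> carrier B \<Longrightarrow> y \<in> carrier N \<Longrightarrow> f (ract M x b) y = f x (lact N b y)"
    and cl: "\<And>x b. x \<in> carrier M \<Longrightarrow> b \<in> carrier B \<Longrightarrow> ract M x b \<in> carrier M"
      "\<And>y b. y \<in> carrier N \<Longrightarrow> b \<in> carrier B \<Longrightarrow> lact N b y \<in> carrier N"
  shows "adm (balanced_relations B M N) M N U f"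
proof -
  have U: "is_vspace U"
    using bil_lmap1[OF f vzero_closed[OF W]] by (rule lmap_vspace)
  have fc: "f x y \<in> carrier U" if "x \<in> carrier M" "y \<in> carrier N" for x y
    using f that by (rule bil_closed)
  have "free_ext M N U f e = vzero U" if "e \<in> balanced_relations B M N" for e
    using that unfolding balanced_relations_def
  proof (elim CollectE exE conjE)
    fix x b y assume *: "e = gen (ract M x b) y - gen x (lact N b y)"
      "x \<in> carrier M" "b \<in> carrier B" "y \<in> carrier N"
    have "free_ext M N U f (gen (ract M x b) y) = free_ext M N U f (gen x (lact N b y))"
      using free_ext_gen[of U M N f, OF U fc] * cl bal by simp
    then show ?thesis
      using * by (intro free_ext_eq_zero[of U M N f e "gen x (lact N b y)" "gen (ract M x b) y", OF U fc]) auto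
  qed
  then show ?thesis unfolding adm_def using U V W f by (intro free_ext_lift) auto
qed

section \<open>The linear map with prescribed values on pure tensors\<close>

context
  fixes E :: "('k::field, 'a, 'b) tens" and V :: "('k, 'a, 'm) vspace_scheme"
    and W :: "('k, 'b, 'n) vspace_scheme" and U :: "('k, 'c, 'l) vspace_scheme" and f
  assumes adm: "adm E V W U f"
begin

lemma lift_unique:
  "lift E V W U f \<in> lin (tspace E V W) U \<and>
    (\<forall>x\<in>carrier V. \<forall>y\<in>carrier W. lift E V W U f (pure E V W x y) = f x y)"
proof -
  obtain g where g: "lmap (tspace E V W) U g"
      "\<And>x y. x \<in> carrier V \<Longrightarrow> y \<in> carrier W \<Longrightarrow> g (pure E V W x y) = f x y"
    using adm by (auto simp: adm_def)
  have U: "is_vspace U" using g(1) by (rule lmap_vspace)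
  have "\<exists>!h. h \<in> lin (tspace E V W) U \<and>
    (\<forall>x\<in>carrier V. \<forall>y\<in>carrier W. h (pure E V W x y) = f x y)"
  proof (rule ex1I)
    have "lmap (tspace E V W) U (restrict g (carrier (tspace E V W)))"
      using g(1) by (rule lmap_cong) simp
    then show "restrict g (carrier (tspace E V W)) \<in> lin (tspace E V W) U \<and>
      (\<forall>x\<in>carrier V. \<forall>y\<in>carrier W. restrict g (carrier (tspace E V W)) (pure E V W x y) = f x y)"
      using g(2) U by (simp add: lin_iff_lmap)
  next
    fix h assume h: "h \<in> lin (tspace E V W) U \<and>
      (\<forall>x\<in>carrier V. \<forall>y\<in>carrier W. h (pure E V W x y) = f x y)"
    then have "\<forall>t\<in>carrier (tspace E V W). h t = g t"
      using g U by (intro tspace_eqI[of _ _ _ U]) (simp_all add: lin_iff_lmap)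
    then show "h = restrict g (carrier (tspace E V W))"
      using h U by (intro extensionalityI[of _ "carrier (tspace E V W)"]) (simp_all add: lin_iff_lmap)
  qed
  then show ?thesis unfolding lift_def by (rule theI')
qed

lemma adm_vspace: "is_vspace U"
  using adm unfolding adm_def by (blast dest: lmap_vspace(2))

lemma lift_lin: "lift E V W U f \<in> lin (tspace E V W) U"
  using lift_unique by blast

lemma lift_pure: "x \<in> carrier V \<Longrightarrow> y \<in> carrier W \<Longrightarrow> lift E V W U f (pure E V W x y) = f x y"
  using lift_unique by blast

lemma lmap_lift: "lmap (tspace E V W) U (\<lambda>t. lift E V W U f t)"
  using lift_lin adm_vspace by (simp add: lin_iff_lmap)

lemma lift_closed: "t \<in> carrier (tspace E V W) \<Longrightarrow> lift E V W U f t \<in> carrier U"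
  using lmap_lift by (rule lmap_closed)

lemma lift_eqI:
  assumes "lmap (tspace E V W) U G" "t \<in> carrier (tspace E V W)"
    and "\<And>x y. x \<in> carrier V \<Longrightarrow> y \<in> carrier W \<Longrightarrow> G (pure E V W x y) = f x y"
  shows "lift E V W U f t = G t"
  using tspace_eqI[OF lmap_lift assms(1)] assms(2,3) by (simp add: lift_pure)

end

lemma lift_cong:
  assumes "\<And>x y. x \<in> carrier V \<Longrightarrow> y \<in> carrier W \<Longrightarrow> f x y = f' x y"
  shows "lift E V W U f t = lift E V W U f' t"
  using assms by (simp add: lift_def cong: ball_cong)

lemma adm_pure: "adm E V W (tspace E V W) (\<lambda>x y. pure E V W x y)"
  unfolding adm_def by (rule exI[of _ "\<lambda>t. t"]) (simp add: lmap_id)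

lemma adm_comp:
  assumes "adm E V W U f" "lmap U U' g"
  shows "adm E V W U' (\<lambda>x y. g (f x y))"
  unfolding adm_def
  by (rule exI[of _ "\<lambda>t. g (lift E V W U f t)"])
    (simp add: lift_pure[OF assms(1)] lmap_comp[OF assms(2) lmap_lift[OF assms(1)]])

text \<open>The basic move of the Sweedler calculus: a linear map passes through a sum over a
  tensor. Admissibility of the new summand follows from that of the old one.\<close>

lemma lmap_lift_comm:
  assumes "lmap U U' g" "adm E V W U f" "t \<in> carrier (tspace E V W)"
  shows "g (lift E V W U f t) = lift E V W U' (\<lambda>x y. g (f x y)) t"
  by (rule lift_eqI[OF adm_comp[OF assms(2,1)] lmap_comp[OF assms(1) lmap_lift[OF assms(2)]] assms(3), symmetric])
    (simp add: lift_pure[OF assms(2)])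

lemma lift_id: "t \<in> carrier (tspace E V W) \<Longrightarrow> lift E V W (tspace E V W) (\<lambda>x y. pure E V W x y) t = t"
  by (rule lift_eqI[OF adm_pure, of _ _ _ "\<lambda>t. t"]) (simp_all add: lmap_id)

lemma lmap_lift_arg:
  assumes "adm E V W U f" "lmap X (tspace E V W) h"
  shows "lmap X U (\<lambda>x. lift E V W U f (h x))"
  using lmap_lift[OF assms(1)] assms(2) by (rule lmap_comp)

text \<open>Here the summand, not the tensor, depends on the variable. Linearity in \<open>x\<close>
  is known only for each pair \<open>a\<close>, \<open>b\<close>, so the two sides are compared on
  pure tensors first.\<close>

lemma lmap_lift_fun:
  assumes adm: "\<And>x. x \<in> carrier X \<Longrightarrow> adm E V W U (f x)"
    and lm: "\<And>a b. a \<in> carrier V \<Longrightarrow> b \<in> carrier W \<Longrightarrow> lmap X U (\<lambda>x. f x a b)"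
    and t: "t \<in> carrier (tspace E V W)" and X: "is_vspace X"
  shows "lmap X U (\<lambda>x. lift E V W U (f x) t)"
proof -
  have U: "is_vspace U" using adm[OF vzero_closed[OF X]] by (rule adm_vspace)
  have "lift E V W U (f (vadd X x y)) t = vadd U (lift E V W U (f x) t) (lift E V W U (f y) t)"
    if "x \<in> carrier X" "y \<in> carrier X" for x y
    by (rule lift_eqI[OF adm lmap_vadd[OF lmap_lift[OF adm] lmap_lift[OF adm]] t])
      (use that X in \<open>simp_all add: lift_pure[OF adm] lmap_add[OF lm]\<close>)
  moreover have "lift E V W U (f (vscale X c x)) t = vscale U c (lift E V W U (f x) t)"
    if "x \<in> carrier X" for x c
    by (rule lift_eqI[OF adm lmap_vscale[OF lmap_lift[OF adm]] t])
      (use that X in \<open>simp_all add: lift_pure[OF adm] lmap_scale[OF lm]\<close>)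
  ultimately show ?thesis
    using X U lift_closed[OF adm t] by (simp add: lmap_def)
qed

text \<open>Interchange of two independent sums. Every intermediate summand needs its own existence
  proof, since either product may be balanced; for plain tensor products \<open>tlift_swap\<close>
  derives them all from bilinearity.\<close>

lemma lift_swap:
  assumes s: "s \<in> carrier (tspace E V W)" and t: "t \<in> carrier (tspace E' V' W')"
    and 1: "\<And>x y. x \<in> carrier V \<Longrightarrow> y \<in> carrier W \<Longrightarrow> adm E' V' W' U (F x y)"
    and 2: "\<And>a b. a \<in> carrier V' \<Longrightarrow> b \<in> carrier W' \<Longrightarrow> adm E V W U (\<lambda>x y. F x y a b)"
    and 3: "\<And>t. t \<in> carrier (tspace E' V' W') \<Longrightarrow> adm E V W U (\<lambda>x y. lift E' V' W' U (F x y) t)"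
    and 4: "adm E' V' W' U (\<lambda>a b. lift E V W U (\<lambda>x y. F x y a b) s)"
  shows "lift E V W U (\<lambda>x y. lift E' V' W' U (F x y) t) s =
    lift E' V' W' U (\<lambda>a b. lift E V W U (\<lambda>x y. F x y a b) s) t"
  by (rule lift_eqI[symmetric, OF 4 lmap_lift_fun[OF 3] t])
    (use s in \<open>simp_all add: lift_pure[OF 1] lmap_lift[OF 1] cong: lift_cong\<close>)

section \<open>Syntax-directed rules for linearity\<close>

named_theorems lin_intros

lemma lmap_cong_iff:
  "V = V' \<Longrightarrow> W = W' \<Longrightarrow> (\<And>x. x \<in> carrier V' \<Longrightarrow> f x = g x) \<Longrightarrow> lmap V W f \<longleftrightarrow> lmap V' W' g"
  using lmap_cong[of V W f g] lmap_cong[of V W g f] by auto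

lemma adm_tensor [lin_intros]: "is_vspace V \<Longrightarrow> is_vspace W \<Longrightarrow> bil V W U f \<Longrightarrow> adm {} V W U f"
  by (rule adm_bil)

declare bilI [lin_intros] lmap_id [lin_intros] lmap_vscale [lin_intros] lmap_vscale_left [lin_intros]
  lmap_times [lin_intros] lmap_lift_arg [lin_intros] lmap_lift_fun [lin_intros] adm_pure [lin_intros]
  lift_closed [lin_intros] vscale_closed [lin_intros]

lemma bil_comp1: "bil V W U g \<Longrightarrow> lmap X V h \<Longrightarrow> y \<in> carrier W \<Longrightarrow> lmap X U (\<lambda>x. g (h x) y)"
  by (rule lmap_comp[OF bil_lmap1])

lemma bil_comp2: "bil V W U g \<Longrightarrow> lmap X W h \<Longrightarrow> x \<in> carrier V \<Longrightarrow> lmap X U (\<lambda>y. g x (h y))"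
  by (rule lmap_comp[OF bil_lmap2])

lemma lmap_pure1 [lin_intros]:
  "lmap X V h \<Longrightarrow> y \<in> carrier W \<Longrightarrow> is_vspace W \<Longrightarrow> lmap X (tspace E V W) (\<lambda>x. pure E V W (h x) y)"
  by (rule bil_comp1[OF bil_pure]) (simp_all add: lmap_vspace(2)[of X V h])

lemma lmap_pure2 [lin_intros]:
  "lmap X W h \<Longrightarrow> x \<in> carrier V \<Longrightarrow> is_vspace V \<Longrightarrow> lmap X (tspace E V W) (\<lambda>y. pure E V W x (h y))"
  by (rule bil_comp2[OF bil_pure]) (simp_all add: lmap_vspace(2)[of X W h])

declare pure_closed [lin_intros]

definition tril where
  "tril V W Z U F \<longleftrightarrow> (\<forall>y\<in>carrier W. \<forall>z\<in>carrier Z. lmap V U (\<lambda>x. F x y z)) \<and>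
     (\<forall>x\<in>carrier V. \<forall>z\<in>carrier Z. lmap W U (\<lambda>y. F x y z)) \<and>
     (\<forall>x\<in>carrier V. \<forall>y\<in>carrier W. lmap Z U (\<lambda>z. F x y z))"

lemma trilI:
  assumes "\<And>y z. y \<in> carrier W \<Longrightarrow> z \<in> carrier Z \<Longrightarrow> lmap V U (\<lambda>x. F x y z)"
    and "\<And>x z. x \<in> carrier V \<Longrightarrow> z \<in> carrier Z \<Longrightarrow> lmap W U (\<lambda>y. F x y z)"
    and "\<And>x y. x \<in> carrier V \<Longrightarrow> y \<in> carrier W \<Longrightarrow> lmap Z U (\<lambda>z. F x y z)"
  shows "tril V W Z U F"
  using assms by (simp add: tril_def)

text \<open>Records of different types, such as an algebra and a bimodule on it, cannot be compared
  by HOL equality. Tensor products, lifts and linear maps read just these four fields, so agreement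
  in them makes the derived spaces literally equal, not merely isomorphic.\<close>

definition same_vs ::
  "('k, 'a, 'm) vspace_scheme \<Rightarrow> ('k, 'a, 'n) vspace_scheme \<Rightarrow> bool"
where
  "same_vs V V' \<longleftrightarrow> carrier V = carrier V' \<and> vadd V = vadd V' \<and> vzero V = vzero V' \<and> vscale V = vscale V'"

lemma same_vs_refl [simp]: "same_vs V V"
  by (simp add: same_vs_def)

lemma same_vs_sym: "same_vs V V' \<Longrightarrow> same_vs V' V"
  by (simp add: same_vs_def)

lemma same_vs_trans: "same_vs V V' \<Longrightarrow> same_vs V' V'' \<Longrightarrow> same_vs V V''"
  by (simp add: same_vs_def)

lemma is_vspace_same: "same_vs V V' \<Longrightarrow> is_vspace V \<longleftrightarrow> is_vspace V'"
  by (simp add: is_vspace_def same_vs_def add_group_def)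

lemma lmap_same: "same_vs V V' \<Longrightarrow> same_vs W W' \<Longrightarrow> lmap V W f \<longleftrightarrow> lmap V' W' f"
  using is_vspace_same[of V V'] is_vspace_same[of W W'] by (simp add: lmap_def same_vs_def)

lemma lin_same: "same_vs V V' \<Longrightarrow> same_vs W W' \<Longrightarrow> lin V W = lin V' W'"
  by (simp add: lin_def same_vs_def)

lemma tspace_same:
  assumes "same_vs V V'" "same_vs W W'"
  shows "tspace E V W = tspace E V' W'" "pure E V W = pure E V' W'"
proof -
  have "bilinear_relations V W = bilinear_relations V' W'"
    using assms by (simp add: bilinear_relations_def same_vs_def)
  then have "tnull E V W = tnull E V' W'" by (simp add: tnull_def)
  moreover from this have "tcoset E V W = tcoset E V' W'" by (simp add: tcoset_def fun_eq_iff)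
  ultimately show "tspace E V W = tspace E V' W'" "pure E V W = pure E V' W'"
    using assms by (simp_all add: tspace_def pure_def fun_eq_iff same_vs_def)
qed

lemma lift_same:
  assumes "same_vs V V'" "same_vs W W'" "same_vs U U'"
  shows "lift E V W U f = lift E V' W' U' f"
proof -
  have "lin (tspace E V W) U = lin (tspace E V' W') U'"
    using assms by (intro lin_same) (simp_all add: tspace_same[OF assms(1,2)])
  then show ?thesis
    using assms tspace_same[OF assms(1,2), of E]
    by (simp add: lift_def fun_eq_iff) (simp add: same_vs_def)
qed

lemma tmap_same:
  assumes "same_vs V V'" "same_vs W W'" "same_vs X X'" "same_vs Y Y'"
  shows "tmap V W X Y f g = tmap V' W' X' Y' f g"
proof -
  have "tensor X Y = tensor X' Y'" "tpure X Y = tpure X' Y'"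
    using tspace_same[OF assms(3,4)] by blast+
  then show ?thesis
    unfolding tmap_def by (simp add: lift_same[OF assms(1,2) same_vs_refl])
qed

lemma tflip_same: "same_vs V V' \<Longrightarrow> same_vs W W' \<Longrightarrow> tflip V W = tflip V' W'"
  unfolding tflip_def by (simp add: tspace_same[of W W' V V'] lift_same[of V V' W W'])

lemma tassoc_same: "same_vs U U' \<Longrightarrow> same_vs V V' \<Longrightarrow> same_vs W W' \<Longrightarrow> tassoc U V W = tassoc U' V' W'"
proof -
  assume 1: "same_vs U U'" and 2: "same_vs V V'" and 3: "same_vs W W'"
  have "tspace E U (tensor V W) = tspace E U' (tensor V' W')" "pure E U (tensor V W) = pure E U' (tensor V' W')" for E
    using tspace_same[OF 2 3, of "{}"] tspace_same[OF 1 same_vs_refl] by auto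
  then show ?thesis
    unfolding tassoc_def
    by (simp add: tspace_same[OF 1 2] tspace_same[OF 2 3] lift_same[OF 1 2 same_vs_refl]
      lift_same[OF same_vs_refl 3 same_vs_refl])
qed

lemma is_coalgebra_same:
  assumes "same_vs V V'"
  shows "is_coalgebra V \<Delta> \<epsilon> \<longleftrightarrow> is_coalgebra V' \<Delta> \<epsilon>"
proof -
  have t: "tensor V V = tensor V' V'" "tensor V (tensor V V) = tensor V' (tensor V' V')"
    using tspace_same[OF assms assms, of "{}"] tspace_same[OF assms same_vs_refl, of "{}"] by auto
  have "carrier V = carrier V'" "vscale V = vscale V'" using assms by (auto simp: same_vs_def)
  moreover have "lin V (tensor V V) = lin V' (tensor V V)" "lin V kspace = lin V' kspace"
    by (simp_all add: lin_same[OF assms same_vs_refl])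
  moreover have "tmap V V (tensor V V) V \<Delta> (\<lambda>y. y) = tmap V' V' (tensor V V) V' \<Delta> (\<lambda>y. y)"
    "tmap V V V (tensor V V) (\<lambda>y. y) \<Delta> = tmap V' V' V' (tensor V V) (\<lambda>y. y) \<Delta>"
    by (simp_all add: tmap_same[OF assms assms] assms)
  ultimately show ?thesis
    unfolding is_coalgebra_def t is_vspace_same[OF assms] tassoc_same[OF assms assms assms]
    by (simp add: t lift_same[OF assms assms assms])
qed


section \<open>Maps between tensor products\<close>

lemma lift_lift:
  assumes "adm E V W U F" "adm E' V' W' (tspace E V W) G" "t \<in> carrier (tspace E' V' W')"
  shows "lift E V W U F (lift E' V' W' (tspace E V W) G t) = lift E' V' W' U (\<lambda>x y. lift E V W U F (G x y)) t"
  using lmap_lift_comm[OF lmap_lift[OF assms(1)] assms(2,3)] .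

context
  fixes V :: "('k::field, 'a, 'm) vspace_scheme" and W :: "('k, 'b, 'n) vspace_scheme"
    and V' :: "('k, 'c, 'm2) vspace_scheme" and W' :: "('k, 'd, 'n2) vspace_scheme" and f g
  assumes f: "lmap V V' f" and g: "lmap W W' g"
begin

lemma adm_tmap: "adm {} V W (tensor V' W') (\<lambda>x y. tpure V' W' (f x) (g y))"
  using lmap_vspace[OF f] lmap_vspace[OF g]
  by (intro lin_intros f g) (simp_all add: lmap_closed[OF f] lmap_closed[OF g])

lemma lmap_tmap: "lmap (tensor V W) (tensor V' W') (\<lambda>t. tmap V W V' W' f g t)"
  unfolding tmap_def by (rule lmap_lift[OF adm_tmap])

lemma tmap_closed: "t \<in> carrier (tensor V W) \<Longrightarrow> tmap V W V' W' f g t \<in> carrier (tensor V' W')"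
  by (rule lmap_closed[OF lmap_tmap])

lemma tmap_pure: "x \<in> carrier V \<Longrightarrow> y \<in> carrier W \<Longrightarrow> tmap V W V' W' f g (tpure V W x y) = tpure V' W' (f x) (g y)"
  unfolding tmap_def by (rule lift_pure[OF adm_tmap])

lemma tlift_tmap:
  assumes F: "bil V' W' U F" and t: "t \<in> carrier (tensor V W)"
  shows "tlift V' W' U F (tmap V W V' W' f g t) = tlift V W U (\<lambda>x y. F (f x) (g y)) t"
proof -
  have a: "adm {} V' W' U F" using lmap_vspace(2)[OF f] lmap_vspace(2)[OF g] F by (rule adm_tensor)
  show ?thesis unfolding tmap_def lift_lift[OF a adm_tmap t]
    using f g by (intro lift_cong) (simp add: lift_pure[OF a] lmap_closed)
qed

end

declare lmap_comp[OF lmap_tmap, lin_intros] tmap_closed[lin_intros]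

lemma tmap_cong:
  "(\<And>x. x \<in> carrier V \<Longrightarrow> f x = f' x) \<Longrightarrow> (\<And>y. y \<in> carrier W \<Longrightarrow> g y = g' y) \<Longrightarrow>
    tmap V W V' W' f g t = tmap V W V' W' f' g' t"
  unfolding tmap_def by (rule lift_cong) simp

lemma tmap_id: "t \<in> carrier (tensor V W) \<Longrightarrow> tmap V W V W (\<lambda>x. x) (\<lambda>y. y) t = t"
  unfolding tmap_def by (rule lift_id)

lemma tmap_tmap:
  assumes "lmap V V' f" "lmap W W' g" "lmap V' V'' f'" "lmap W' W'' g'" "t \<in> carrier (tensor V W)"
  shows "tmap V' W' V'' W'' f' g' (tmap V W V' W' f g t) = tmap V W V'' W'' (\<lambda>x. f' (f x)) (\<lambda>y. g' (g y)) t"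
proof -
  have "bil V' W' (tensor V'' W'') (\<lambda>x y. tpure V'' W'' (f' x) (g' y))"
    using assms lmap_vspace[OF assms(3)] lmap_vspace[OF assms(4)]
    by (intro lin_intros) (auto simp: lmap_closed)
  then show ?thesis
    using tlift_tmap[OF assms(1,2) _ assms(5)] by (simp add: tmap_def)
qed

context
  fixes V :: "('k::field, 'a, 'm) vspace_scheme" and W :: "('k, 'b, 'n) vspace_scheme"
  assumes V: "is_vspace V" and W: "is_vspace W"
begin

lemma adm_tflip: "adm {} V W (tensor W V) (\<lambda>x y. tpure W V y x)"
  using V W by (intro lin_intros)

lemma lmap_tflip: "lmap (tensor V W) (tensor W V) (\<lambda>t. tflip V W t)"
  unfolding tflip_def by (rule lmap_lift[OF adm_tflip])

lemma tflip_closed: "t \<in> carrier (tensor V W) \<Longrightarrow> tflip V W t \<in> carrier (tensor W V)"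
  by (rule lmap_closed[OF lmap_tflip])

lemma tflip_pure: "x \<in> carrier V \<Longrightarrow> y \<in> carrier W \<Longrightarrow> tflip V W (tpure V W x y) = tpure W V y x"
  unfolding tflip_def by (rule lift_pure[OF adm_tflip])

lemma tlift_tflip:
  assumes F: "bil W V U F" and t: "t \<in> carrier (tensor V W)"
  shows "tlift W V U F (tflip V W t) = tlift V W U (\<lambda>x y. F y x) t"
proof -
  have a: "adm {} W V U F" using W V F by (rule adm_tensor)
  show ?thesis unfolding tflip_def lift_lift[OF a adm_tflip t]
    by (intro lift_cong) (simp add: lift_pure[OF a])
qed

end

declare lmap_comp[OF lmap_tflip, lin_intros] tflip_closed[lin_intros]

lemma tflip_tmap:
  assumes "lmap V V' f" "lmap W W' g" "t \<in> carrier (tensor V W)"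
  shows "tflip V' W' (tmap V W V' W' f g t) = tmap W V W' V' g f (tflip V W t)"
proof -
  note vs = lmap_vspace[OF assms(1)] lmap_vspace[OF assms(2)]
  have "bil V' W' (tensor W' V') (\<lambda>x y. tpure W' V' y x)" using vs by (intro lin_intros)
  moreover have "bil W V (tensor W' V') (\<lambda>x y. tpure W' V' (g x) (f y))"
    using vs assms by (intro lin_intros) (simp_all add: lmap_closed)
  ultimately show ?thesis
    using assms vs by (simp add: tflip_def tlift_tmap) (simp add: tmap_def tlift_tflip flip: tflip_def)
qed

context
  fixes U :: "('k::field, 'a, 'm) vspace_scheme" and V :: "('k, 'b, 'n) vspace_scheme"
    and W :: "('k, 'c, 'l) vspace_scheme"
  assumes U: "is_vspace U" and V: "is_vspace V" and W: "is_vspace W"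
begin

lemma adm_tassoc_inner:
  "z \<in> carrier W \<Longrightarrow> adm {} U V (tensor U (tensor V W)) (\<lambda>x y. tpure U (tensor V W) x (tpure V W y z))"
  using U V W by (intro lin_intros) simp_all

lemma adm_tassoc: "adm {} (tensor U V) W (tensor U (tensor V W))
     (\<lambda>s z. tlift U V (tensor U (tensor V W))
        (\<lambda>x y. tpure U (tensor V W) x (tpure V W y z)) s)"
  using U V W by (intro lin_intros) simp_all

lemma lmap_tassoc: "lmap (tensor (tensor U V) W) (tensor U (tensor V W)) (\<lambda>t. tassoc U V W t)"
  unfolding tassoc_def by (rule lmap_lift[OF adm_tassoc])

lemma tassoc_pure: "s \<in> carrier (tensor U V) \<Longrightarrow> z \<in> carrier W \<Longrightarrow>
  tassoc U V W (tpure (tensor U V) W s z) =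
    tlift U V (tensor U (tensor V W)) (\<lambda>x y. tpure U (tensor V W) x (tpure V W y z)) s"
  unfolding tassoc_def by (rule lift_pure[OF adm_tassoc])

lemma tassoc_pure_pure: "x \<in> carrier U \<Longrightarrow> y \<in> carrier V \<Longrightarrow> z \<in> carrier W \<Longrightarrow>
  tassoc U V W (tpure (tensor U V) W (tpure U V x y) z) = tpure U (tensor V W) x (tpure V W y z)"
  by (simp add: tassoc_pure lift_pure[OF adm_tassoc_inner])

end

declare lmap_comp[OF lmap_tassoc, lin_intros]

lemma tlift_swap:
  assumes s: "s \<in> carrier (tensor V W)" and t: "t \<in> carrier (tensor V' W')"
    and 1: "\<And>x y. x \<in> carrier V \<Longrightarrow> y \<in> carrier W \<Longrightarrow> bil V' W' U (F x y)"
    and 2: "\<And>a b. a \<in> carrier V' \<Longrightarrow> b \<in> carrier W' \<Longrightarrow> bil V W U (\<lambda>x y. F x y a b)"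
    and vs: "is_vspace V" "is_vspace W" "is_vspace V'" "is_vspace W'"
  shows "tlift V W U (\<lambda>x y. tlift V' W' U (F x y) t) s =
    tlift V' W' U (\<lambda>a b. tlift V W U (\<lambda>x y. F x y a b) s) t"
proof (rule lift_swap[OF s t])
  note a1 = adm_tensor[OF vs(3,4) 1] and a2 = adm_tensor[OF vs(1,2) 2]
  show "adm {} V W U (\<lambda>x y. tlift V' W' U (F x y) t)" if t: "t \<in> carrier (tensor V' W')" for t
  proof (rule adm_tensor[OF vs(1,2) bilI])
    show "lmap W U (\<lambda>y. tlift V' W' U (F x y) t)" if "x \<in> carrier V" for x
      using that by (intro lmap_lift_fun a1 t vs bil_lmap2[OF 2])
    show "lmap V U (\<lambda>x. tlift V' W' U (F x y) t)" if "y \<in> carrier W" for y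
      using that by (intro lmap_lift_fun a1 t vs bil_lmap1[OF 2])
  qed
  show "adm {} V' W' U (\<lambda>a b. tlift V W U (\<lambda>x y. F x y a b) s)"
  proof (rule adm_tensor[OF vs(3,4) bilI])
    show "lmap W' U (\<lambda>b. tlift V W U (\<lambda>x y. F x y a b) s)" if "a \<in> carrier V'" for a
      using that by (intro lmap_lift_fun a2 s vs bil_lmap2[OF 1])
    show "lmap V' U (\<lambda>a. tlift V W U (\<lambda>x y. F x y a b) s)" if "b \<in> carrier W'" for b
      using that by (intro lmap_lift_fun a2 s vs bil_lmap1[OF 1])
  qed
qed (use vs 1 2 in \<open>simp_all add: adm_tensor\<close>)


section \<open>Algebras and coalgebras\<close>

lemma algebra_vspace [simp]: "is_algebra A \<Longrightarrow> is_vspace A"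
  by (simp add: is_algebra_def)

lemma aone_closed [simp]: "is_algebra A \<Longrightarrow> aone A \<in> carrier A"
  by (simp add: is_algebra_def)

lemma amult_bil: "is_algebra A \<Longrightarrow> bil A A A (amult A)"
  using bilinear_iff_bil[of A A A "amult A"] unfolding is_algebra_def by blast

lemma amult_closed [simp]:
  "is_algebra A \<Longrightarrow> x \<in> carrier A \<Longrightarrow> y \<in> carrier A \<Longrightarrow> amult A x y \<in> carrier A"
  by (rule bil_closed[OF amult_bil])

lemma amult_assoc:
  "is_algebra A \<Longrightarrow> x \<in> carrier A \<Longrightarrow> y \<in> carrier A \<Longrightarrow> z \<in> carrier A \<Longrightarrow>
    amult A (amult A x y) z = amult A x (amult A y z)"
  unfolding is_algebra_def by blast

lemma aone_mult [simp]:
  "is_algebra A \<Longrightarrow> x \<in> carrier A \<Longrightarrow> amult A (aone A) x = x"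
  "is_algebra A \<Longrightarrow> x \<in> carrier A \<Longrightarrow> amult A x (aone A) = x"
  unfolding is_algebra_def by blast+

lemma lmap_amult1 [lin_intros]:
  "is_algebra A \<Longrightarrow> lmap X A h \<Longrightarrow> y \<in> carrier A \<Longrightarrow> lmap X A (\<lambda>x. amult A (h x) y)"
  by (rule bil_comp1[OF amult_bil])

lemma lmap_amult2 [lin_intros]:
  "is_algebra A \<Longrightarrow> lmap X A h \<Longrightarrow> x \<in> carrier A \<Longrightarrow> lmap X A (\<lambda>y. amult A x (h y))"
  by (rule bil_comp2[OF amult_bil])

lemma amult_vscale:
  assumes "is_algebra A" "x \<in> carrier A" "y \<in> carrier A"
  shows "amult A (vscale A c x) y = vscale A c (amult A x y)"
    "amult A x (vscale A c y) = vscale A c (amult A x y)"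
  using lmap_scale[OF bil_lmap1[OF amult_bil[OF assms(1)] assms(3)] assms(2)]
    lmap_scale[OF bil_lmap2[OF amult_bil[OF assms(1)] assms(2)] assms(3)] by simp_all

lemma amult_lift:
  assumes "is_algebra A" "adm E V W A F" "t \<in> carrier (tspace E V W)" "x \<in> carrier A"
  shows "amult A x (lift E V W A F t) = lift E V W A (\<lambda>a b. amult A x (F a b)) t"
    "amult A (lift E V W A F t) x = lift E V W A (\<lambda>a b. amult A (F a b) x) t"
  using lmap_lift_comm[OF bil_lmap2[OF amult_bil[OF assms(1)] assms(4)] assms(2,3)]
    lmap_lift_comm[OF bil_lmap1[OF amult_bil[OF assms(1)] assms(4)] assms(2,3)] by simp_all

declare amult_closed [lin_intros]

section \<open>The algebra structure on a tensor product\<close>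

lemma same_tensor_alg: "same_vs (tensor_alg A C) (tensor A C)"
  by (simp add: same_vs_def tensor_alg_def vspace.defs alg.defs)

lemma tensor_alg_simps [simp]:
  "carrier (tensor_alg A C) = carrier (tensor A C)" "vadd (tensor_alg A C) = vadd (tensor A C)"
  "vzero (tensor_alg A C) = vzero (tensor A C)" "vscale (tensor_alg A C) = vscale (tensor A C)"
  "aone (tensor_alg A C) = tpure A C (aone A) (aone C)"
  by (simp_all add: tensor_alg_def alg.defs vspace.defs)

lemmas tensor_alg_same [simp] =
  is_vspace_same[OF same_tensor_alg]
  tspace_same[OF same_vs_refl same_tensor_alg] tspace_same[OF same_tensor_alg same_vs_refl]
  lift_same[OF same_vs_refl same_tensor_alg same_vs_refl] lift_same[OF same_tensor_alg same_vs_refl same_vs_refl]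
  lmap_same[OF same_vs_refl same_tensor_alg] lmap_same[OF same_tensor_alg same_vs_refl]

context
  fixes A :: "('k::field, 'a, 'm) alg_scheme" and C :: "('k, 'b, 'n) alg_scheme"
  assumes A: "is_algebra A" and C: "is_algebra C"
begin

lemma amult_tensor:
  "s \<in> carrier (tensor A C) \<Longrightarrow> t \<in> carrier (tensor A C) \<Longrightarrow>
   amult (tensor_alg A C) s t = tlift A C (tensor A C)
          (\<lambda>x y. tlift A C (tensor A C)
             (\<lambda>x' y'. tpure A C (amult A x x') (amult C y y')) t) s"
  by (simp add: tensor_alg_def vspace.defs alg.defs)

lemma amult_tensor_bil: "bil (tensor A C) (tensor A C) (tensor A C) (amult (tensor_alg A C))"
proof -
  have "bil (tensor A C) (tensor A C) (tensor A C) (\<lambda>s t. tlift A C (tensor A C)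
          (\<lambda>x y. tlift A C (tensor A C)
             (\<lambda>x' y'. tpure A C (amult A x x') (amult C y y')) t) s)"
    using A C by (intro lin_intros) (simp_all)
  then show ?thesis
    unfolding bil_def by (simp add: amult_tensor cong: lmap_cong_iff)
qed

lemma amult_tensor_pure:
  assumes "x \<in> carrier A" "y \<in> carrier C" "x' \<in> carrier A" "y' \<in> carrier C"
  shows "amult (tensor_alg A C) (tpure A C x y) (tpure A C x' y') = tpure A C (amult A x x') (amult C y y')"
proof -
  have "adm {} A C (tensor A C) (\<lambda>x y. tlift A C (tensor A C)
             (\<lambda>x' y'. tpure A C (amult A x x') (amult C y y')) (tpure A C x' y'))"
    using A C assms by (intro lin_intros) simp_all
  moreover have "adm {} A C (tensor A C) (\<lambda>x' y'. tpure A C (amult A x x') (amult C y y'))"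
    using A C assms by (intro lin_intros) simp_all
  ultimately show ?thesis
    using assms by (simp add: amult_tensor lift_pure)
qed

text \<open>All laws are multilinear identities and can be checked on pure tensors; for
  associativity the three factors are made pure one after the other.\<close>

lemma is_algebra_tensor: "is_algebra (tensor_alg A C)"
proof -
  let ?T = "tensor_alg A C"
  let ?t = "tensor A C"
  have mem: "amult ?T s t \<in> carrier ?t" if "s \<in> carrier ?t" "t \<in> carrier ?t" for s t
    using bil_closed[OF amult_tensor_bil that] .
  note li = bil_comp1[OF amult_tensor_bil] bil_comp2[OF amult_tensor_bil]
  have assoc: "\<forall>s\<in>carrier ?t. amult ?T (amult ?T s t) u = amult ?T s (amult ?T t u)"
    if t: "t \<in> carrier ?t" and u: "u \<in> carrier ?t" for t u
  proof (rule tspace_eqI[where U = ?t])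
    fix x y assume xy: "x \<in> carrier A" "y \<in> carrier C"
    have "\<forall>t\<in>carrier ?t. amult ?T (amult ?T (tpure A C x y) t) u = amult ?T (tpure A C x y) (amult ?T t u)"
    proof (rule tspace_eqI[where U = ?t])
      fix x' y' assume xy': "x' \<in> carrier A" "y' \<in> carrier C"
      have "\<forall>u\<in>carrier ?t. amult ?T (amult ?T (tpure A C x y) (tpure A C x' y')) u =
         amult ?T (tpure A C x y) (amult ?T (tpure A C x' y') u)"
        by (rule tspace_eqI[where U = ?t])
          ((intro li lmap_id)?; use xy xy' A C in \<open>simp add: amult_tensor_pure amult_assoc mem\<close>)+
      then show "amult ?T (amult ?T (tpure A C x y) (tpure A C x' y')) u =
         amult ?T (tpure A C x y) (amult ?T (tpure A C x' y') u)" using u by blast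
    qed ((intro li lmap_id)?; use xy u mem in simp)+
    then show "amult ?T (amult ?T (tpure A C x y) t) u = amult ?T (tpure A C x y) (amult ?T t u)"
      using t by blast
  qed ((intro li lmap_id)?; use t u mem in simp)+
  have one: "\<forall>s\<in>carrier ?t. amult ?T (aone ?T) s = s" "\<forall>s\<in>carrier ?t. amult ?T s (aone ?T) = s"
    by (rule tspace_eqI[where U = ?t]; ((intro li lmap_id)?; use A C in \<open>simp add: amult_tensor_pure\<close>))+
  have ext: "amult ?T \<in> extensional (carrier ?t)" "amult ?T s \<in> extensional (carrier ?t)" if "s \<in> carrier ?t" for s
    using that by (simp_all add: tensor_alg_def vspace.defs alg.defs)
  have "amult ?T \<in> carrier ?t \<rightarrow>\<^sub>E carrier ?t \<rightarrow>\<^sub>E carrier ?t"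
  proof (rule PiE_I)
    fix s assume s: "s \<in> carrier ?t"
    show "amult ?T s \<in> carrier ?t \<rightarrow>\<^sub>E carrier ?t"
      using mem[OF s] ext(2)[OF s] by (simp add: PiE_iff)
  next
    fix s assume "s \<notin> carrier ?t"
    then show "amult ?T s = undefined"
      by (simp add: tensor_alg_def vspace.defs alg.defs)
  qed
  moreover have "bil ?T ?T ?T (amult ?T)" using amult_tensor_bil by (simp add: bil_def)
  ultimately have "bilinear ?T ?T ?T (amult ?T)" by (subst bilinear_iff_bil) simp_all
  moreover have "is_vspace ?T" by simp
  ultimately show ?thesis
    unfolding is_algebra_def tensor_alg_simps(1) using A C assoc one by simp
qed

text \<open>This is how multiplicativity of \<open>\<Delta>\<close> enters Sweedler computations: a
  sum over a product becomes a double sum.\<close>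

lemma tlift_amult_tensor:
  assumes F: "bil A C U F" and s: "s \<in> carrier (tensor A C)" and t: "t \<in> carrier (tensor A C)"
  shows "tlift A C U F (amult (tensor_alg A C) s t) =
    tlift A C U (\<lambda>x y. tlift A C U (\<lambda>x' y'. F (amult A x x') (amult C y y')) t) s"
proof -
  have a: "adm {} A C U F" using A C F by (intro adm_tensor) simp_all
  have b: "adm {} A C (tensor A C) (\<lambda>x' y'. tpure A C (amult A x x') (amult C y y'))"
    if "x \<in> carrier A" "y \<in> carrier C" for x y
    using A C that by (intro lin_intros) simp_all
  have c: "adm {} A C (tensor A C) (\<lambda>x y. tlift A C (tensor A C)
             (\<lambda>x' y'. tpure A C (amult A x x') (amult C y y')) t)"
    using A C t by (intro lin_intros) simp_all
  show ?thesis
    unfolding amult_tensor[OF s t] lift_lift[OF a c s]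
    using A C t by (intro lift_cong) (simp add: lift_lift[OF a b] lift_pure[OF a] cong: lift_cong)
qed

end

section \<open>Sweedler rules for coalgebras and convolution inverses\<close>

lemma coalgebra_vspace: "is_coalgebra V \<Delta> \<epsilon> \<Longrightarrow> is_vspace V"
  by (simp add: is_coalgebra_def)

lemma coalgebra_lmap:
  assumes "is_coalgebra V \<Delta> \<epsilon>"
  shows "lmap V (tensor V V) \<Delta>" "lmap V kspace \<epsilon>"
  using assms unfolding is_coalgebra_def by (auto intro: lmap_of_lin)

text \<open>The Sweedler form of coassociativity. A trilinear \<open>F\<close> factors through a
  linear map \<Phi> on \<open>V \<otimes> (V \<otimes> V)\<close>, and applying \<Phi> to the two
  sides of the coassociativity axiom yields the two double sums.\<close>

lemma coassoc_lift:
  assumes C: "is_coalgebra V \<Delta> \<epsilon>" and F: "tril V V V U F" and x: "x \<in> carrier V"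
  shows "tlift V V U (\<lambda>a b. tlift V V U (\<lambda>a1 a2. F a1 a2 b) (\<Delta> a)) (\<Delta> x) =
    tlift V V U (\<lambda>a b. tlift V V U (F a) (\<Delta> b)) (\<Delta> x)"
proof -
  let ?W = "tensor V V"
  note V = coalgebra_vspace[OF C] and \<Delta> = coalgebra_lmap(1)[OF C]
  have \<Delta>c: "\<Delta> a \<in> carrier ?W" if "a \<in> carrier V" for a using \<Delta> that by (rule lmap_closed)
  have aF: "adm {} V V U (F a)" if "a \<in> carrier V" for a
    using that F V by (intro adm_tensor bilI) (simp_all add: tril_def)
  have aF': "adm {} V V U (\<lambda>x y. F x y z)" if "z \<in> carrier V" for z
    using that F V by (intro adm_tensor bilI) (simp_all add: tril_def)
  have a\<Phi>: "adm {} V ?W U (\<lambda>a s. tlift V V U (F a) s)"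
  proof (rule adm_tensor[OF V _ bilI])
    show "lmap ?W U (\<lambda>s. tlift V V U (F a) s)" if "a \<in> carrier V" for a
      using that by (intro lmap_lift aF)
    show "lmap V U (\<lambda>a. tlift V V U (F a) s)" if "s \<in> carrier ?W" for s
      using that F V by (intro lmap_lift_fun aF) (simp_all add: tril_def)
  qed simp
  define \<Phi> where "\<Phi> = tlift V ?W U (\<lambda>a s. tlift V V U (F a) s)"
  have \<Phi>: "lmap (tensor V ?W) U \<Phi>" unfolding \<Phi>_def by (rule lmap_lift[OF a\<Phi>])
  have \<Phi>_pure: "\<Phi> (tpure V ?W a s) = tlift V V U (F a) s" if "a \<in> carrier V" "s \<in> carrier ?W" for a s
    unfolding \<Phi>_def using that by (rule lift_pure[OF a\<Phi>])
  have R: "\<Phi> (tmap V V V ?W (\<lambda>y. y) \<Delta> (\<Delta> x)) = tlift V V U (\<lambda>a b. tlift V V U (F a) (\<Delta> b)) (\<Delta> x)"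
    unfolding tmap_def lmap_lift_comm[OF \<Phi> adm_tmap[OF lmap_id[OF V] \<Delta>] \<Delta>c[OF x]]
    by (rule lift_cong) (simp add: \<Phi>_pure \<Delta>c)
  have pure: "\<Phi> (tassoc V V V (tpure ?W V s z)) = tlift V V U (\<lambda>x y. F x y z) s"
    if "s \<in> carrier ?W" "z \<in> carrier V" for s z
    unfolding tassoc_pure[OF V V V that] lmap_lift_comm[OF \<Phi> adm_tassoc_inner[OF V V V that(2)] that(1)]
    using that by (intro lift_cong) (simp add: \<Phi>_pure lift_pure[OF aF])
  have L: "\<Phi> (tassoc V V V (tmap V V ?W V \<Delta> (\<lambda>y. y) (\<Delta> x))) =
      tlift V V U (\<lambda>a b. tlift V V U (\<lambda>a1 a2. F a1 a2 b) (\<Delta> a)) (\<Delta> x)"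
    unfolding tmap_def lmap_lift_comm[OF lmap_comp[OF \<Phi> lmap_tassoc[OF V V V]]
        adm_tmap[OF \<Delta> lmap_id[OF V]] \<Delta>c[OF x]]
    by (rule lift_cong) (simp add: pure \<Delta>c)
  show ?thesis using C x unfolding is_coalgebra_def by (simp flip: L R)
qed

text \<open>Obtained by applying the linear map \<open>G\<close> to the counit axioms; in this form
  a summand containing \<open>\<epsilon>\<close> gets removed from a sum.\<close>

lemma counit_lift:
  assumes C: "is_coalgebra V \<Delta> \<epsilon>" and G: "lmap V U G" and x: "x \<in> carrier V"
  shows "tlift V V U (\<lambda>a b. vscale U (\<epsilon> a) (G b)) (\<Delta> x) = G x"
    and "tlift V V U (\<lambda>a b. vscale U (\<epsilon> b) (G a)) (\<Delta> x) = G x"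
proof -
  note V = coalgebra_vspace[OF C] and \<Delta> = coalgebra_lmap(1)[OF C] and \<epsilon> = coalgebra_lmap(2)[OF C]
  have \<Delta>c: "\<Delta> x \<in> carrier (tensor V V)" using \<Delta> x by (rule lmap_closed)
  have a1: "adm {} V V V (\<lambda>y z. vscale V (\<epsilon> y) z)" and a2: "adm {} V V V (\<lambda>y z. vscale V (\<epsilon> z) y)"
    using V by (intro lin_intros \<epsilon>; simp)+
  have "G (tlift V V V (\<lambda>y z. vscale V (\<epsilon> y) z) (\<Delta> x)) = tlift V V U (\<lambda>a b. vscale U (\<epsilon> a) (G b)) (\<Delta> x)"
    unfolding lmap_lift_comm[OF G a1 \<Delta>c] by (rule lift_cong) (simp add: lmap_scale[OF G])
  then show "tlift V V U (\<lambda>a b. vscale U (\<epsilon> a) (G b)) (\<Delta> x) = G x"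
    using C x unfolding is_coalgebra_def by simp
  have "G (tlift V V V (\<lambda>y z. vscale V (\<epsilon> z) y) (\<Delta> x)) = tlift V V U (\<lambda>a b. vscale U (\<epsilon> b) (G a)) (\<Delta> x)"
    unfolding lmap_lift_comm[OF G a2 \<Delta>c] by (rule lift_cong) (simp add: lmap_scale[OF G])
  then show "tlift V V U (\<lambda>a b. vscale U (\<epsilon> b) (G a)) (\<Delta> x) = G x"
    using C x unfolding is_coalgebra_def by simp
qed

text \<open>In the convolution monoid of linear maps from \<open>C\<close> to \<open>A\<close>, a
  left and a right inverse of \<open>f\<close> coincide:
  \<open>l = l \<star> (f \<star> r) = (l \<star> f) \<star> r = r\<close>. Uniqueness of antipodes
  and their compatibility with \<open>\<Delta>\<close> and with bialgebra maps are
  instances.\<close>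

lemma convolution_inverse_unique:
  assumes C: "is_coalgebra C \<Delta> \<epsilon>" and A: "is_algebra A"
    and l: "lmap C A l" and f: "lmap C A f" and r: "lmap C A r"
    and lf: "\<And>x. x \<in> carrier C \<Longrightarrow> tlift C C A (\<lambda>a b. amult A (l a) (f b)) (\<Delta> x) = vscale A (\<epsilon> x) (aone A)"
    and fr: "\<And>x. x \<in> carrier C \<Longrightarrow> tlift C C A (\<lambda>a b. amult A (f a) (r b)) (\<Delta> x) = vscale A (\<epsilon> x) (aone A)"
    and x: "x \<in> carrier C"
  shows "l x = r x"
proof -
  note V = coalgebra_vspace[OF C] and \<Delta> = coalgebra_lmap(1)[OF C] and \<epsilon> = coalgebra_lmap(2)[OF C]
  note cl = lmap_closed[OF l] lmap_closed[OF f] lmap_closed[OF r] lmap_closed[OF \<Delta>]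
  let ?F = "\<lambda>a b c. amult A (l a) (amult A (f b) (r c))"
  have F: "tril C C C A ?F"
    by (intro trilI lin_intros lmap_comp[OF l] lmap_comp[OF f] lmap_comp[OF r]) (simp_all add: A V cl)
  have a1: "adm {} C C A (\<lambda>a b. amult A (f a) (r b))" and a2: "adm {} C C A (\<lambda>a b. amult A (l a) (f b))"
    by (intro lin_intros lmap_comp[OF l] lmap_comp[OF f] lmap_comp[OF r]; simp add: A V cl)+
  have "l x = tlift C C A (\<lambda>a b. vscale A (\<epsilon> b) (l a)) (\<Delta> x)"
    using counit_lift(2)[OF C l x] by simp
  also have "\<dots> = tlift C C A (\<lambda>a b. tlift C C A (?F a) (\<Delta> b)) (\<Delta> x)"
    by (rule lift_cong) (simp add: amult_lift[OF A a1, symmetric] cl fr amult_vscale A)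
  also have "\<dots> = tlift C C A (\<lambda>a b. tlift C C A (\<lambda>a1 a2. ?F a1 a2 b) (\<Delta> a)) (\<Delta> x)"
    by (rule coassoc_lift[OF C F x, symmetric])
  also have "\<dots> = tlift C C A (\<lambda>a b. vscale A (\<epsilon> a) (r b)) (\<Delta> x)"
  proof (rule lift_cong)
    fix a b assume ab: "a \<in> carrier C" "b \<in> carrier C"
    have "tlift C C A (\<lambda>a1 a2. ?F a1 a2 b) (\<Delta> a) = tlift C C A (\<lambda>a1 a2. amult A (amult A (l a1) (f a2)) (r b)) (\<Delta> a)"
      by (rule lift_cong) (simp add: amult_assoc A cl ab)
    also have "\<dots> = vscale A (\<epsilon> a) (r b)"
      by (simp add: amult_lift[OF A a2, symmetric] cl ab lf amult_vscale A)
    finally show "tlift C C A (\<lambda>a1 a2. ?F a1 a2 b) (\<Delta> a) = vscale A (\<epsilon> a) (r b)" .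
  qed
  also have "\<dots> = r x" by (rule counit_lift(1)[OF C r x])
  finally show ?thesis .
qed


section \<open>Bialgebras\<close>

lemma bialgebra_algebra [simp]: "is_bialgebra H \<Longrightarrow> is_algebra H"
  by (simp add: is_bialgebra_def)

lemma bialgebra_coalgebra: "is_bialgebra H \<Longrightarrow> is_coalgebra H (bcomult H) (bcounit H)"
  by (simp add: is_bialgebra_def)

lemma lmap_bcomult [lin_intros]:
  "is_bialgebra H \<Longrightarrow> lmap X H h \<Longrightarrow> lmap X (tensor H H) (\<lambda>x. bcomult H (h x))"
  by (rule lmap_comp[OF coalgebra_lmap(1)[OF bialgebra_coalgebra]])

lemma lmap_bcounit [lin_intros]:
  "is_bialgebra H \<Longrightarrow> lmap X H h \<Longrightarrow> lmap X kspace (\<lambda>x. bcounit H (h x))"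
  by (rule lmap_comp[OF coalgebra_lmap(2)[OF bialgebra_coalgebra]])

lemma bcomult_closed [simp, lin_intros]:
  "is_bialgebra H \<Longrightarrow> x \<in> carrier H \<Longrightarrow> bcomult H x \<in> carrier (tensor H H)"
  by (rule lmap_closed[OF coalgebra_lmap(1)[OF bialgebra_coalgebra]])

lemma bcomult_mult: "is_bialgebra H \<Longrightarrow> x \<in> carrier H \<Longrightarrow> y \<in> carrier H \<Longrightarrow>
  bcomult H (amult H x y) = amult (tensor_alg H H) (bcomult H x) (bcomult H y)"
  unfolding is_bialgebra_def by blast

lemma bcounit_mult: "is_bialgebra H \<Longrightarrow> x \<in> carrier H \<Longrightarrow> y \<in> carrier H \<Longrightarrow>
  bcounit H (amult H x y) = bcounit H x * bcounit H y"
  unfolding is_bialgebra_def by blast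

lemma bcomult_one: "is_bialgebra H \<Longrightarrow> bcomult H (aone H) = tpure H H (aone H) (aone H)"
  by (simp add: is_bialgebra_def)

lemma bcounit_one: "is_bialgebra H \<Longrightarrow> bcounit H (aone H) = 1"
  by (simp add: is_bialgebra_def)

lemma bcomult_mult_lift:
  assumes "is_bialgebra H" "bil H H U F" "x \<in> carrier H" "y \<in> carrier H"
  shows "tlift H H U F (bcomult H (amult H x y)) =
    tlift H H U (\<lambda>a b. tlift H H U (\<lambda>c d. F (amult H a c) (amult H b d)) (bcomult H y)) (bcomult H x)"
  using assms by (simp add: bcomult_mult tlift_amult_tensor)

context
  fixes H :: "('k::field, 'a, 'm) bialg_scheme"
  assumes H: "is_bialgebra H"
begin

text \<open>Both maps are convolution inverses of the identity. Uniqueness is what gives the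
  definite description \<open>antipode\<close> a meaning.\<close>

lemma antipode_unique:
  assumes "is_antipode H s" "is_antipode H s'"
  shows "s = s'"
proof -
  note C = bialgebra_coalgebra[OF H]
  have lm: "lmap H H s" "lmap H H s'"
    using assms H by (auto simp: is_antipode_def intro: lmap_of_lin)
  have "s x = s' x" if "x \<in> carrier H" for x
    by (rule convolution_inverse_unique[OF C _ lm(1) lmap_id lm(2) _ _ that])
      (use assms H in \<open>simp_all add: is_antipode_def\<close>)
  moreover have "s \<in> extensional (carrier H)" "s' \<in> extensional (carrier H)"
    using assms H by (simp_all add: is_antipode_def lin_iff_lmap)
  ultimately show ?thesis by (intro extensionalityI) auto
qed

end

section \<open>Properties of the antipode\<close>

locale hopf =
  fixes H :: "('k::field, 'a, 'm) bialg_scheme"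
  assumes hopf: "is_hopf_algebra H"
begin

lemma bialgebra [simp]: "is_bialgebra H"
  using hopf by (simp add: is_hopf_algebra_def)

lemma algebra [simp]: "is_algebra H"
  by (rule bialgebra_algebra[OF bialgebra])

lemma vspace [simp]: "is_vspace H"
  by simp

lemmas coalgebra = bialgebra_coalgebra[OF bialgebra]

lemma is_antipode: "is_antipode H (antipode H)"
proof -
  have "\<exists>!s. is_antipode H s"
    using hopf antipode_unique[OF bialgebra] by (auto simp: is_hopf_algebra_def)
  then show ?thesis unfolding antipode_def by (rule theI')
qed

lemma antipode_lmap: "lmap H H (antipode H)"
  using is_antipode by (auto simp: is_antipode_def intro: lmap_of_lin)

lemma antipode_lin: "antipode H \<in> lin H H"
  using is_antipode by (simp add: is_antipode_def)

lemmas lmap_antipode [lin_intros] = lmap_comp[OF antipode_lmap]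

lemma antipode_closed [simp, lin_intros]: "x \<in> carrier H \<Longrightarrow> antipode H x \<in> carrier H"
  by (rule lmap_closed[OF antipode_lmap])

lemma antipode_left:
  "x \<in> carrier H \<Longrightarrow> tlift H H H (\<lambda>y z. amult H (antipode H y) z) (bcomult H x) = vscale H (bcounit H x) (aone H)"
  using is_antipode by (simp add: is_antipode_def)

lemma antipode_right:
  "x \<in> carrier H \<Longrightarrow> tlift H H H (\<lambda>y z. amult H y (antipode H z)) (bcomult H x) = vscale H (bcounit H x) (aone H)"
  using is_antipode by (simp add: is_antipode_def)

lemma antipode_one: "antipode H (aone H) = aone H"
proof -
  have "adm {} H H H (\<lambda>y z. amult H (antipode H y) z)" by (intro lin_intros) simp_all
  then show ?thesis
    using antipode_left[of "aone H"] by (simp add: bcomult_one bcounit_one lift_pure)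
qed

text \<open>As \<open>\<epsilon>\<close> is multiplicative, it may be applied to the antipode axiom
  once \<open>S(x)\<close> has been padded to
  \<open>\<Sum> \<epsilon>(x\<^sub>2) S(x\<^sub>1)\<close>.\<close>

lemma bcounit_antipode:
  assumes x: "x \<in> carrier H"
  shows "bcounit H (antipode H x) = bcounit H x"
proof -
  note \<Delta>x = bcomult_closed[OF bialgebra x]
  have a: "adm {} H H H (\<lambda>y z. amult H (antipode H y) z)" by (intro lin_intros) simp_all
  have e: "lmap H kspace (\<lambda>x. bcounit H x)" by (intro lin_intros) simp_all
  have "bcounit H (antipode H x) = tlift H H kspace (\<lambda>y z. bcounit H z * bcounit H (antipode H y)) (bcomult H x)"
    using counit_lift(2)[OF coalgebra lmap_bcounit[OF bialgebra lmap_antipode[OF lmap_id]] x] by simp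
  also have "\<dots> = tlift H H kspace (\<lambda>y z. bcounit H (amult H (antipode H y) z)) (bcomult H x)"
    by (rule lift_cong) (simp add: bcounit_mult)
  also have "\<dots> = bcounit H (vscale H (bcounit H x) (aone H))"
    unfolding lmap_lift_comm[OF e a \<Delta>x, symmetric] by (simp add: antipode_left x)
  finally show ?thesis using lmap_scale[OF e, of "aone H" "bcounit H x"] by (simp add: bcounit_one)
qed

text \<open>The sum \<open>S(x\<^sub>1 y\<^sub>1) x\<^sub>2 y\<^sub>2 S(y\<^sub>3)
  S(x\<^sub>3)\<close> is evaluated in two ways. Cancelling \<open>y\<^sub>2 S(y\<^sub>3)\<close>
  and then \<open>x\<^sub>2 S(x\<^sub>3)\<close> leaves \<open>S(x y)\<close>; cancelling
  \<open>S(x\<^sub>1 y\<^sub>1) x\<^sub>2 y\<^sub>2\<close> leaves \<open>S(y) S(x)\<close>. This is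
  uniqueness of convolution inverses on the coalgebra \<open>H \<otimes> H\<close>, written out in
  elements of \<open>H\<close>.\<close>

lemma antipode_mult:
  assumes x: "x \<in> carrier H" and y: "y \<in> carrier H"
  shows "antipode H (amult H x y) = amult H (antipode H y) (antipode H x)"
proof -
  let ?S = "antipode H" and ?m = "amult H" and ?\<Delta> = "bcomult H" and ?e = "bcounit H"
  note \<Delta>x = bcomult_closed[OF bialgebra x] and \<Delta>y = bcomult_closed[OF bialgebra y]
  have a1: "adm {} H H H (\<lambda>a b. ?m a (?S b))" and a2: "adm {} H H H (\<lambda>a b. ?m (?S a) b)"
    by (intro lin_intros; simp)+
  \<comment> \<open>The variables \<open>a, b1, b2\<close> stand for the three coproduct factors of
    \<open>x\<close>, and \<open>c, d1, d2\<close> for those of \<open>y\<close>.\<close>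
  let ?P = "\<lambda>a b1 b2 c d1 d2. ?m (?S (?m a c)) (?m (?m b1 d1) (?m (?S d2) (?S b2)))"
  let ?M = "\<lambda>a b1 b2. tlift H H H (\<lambda>c d. tlift H H H (?P a b1 b2 c) (?\<Delta> d)) (?\<Delta> y)"
  have M: "tril H H H H ?M" by (intro trilI lin_intros) (simp_all add: y)
  have P: "tril H H H H (?P a b1 b2)" if "a \<in> carrier H" "b1 \<in> carrier H" "b2 \<in> carrier H" for a b1 b2
    using that by (intro trilI lin_intros) simp_all
  have M1: "?M a b1 b2 = ?m (?S (?m a y)) (?m b1 (?S b2))"
    if [simp]: "a \<in> carrier H" "b1 \<in> carrier H" "b2 \<in> carrier H" for a b1 b2
  proof -
    have "tlift H H H (?P a b1 b2 c) (?\<Delta> d) = vscale H (?e d) (?m (?S (?m a c)) (?m b1 (?S b2)))"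
      if [simp]: "c \<in> carrier H" "d \<in> carrier H" for c d
    proof -
      have "tlift H H H (?P a b1 b2 c) (?\<Delta> d) =
        tlift H H H (\<lambda>d1 d2. ?m (?S (?m a c)) (?m b1 (?m (?m d1 (?S d2)) (?S b2)))) (?\<Delta> d)"
        by (rule lift_cong) (simp add: amult_assoc)
      also have "\<dots> = ?m (?S (?m a c)) (?m b1 (?m (vscale H (?e d) (aone H)) (?S b2)))"
      proof -
        have b1: "adm {} H H H (\<lambda>d1 d2. ?m (?m d1 (?S d2)) (?S b2))" by (intro lin_intros) simp_all
        have b2: "adm {} H H H (\<lambda>d1 d2. ?m b1 (?m (?m d1 (?S d2)) (?S b2)))" by (intro lin_intros) simp_all
        show ?thesis
          by (simp add: amult_lift[OF _ b2, symmetric] amult_lift[OF _ b1, symmetric]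
              amult_lift[OF _ a1, symmetric] antipode_right)
      qed
      finally show ?thesis by (simp add: amult_vscale)
    qed
    then have "?M a b1 b2 = tlift H H H (\<lambda>c d. vscale H (?e d) (?m (?S (?m a c)) (?m b1 (?S b2)))) (?\<Delta> y)"
      by (intro lift_cong)
    also have "\<dots> = ?m (?S (?m a y)) (?m b1 (?S b2))"
      by (rule counit_lift(2)[OF coalgebra _ y]) (intro lin_intros; simp)
    finally show ?thesis .
  qed
  have "tlift H H H (\<lambda>a b. tlift H H H (?M a) (?\<Delta> b)) (?\<Delta> x) =
      tlift H H H (\<lambda>a b. vscale H (?e b) (?S (?m a y))) (?\<Delta> x)"
  proof (rule lift_cong)
    fix a b assume [simp]: "a \<in> carrier H" "b \<in> carrier H"
    have "tlift H H H (?M a) (?\<Delta> b) = tlift H H H (\<lambda>b1 b2. ?m (?S (?m a y)) (?m b1 (?S b2))) (?\<Delta> b)"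
      by (rule lift_cong) (simp only: M1 \<open>a \<in> carrier H\<close>)
    also have "\<dots> = vscale H (?e b) (?S (?m a y))"
      by (simp add: amult_lift[OF _ a1, symmetric] antipode_right amult_vscale y)
    finally show "tlift H H H (?M a) (?\<Delta> b) = vscale H (?e b) (?S (?m a y))" .
  qed
  also have "\<dots> = ?S (?m x y)"
    by (rule counit_lift(2)[OF coalgebra _ x]) (intro lin_intros; simp add: y)
  finally have 1: "tlift H H H (\<lambda>a b. tlift H H H (?M a) (?\<Delta> b)) (?\<Delta> x) = ?S (?m x y)" .
  have "tlift H H H (\<lambda>a b. tlift H H H (?M a) (?\<Delta> b)) (?\<Delta> x) =
      tlift H H H (\<lambda>a b. tlift H H H (\<lambda>a1 a2. ?M a1 a2 b) (?\<Delta> a)) (?\<Delta> x)"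
    by (rule coassoc_lift[OF coalgebra M x, symmetric])
  also have "\<dots> = tlift H H H (\<lambda>a b. vscale H (?e a) (?m (?S y) (?S b))) (?\<Delta> x)"
  proof (rule lift_cong)
    fix a b assume [simp]: "a \<in> carrier H" "b \<in> carrier H"
    let ?Q = "\<lambda>a1 a2 c1 c2 d. ?m (?m (?S (?m a1 c1)) (?m a2 c2)) (?m (?S d) (?S b))"
    have "tlift H H H (\<lambda>a1 a2. ?M a1 a2 b) (?\<Delta> a) =
      tlift H H H (\<lambda>a1 a2. tlift H H H (\<lambda>c d. tlift H H H (\<lambda>c1 c2. ?P a1 a2 b c1 c2 d) (?\<Delta> c)) (?\<Delta> y)) (?\<Delta> a)"
      by (rule lift_cong) (rule coassoc_lift[OF coalgebra P y, symmetric]; simp)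
    also have "\<dots> = tlift H H H (\<lambda>a1 a2. tlift H H H (\<lambda>c d. tlift H H H (\<lambda>c1 c2. ?Q a1 a2 c1 c2 d) (?\<Delta> c)) (?\<Delta> y)) (?\<Delta> a)"
      by (intro lift_cong) (simp add: amult_assoc)
    \<comment> \<open>The sums over the factors of \<open>x\<close> and of \<open>y\<close> are
      interchanged, so that \<open>\<Delta>(a)\<close> and \<open>\<Delta>(c)\<close> stand together
      and combine to \<open>\<Delta>(a c)\<close>.\<close>
    also have "\<dots> = tlift H H H (\<lambda>c d. tlift H H H (\<lambda>a1 a2. tlift H H H (\<lambda>c1 c2. ?Q a1 a2 c1 c2 d) (?\<Delta> c)) (?\<Delta> a)) (?\<Delta> y)"
      by (rule tlift_swap; (intro lin_intros)?; simp add: y)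
    also have "\<dots> = tlift H H H (\<lambda>c d. vscale H (?e c) (vscale H (?e a) (?m (?S d) (?S b)))) (?\<Delta> y)"
    proof (rule lift_cong)
      fix c d assume [simp]: "c \<in> carrier H" "d \<in> carrier H"
      have b1: "adm {} H H H (\<lambda>c1 c2. ?m (?S (?m a1 c1)) (?m a2 c2))" if "a1 \<in> carrier H" "a2 \<in> carrier H" for a1 a2
        using that by (intro lin_intros) simp_all
      have b2: "adm {} H H H (\<lambda>a1 a2. tlift H H H (\<lambda>c1 c2. ?m (?S (?m a1 c1)) (?m a2 c2)) (?\<Delta> c))"
        by (intro lin_intros) simp_all
      have "tlift H H H (\<lambda>a1 a2. tlift H H H (\<lambda>c1 c2. ?Q a1 a2 c1 c2 d) (?\<Delta> c)) (?\<Delta> a) =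
        tlift H H H (\<lambda>a1 a2. ?m (tlift H H H (\<lambda>c1 c2. ?m (?S (?m a1 c1)) (?m a2 c2)) (?\<Delta> c)) (?m (?S d) (?S b))) (?\<Delta> a)"
        by (rule lift_cong) (simp add: amult_lift[OF _ b1])
      also have "\<dots> = ?m (tlift H H H (\<lambda>a1 a2. tlift H H H (\<lambda>c1 c2. ?m (?S (?m a1 c1)) (?m a2 c2)) (?\<Delta> c)) (?\<Delta> a)) (?m (?S d) (?S b))"
        by (simp add: amult_lift[OF _ b2])
      also have "tlift H H H (\<lambda>a1 a2. tlift H H H (\<lambda>c1 c2. ?m (?S (?m a1 c1)) (?m a2 c2)) (?\<Delta> c)) (?\<Delta> a)
          = tlift H H H (\<lambda>u v. ?m (?S u) v) (?\<Delta> (?m a c))"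
        by (rule bcomult_mult_lift[symmetric, OF bialgebra]; (intro lin_intros)?; simp)
      finally show "tlift H H H (\<lambda>a1 a2. tlift H H H (\<lambda>c1 c2. ?Q a1 a2 c1 c2 d) (?\<Delta> c)) (?\<Delta> a)
        = vscale H (?e c) (vscale H (?e a) (?m (?S d) (?S b)))"
        by (simp add: antipode_left amult_vscale bcounit_mult vscale_mult vscale_commute[of H _ "?e c"])
    qed
    also have "\<dots> = vscale H (?e a) (?m (?S y) (?S b))"
      by (rule counit_lift(1)[OF coalgebra _ y]) (intro lin_intros; simp)
    finally show "tlift H H H (\<lambda>a1 a2. ?M a1 a2 b) (?\<Delta> a) = vscale H (?e a) (?m (?S y) (?S b))" .
  qed
  also have "\<dots> = ?m (?S y) (?S x)"
    by (rule counit_lift(1)[OF coalgebra _ x]) (intro lin_intros; simp add: y)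
  finally show ?thesis using 1 by simp
qed

text \<open>In the convolution monoid of maps from \<open>H\<close> to \<open>H \<otimes> H\<close>,
  the map \<open>\<Delta> S\<close> is a left inverse and
  \<open>x \<mapsto> S(x\<^sub>2) \<otimes> S(x\<^sub>1)\<close> a right inverse of
  \<open>\<Delta>\<close>.\<close>

lemma bcomult_antipode:
  assumes x: "x \<in> carrier H"
  shows "bcomult H (antipode H x) = tlift H H (tensor H H) (\<lambda>a b. tpure H H (antipode H b) (antipode H a)) (bcomult H x)"
proof -
  let ?S = "antipode H" and ?m = "amult H" and ?\<Delta> = "bcomult H" and ?e = "bcounit H"
  let ?T = "tensor_alg H H" and ?t = "tensor H H"
  let ?r = "\<lambda>x. tlift H H ?t (\<lambda>a b. tpure H H (?S b) (?S a)) (?\<Delta> x)"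
  have T: "is_algebra ?T" by (simp add: is_algebra_tensor)
  have a1: "adm {} H H H (\<lambda>a b. ?m a (?S b))" and a2: "adm {} H H H (\<lambda>a b. ?m (?S a) b)"
    by (intro lin_intros; simp)+
  have ar: "adm {} H H ?t (\<lambda>a b. tpure H H (?S b) (?S a))" by (intro lin_intros) simp_all
  have lD: "lmap H ?t ?\<Delta>" by (intro lin_intros) simp_all
  note mT = lmap_comp[OF bil_lmap1[OF amult_tensor_bil[OF algebra algebra]]]
    lmap_comp[OF bil_lmap2[OF amult_tensor_bil[OF algebra algebra]]]
  show ?thesis
  proof (rule convolution_inverse_unique[OF coalgebra T _ _ _ _ _ x, of "\<lambda>x. ?\<Delta> (?S x)" ?\<Delta> ?r])
    show "lmap H ?T (\<lambda>x. ?\<Delta> (?S x))" "lmap H ?T ?\<Delta>" "lmap H ?T ?r"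
      by (simp, intro lin_intros; simp)+
    fix x assume x: "x \<in> carrier H"
    note \<Delta>x = bcomult_closed[OF bialgebra x]
    have "tlift H H ?T (\<lambda>a b. amult ?T (?\<Delta> (?S a)) (?\<Delta> b)) (?\<Delta> x) = tlift H H ?t (\<lambda>a b. ?\<Delta> (?m (?S a) b)) (?\<Delta> x)"
      unfolding lift_same[OF same_vs_refl same_vs_refl same_tensor_alg]
      by (rule lift_cong) (simp add: bcomult_mult)
    also have "\<dots> = ?\<Delta> (vscale H (?e x) (aone H))"
      unfolding lmap_lift_comm[OF lD a2 \<Delta>x, symmetric] by (simp add: antipode_left x)
    also have "\<dots> = vscale ?T (?e x) (aone ?T)"
      by (simp add: lmap_scale[OF lD] bcomult_one)
    finally show "tlift H H ?T (\<lambda>a b. amult ?T (?\<Delta> (?S a)) (?\<Delta> b)) (?\<Delta> x) = vscale ?T (?e x) (aone ?T)" .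
    have p: "adm {} H H ?t (tpure H H)" by (rule adm_pure)
    have F1: "tril H H H ?t (\<lambda>a b1 b2. amult ?T (?\<Delta> a) (tpure H H (?S b2) (?S b1)))"
      by (intro trilI mT lin_intros) simp_all
    have \<Delta>mult: "amult ?T (?\<Delta> a) (tpure H H u v) = tlift H H ?t (\<lambda>p q. tpure H H (?m p u) (?m q v)) (?\<Delta> a)"
      if [simp]: "a \<in> carrier H" "u \<in> carrier H" "v \<in> carrier H" for a u v
    proof -
      have b: "adm {} H H ?t (\<lambda>x' y'. tpure H H (?m p x') (?m q y'))" if "p \<in> carrier H" "q \<in> carrier H" for p q
        using that by (intro lin_intros) simp_all
      show ?thesis
        unfolding amult_tensor[OF algebra algebra bcomult_closed[OF bialgebra that(1)] pure_closed[OF that(2,3)]]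
        by (rule lift_cong) (simp add: lift_pure[OF b])
    qed
    have "tlift H H ?T (\<lambda>a b. amult ?T (?\<Delta> a) (?r b)) (?\<Delta> x) =
      tlift H H ?t (\<lambda>a b. tlift H H ?t (\<lambda>b1 b2. amult ?T (?\<Delta> a) (tpure H H (?S b2) (?S b1))) (?\<Delta> b)) (?\<Delta> x)"
      unfolding lift_same[OF same_vs_refl same_vs_refl same_tensor_alg]
      by (intro lift_cong lmap_lift_comm[OF mT(2)[OF _ lmap_id] ar]) simp_all
    \<comment> \<open>Rebracketing isolates the pair \<open>x\<^sub>2 S(x\<^sub>3)\<close> in
      \<open>x\<^sub>1 S(x\<^sub>4) \<otimes> x\<^sub>2 S(x\<^sub>3)\<close>; it cancels first, and
      the outer pair follows.\<close>
    also have "\<dots> = tlift H H ?t (\<lambda>a b. tlift H H ?t (\<lambda>a1 a2. amult ?T (?\<Delta> a1) (tpure H H (?S b) (?S a2))) (?\<Delta> a)) (?\<Delta> x)"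
      by (rule coassoc_lift[OF coalgebra F1 x, symmetric])
    also have "\<dots> = tlift H H ?t (\<lambda>a b. tpure H H (?m a (?S b)) (aone H)) (?\<Delta> x)"
    proof (rule lift_cong)
      fix a b assume [simp]: "a \<in> carrier H" "b \<in> carrier H"
      have F2: "tril H H H ?t (\<lambda>p q a2. tpure H H (?m p (?S b)) (?m q (?S a2)))"
        by (intro trilI lin_intros) simp_all
      have "tlift H H ?t (\<lambda>a1 a2. amult ?T (?\<Delta> a1) (tpure H H (?S b) (?S a2))) (?\<Delta> a) =
        tlift H H ?t (\<lambda>a1 a2. tlift H H ?t (\<lambda>p q. tpure H H (?m p (?S b)) (?m q (?S a2))) (?\<Delta> a1)) (?\<Delta> a)"
        by (rule lift_cong) (simp add: \<Delta>mult)
      also have "\<dots> = tlift H H ?t (\<lambda>p w. tlift H H ?t (\<lambda>q a2. tpure H H (?m p (?S b)) (?m q (?S a2))) (?\<Delta> w)) (?\<Delta> a)"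
        by (rule coassoc_lift[OF coalgebra F2]) simp
      also have "\<dots> = tlift H H ?t (\<lambda>p w. vscale ?t (?e w) (tpure H H (?m p (?S b)) (aone H))) (?\<Delta> a)"
      proof (rule lift_cong)
        fix p w assume [simp]: "p \<in> carrier H" "w \<in> carrier H"
        have g: "lmap H ?t (\<lambda>z. tpure H H (?m p (?S b)) z)" by (intro lin_intros) simp_all
        have "tlift H H ?t (\<lambda>q a2. tpure H H (?m p (?S b)) (?m q (?S a2))) (?\<Delta> w) =
          tpure H H (?m p (?S b)) (vscale H (?e w) (aone H))"
          by (simp add: lmap_lift_comm[OF g a1, symmetric] antipode_right)
        also have "\<dots> = vscale ?t (?e w) (tpure H H (?m p (?S b)) (aone H))"
          by (rule lmap_scale[OF g]) simp
        finally show "tlift H H ?t (\<lambda>q a2. tpure H H (?m p (?S b)) (?m q (?S a2))) (?\<Delta> w) =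
          vscale ?t (?e w) (tpure H H (?m p (?S b)) (aone H))" .
      qed
      also have "\<dots> = tpure H H (?m a (?S b)) (aone H)"
        by (rule counit_lift(2)[OF coalgebra]) ((intro lin_intros)?; simp)+
      finally show "tlift H H ?t (\<lambda>a1 a2. amult ?T (?\<Delta> a1) (tpure H H (?S b) (?S a2))) (?\<Delta> a) =
        tpure H H (?m a (?S b)) (aone H)" .
    qed
    also have "\<dots> = vscale ?T (?e x) (aone ?T)"
    proof -
      have g: "lmap H ?t (\<lambda>z. tpure H H z (aone H))" by (intro lin_intros) simp_all
      show ?thesis
        using lmap_scale[OF g, of "aone H" "?e x"]
        by (simp add: lmap_lift_comm[OF g a1 \<Delta>x, symmetric] antipode_right x)
    qed
    finally show "tlift H H ?T (\<lambda>a b. amult ?T (?\<Delta> a) (?r b)) (?\<Delta> x) = vscale ?T (?e x) (aone ?T)" .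
  qed
qed

end

section \<open>Homomorphisms\<close>

definition alg_map :: "('k::field, 'a, 'm) alg_scheme \<Rightarrow> ('k, 'b, 'n) alg_scheme \<Rightarrow> ('a \<Rightarrow> 'b) \<Rightarrow> bool" where
  "alg_map A C g \<longleftrightarrow> is_algebra A \<and> is_algebra C \<and> lmap A C g \<and> g (aone A) = aone C \<and>
     (\<forall>x\<in>carrier A. \<forall>y\<in>carrier A. g (amult A x y) = amult C (g x) (g y))"

lemma alg_map_lmap: "alg_map A C g \<Longrightarrow> lmap A C g"
  and alg_map_one: "alg_map A C g \<Longrightarrow> g (aone A) = aone C"
  and alg_map_mult: "alg_map A C g \<Longrightarrow> x \<in> carrier A \<Longrightarrow> y \<in> carrier A \<Longrightarrow> g (amult A x y) = amult C (g x) (g y)"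
  and alg_map_algebra: "alg_map A C g \<Longrightarrow> is_algebra A" "alg_map A C g \<Longrightarrow> is_algebra C"
  by (simp_all add: alg_map_def)

lemma lmap_amult_tensor:
  assumes "is_algebra A" "is_algebra C"
  shows "lmap X (tensor A C) h \<Longrightarrow> t \<in> carrier (tensor A C) \<Longrightarrow> lmap X (tensor A C) (\<lambda>x. amult (tensor_alg A C) (h x) t)"
    and "lmap X (tensor A C) h \<Longrightarrow> t \<in> carrier (tensor A C) \<Longrightarrow> lmap X (tensor A C) (\<lambda>x. amult (tensor_alg A C) t (h x))"
  by (rule bil_comp1[OF amult_tensor_bil[OF assms]] bil_comp2[OF amult_tensor_bil[OF assms]]; assumption)+

lemma amult_tensor_closed:
  "is_algebra A \<Longrightarrow> is_algebra C \<Longrightarrow> s \<in> carrier (tensor A C) \<Longrightarrow> t \<in> carrier (tensor A C) \<Longrightarrow>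
    amult (tensor_alg A C) s t \<in> carrier (tensor A C)"
  by (rule bil_closed[OF amult_tensor_bil])

declare lmap_amult_tensor [lin_intros] amult_tensor_closed [simp, lin_intros]

lemma alg_map_tmap:
  assumes g: "alg_map A A' g" and h: "alg_map C C' h"
  shows "alg_map (tensor_alg A C) (tensor_alg A' C') (\<lambda>t. tmap A C A' C' g h t)"
proof -
  note alg = alg_map_algebra[OF g] alg_map_algebra[OF h]
  note gl = alg_map_lmap[OF g] and hl = alg_map_lmap[OF h]
  note cl = lmap_closed[OF gl] lmap_closed[OF hl]
  let ?f = "\<lambda>t. tmap A C A' C' g h t"
  have mult: "\<forall>s\<in>carrier (tensor A C). ?f (amult (tensor_alg A C) s t) = amult (tensor_alg A' C') (?f s) (?f t)"
    if t: "t \<in> carrier (tensor A C)" for t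
  proof (rule tspace_eqI)
    show "lmap (tensor A C) (tensor A' C') (\<lambda>s. ?f (amult (tensor_alg A C) s t))"
      "lmap (tensor A C) (tensor A' C') (\<lambda>s. amult (tensor_alg A' C') (?f s) (?f t))"
      by (intro lin_intros gl hl t; simp add: alg)+
    fix x y assume xy: "x \<in> carrier A" "y \<in> carrier C"
    have "\<forall>t\<in>carrier (tensor A C). ?f (amult (tensor_alg A C) (tpure A C x y) t) = amult (tensor_alg A' C') (?f (tpure A C x y)) (?f t)"
    proof (rule tspace_eqI)
      show "lmap (tensor A C) (tensor A' C') (\<lambda>t. ?f (amult (tensor_alg A C) (tpure A C x y) t))"
        "lmap (tensor A C) (tensor A' C') (\<lambda>t. amult (tensor_alg A' C') (?f (tpure A C x y)) (?f t))"
        by (intro lin_intros gl hl; simp add: alg xy)+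
    qed (simp add: amult_tensor_pure alg xy tmap_pure[OF gl hl] cl alg_map_mult[OF g] alg_map_mult[OF h])
    then show "?f (amult (tensor_alg A C) (tpure A C x y) t) = amult (tensor_alg A' C') (?f (tpure A C x y)) (?f t)"
      using t by blast
  qed
  show ?thesis
    unfolding alg_map_def
    using mult by (simp add: is_algebra_tensor alg lmap_tmap[OF gl hl] tmap_pure[OF gl hl]
        alg_map_one[OF g] alg_map_one[OF h])
qed

section \<open>Inverses and characters\<close>

lemma alg_inverse_eq:
  assumes "is_algebra A" "x \<in> carrier A" "y \<in> carrier A" "amult A x y = aone A" "amult A y x = aone A"
  shows "alg_inverse A x = y"
  unfolding alg_inverse_def
proof (rule the_equality)
  fix z assume z: "z \<in> carrier A \<and> amult A x z = aone A \<and> amult A z x = aone A"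
  then have "z = amult A z (amult A x y)" using assms by simp
  also have "\<dots> = amult A (amult A z x) y" using amult_assoc[OF assms(1) _ assms(2,3), of z] z by simp
  finally show "z = y" using assms z by simp
qed (use assms in blast)

lemma alg_inverse:
  assumes "is_algebra A" "alg_invertible A x"
  shows "alg_inverse A x \<in> carrier A" "amult A x (alg_inverse A x) = aone A"
    "amult A (alg_inverse A x) x = aone A"
proof -
  obtain y where "x \<in> carrier A" "y \<in> carrier A" "amult A x y = aone A" "amult A y x = aone A"
    using assms(2) by (auto simp: alg_invertible_def)
  then show "alg_inverse A x \<in> carrier A" "amult A x (alg_inverse A x) = aone A"
    "amult A (alg_inverse A x) x = aone A"
    using alg_inverse_eq[OF assms(1)] by auto
qed

text \<open>Meant for \<open>\<epsilon> \<otimes> \<epsilon>\<close> and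
  \<open>\<epsilon> \<otimes> (\<epsilon> \<otimes> \<epsilon>)\<close> on powers of
  \<open>B\<close>: as tensor products of characters these are characters, so they can be applied to
  the multiplicative axioms for \<open>S\<close>.\<close>

lemma tlift_character_mult:
  assumes A: "is_algebra A" and C: "is_algebra C" and c: "lmap A kspace c" and d: "lmap C kspace d"
    and cm: "\<And>x y. x \<in> carrier A \<Longrightarrow> y \<in> carrier A \<Longrightarrow> c (amult A x y) = c x * c y"
    and dm: "\<And>x y. x \<in> carrier C \<Longrightarrow> y \<in> carrier C \<Longrightarrow> d (amult C x y) = d x * d y"
    and s: "s \<in> carrier (tensor A C)" and t: "t \<in> carrier (tensor A C)"
  shows "tlift A C kspace (\<lambda>x y. c x * d y) (amult (tensor_alg A C) s t) =
    tlift A C kspace (\<lambda>x y. c x * d y) s * tlift A C kspace (\<lambda>x y. c x * d y) t"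
proof -
  have b: "bil A C kspace (\<lambda>x y. c x * d y)" by (intro lin_intros c d)
  have a: "adm {} A C kspace (\<lambda>x y. c x * d y)" using A C b by (intro adm_tensor) simp_all
  let ?e = "\<lambda>t. tlift A C kspace (\<lambda>x y. c x * d y) t"
  have "?e (amult (tensor_alg A C) s t) =
      tlift A C kspace (\<lambda>x y. tlift A C kspace (\<lambda>x' y'. (c x * d y) * (c x' * d y')) t) s"
    unfolding tlift_amult_tensor[OF A C b s t] by (intro lift_cong) (simp add: cm dm)
  also have "\<dots> = tlift A C kspace (\<lambda>x y. (c x * d y) * ?e t) s"
    by (intro lift_cong lmap_lift_comm[OF lmap_times(1)[OF lmap_id] a t, symmetric]) simp_all
  also have "\<dots> = ?e s * ?e t"
    by (rule lmap_lift_comm[OF lmap_times(2)[OF lmap_id] a s, symmetric]) simp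
  finally show ?thesis .
qed

section \<open>Bialgebra morphisms\<close>

lemma bialg_hom_lmap: "f \<in> bialg_hom A H \<Longrightarrow> is_bialgebra A \<Longrightarrow> is_bialgebra H \<Longrightarrow> lmap A H f"
  by (auto simp: bialg_hom_def intro: lmap_of_lin)

lemma bialg_hom_mult: "f \<in> bialg_hom A H \<Longrightarrow> x \<in> carrier A \<Longrightarrow> y \<in> carrier A \<Longrightarrow> f (amult A x y) = amult H (f x) (f y)"
  and bialg_hom_one: "f \<in> bialg_hom A H \<Longrightarrow> f (aone A) = aone H"
  and bialg_hom_comult: "f \<in> bialg_hom A H \<Longrightarrow> x \<in> carrier A \<Longrightarrow> bcomult H (f x) = tmap A A H H f f (bcomult A x)"
  and bialg_hom_counit: "f \<in> bialg_hom A H \<Longrightarrow> x \<in> carrier A \<Longrightarrow> bcounit H (f x) = bcounit A x"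
  by (simp_all add: bialg_hom_def)

lemma bialg_hom_alg_map: "f \<in> bialg_hom A H \<Longrightarrow> is_bialgebra A \<Longrightarrow> is_bialgebra H \<Longrightarrow> alg_map A H f"
  by (simp add: alg_map_def bialg_hom_lmap bialg_hom_mult bialg_hom_one)

lemma bialg_hom_comult_lift:
  assumes "f \<in> bialg_hom A H" "is_bialgebra A" "is_bialgebra H" "bil H H U F" "x \<in> carrier A"
  shows "tlift H H U F (bcomult H (f x)) = tlift A A U (\<lambda>a b. F (f a) (f b)) (bcomult A x)"
  using assms bialg_hom_lmap[OF assms(1-3)] by (simp add: bialg_hom_comult tlift_tmap)

lemma bialg_hom_id:
  assumes "is_bialgebra H"
  shows "(\<lambda>x\<in>carrier H. x) \<in> bialg_hom H H"
proof -
  have "lmap H H (\<lambda>x\<in>carrier H. x)"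
    by (rule lmap_cong[OF lmap_id]) (use assms in simp_all)
  moreover have "tmap H H H H (\<lambda>x\<in>carrier H. x) (\<lambda>x\<in>carrier H. x) t = t" if "t \<in> carrier (tensor H H)" for t
    using tmap_cong[of H "\<lambda>x\<in>carrier H. x" "\<lambda>x. x" H "\<lambda>x\<in>carrier H. x" "\<lambda>x. x" H H t] tmap_id[OF that] by simp
  ultimately show ?thesis
    using assms by (simp add: bialg_hom_def lin_iff_lmap)
qed

lemma tmap_compose:
  assumes f: "lmap A H f" and g: "lmap H K g" and t: "t \<in> carrier (tensor A A)"
  shows "tmap A A K K (compose (carrier A) g f) (compose (carrier A) g f) t = tmap H H K K g g (tmap A A H H f f t)"
  unfolding tmap_tmap[OF f f g g t] by (rule tmap_cong) (simp_all add: compose_eq)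

lemma bialg_hom_compose:
  assumes f: "f \<in> bialg_hom A H" and g: "g \<in> bialg_hom H K"
    and A: "is_bialgebra A" and H: "is_bialgebra H" and K: "is_bialgebra K"
  shows "compose (carrier A) g f \<in> bialg_hom A K"
proof -
  note fl = bialg_hom_lmap[OF f A H] and gl = bialg_hom_lmap[OF g H K]
  have "lmap A K (compose (carrier A) g f)"
    by (rule lmap_cong[OF lmap_comp[OF gl fl]]) (simp add: compose_eq)
  then show ?thesis
    using A K lmap_closed[OF fl]
    by (simp add: bialg_hom_def lin_iff_lmap compose_extensional compose_eq tmap_compose[OF fl gl] bialg_hom_mult[OF f]
        bialg_hom_mult[OF g] bialg_hom_one[OF f] bialg_hom_one[OF g] bialg_hom_comult[OF f] bialg_hom_comult[OF g]
        bialg_hom_counit[OF f] bialg_hom_counit[OF g])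
qed

text \<open>Among linear maps from \<open>A\<close> to \<open>H\<close>, \<open>f S\<close> is a
  left and \<open>S f\<close> a right convolution inverse of \<open>f\<close>: the first because
  \<open>f\<close> respects products, the second because it respects coproducts.\<close>

lemma bialg_hom_antipode:
  assumes f: "f \<in> bialg_hom A H" and A: "is_hopf_algebra A" and H: "is_hopf_algebra H" and x: "x \<in> carrier A"
  shows "f (antipode A x) = antipode H (f x)"
proof -
  interpret A: hopf A using A by unfold_locales
  interpret H: hopf H using H by unfold_locales
  note fl = bialg_hom_lmap[OF f A.bialgebra H.bialgebra]
  have fc: "f x \<in> carrier H" if "x \<in> carrier A" for x using fl that by (rule lmap_closed)
  show ?thesis
  proof (rule convolution_inverse_unique[OF A.coalgebra H.algebra _ fl _ _ _ x])
    show "lmap A H (\<lambda>x. f (antipode A x))" by (rule lmap_comp[OF fl A.antipode_lmap])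
    show "lmap A H (\<lambda>x. antipode H (f x))" by (rule lmap_comp[OF H.antipode_lmap fl])
    fix x assume x: "x \<in> carrier A"
    have a: "adm {} A A A (\<lambda>a b. amult A (antipode A a) b)" by (intro lin_intros) simp_all
    have "tlift A A H (\<lambda>a b. amult H (f (antipode A a)) (f b)) (bcomult A x) =
        tlift A A H (\<lambda>a b. f (amult A (antipode A a) b)) (bcomult A x)"
      by (rule lift_cong) (simp add: bialg_hom_mult[OF f])
    also have "\<dots> = f (vscale A (bcounit A x) (aone A))"
      using x by (simp add: lmap_lift_comm[OF fl a, symmetric] A.antipode_left)
    finally show "tlift A A H (\<lambda>a b. amult H (f (antipode A a)) (f b)) (bcomult A x) = vscale H (bcounit A x) (aone H)"
      by (simp add: lmap_scale[OF fl] bialg_hom_one[OF f])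
    have "bil H H H (\<lambda>a b. amult H a (antipode H b))" by (intro lin_intros) simp_all
    from bialg_hom_comult_lift[OF f A.bialgebra H.bialgebra this x]
    show "tlift A A H (\<lambda>a b. amult H (f a) (antipode H (f b))) (bcomult A x) = vscale H (bcounit A x) (aone H)"
      using x by (simp add: H.antipode_right fc bialg_hom_counit[OF f])
  qed
qed


section \<open>Triangular structures\<close>

lemma triangular_hopf: "is_triangular B S \<Longrightarrow> is_hopf_algebra B"
  by (simp add: is_triangular_def is_quasitriangular_def)

lemma triangular_invertible: "is_triangular B S \<Longrightarrow> alg_invertible (tensor_alg B B) S"
  by (simp add: is_triangular_def is_quasitriangular_def)

locale triangular =
  fixes B :: "('k::field, 'a, 'm) bialg_scheme" and S
  assumes triangular: "is_triangular B S"

sublocale triangular \<subseteq> hopf B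
  using triangular_hopf[OF triangular] by unfold_locales

context triangular
begin

abbreviation S' where "S' \<equiv> alg_inverse (tensor_alg B B) S"

lemma S_closed [simp]: "S \<in> carrier (tensor B B)"
  using triangular_invertible[OF triangular] by (simp add: alg_invertible_def)

lemma S'_closed [simp]: "S' \<in> carrier (tensor B B)"
  and S_S': "amult (tensor_alg B B) S S' = tpure B B (aone B) (aone B)"
  and S'_S: "amult (tensor_alg B B) S' S = tpure B B (aone B) (aone B)"
  using alg_inverse[OF is_algebra_tensor[OF algebra algebra] triangular_invertible[OF triangular]] by simp_all

abbreviation ee where "ee \<equiv> tlift B B kspace (\<lambda>x y. bcounit B x * bcounit B y)"

lemma lmap_counit: "lmap B kspace (\<lambda>x. bcounit B x)"
  by (intro lin_intros) simp_all

lemma adm_ee: "adm {} B B kspace (\<lambda>x y. bcounit B x * bcounit B y)"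
  by (intro lin_intros lmap_counit) simp_all

lemma ee_mult:
  "s \<in> carrier (tensor B B) \<Longrightarrow> t \<in> carrier (tensor B B) \<Longrightarrow> ee (amult (tensor_alg B B) s t) = ee s * ee t"
  by (rule tlift_character_mult[OF algebra algebra lmap_counit lmap_counit]) (simp_all add: bcounit_mult)

text \<open>Applying \<open>\<epsilon> \<otimes> \<epsilon> \<otimes> \<epsilon>\<close> to the
  axiom for \<open>(\<Delta> \<otimes> Id)(S)\<close> gives \<open>e = e e\<close> for the scalar
  \<open>e = (\<epsilon> \<otimes> \<epsilon>)(S)\<close>, because \<open>\<epsilon>\<close> undoes
  \<open>\<Delta>\<close> and sends the unit inserted by a leg map to \<open>1\<close>. As
  \<open>S\<close> is invertible, so is \<open>e\<close>.\<close>

lemma ee_S: "ee S = 1" and ee_S': "ee S' = 1"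
proof -
  let ?BB = "tensor B B" and ?e = "bcounit B"
  define eee where "eee = tlift B ?BB kspace (\<lambda>x s. ?e x * ee s)"
  have lee: "lmap ?BB kspace (\<lambda>s. ee s)" by (rule lmap_lift[OF adm_ee])
  have a: "adm {} B ?BB kspace (\<lambda>x s. ?e x * ee s)" by (intro lin_intros lmap_counit lmap_comp[OF lee]) simp_all
  have leee: "lmap (tensor B ?BB) kspace eee" unfolding eee_def by (rule lmap_lift[OF a])
  have eee_pure: "eee (tpure B ?BB x (tpure B B y z)) = ?e x * (?e y * ?e z)"
    if "x \<in> carrier B" "y \<in> carrier B" "z \<in> carrier B" for x y z
    unfolding eee_def using that by (simp add: lift_pure[OF a] lift_pure[OF adm_ee])
  have TT: "is_algebra (tensor_alg B B)" by (simp add: is_algebra_tensor)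
  have eee_mult: "eee (amult (tensor_alg B (tensor_alg B B)) s t) = eee s * eee t"
    if "s \<in> carrier (tensor B ?BB)" "t \<in> carrier (tensor B ?BB)" for s t
    using tlift_character_mult[OF algebra TT lmap_counit, of "\<lambda>s. ee s" s t] that lee ee_mult
    by (simp add: bcounit_mult eee_def)
  have D: "lmap B ?BB (\<lambda>x. bcomult B x)" by (intro lin_intros) simp_all
  have a13: "adm {} B B (tensor B ?BB) (\<lambda>x y. tpure B ?BB x (tpure B B (aone B) y))"
    and a23: "adm {} B B (tensor B ?BB) (\<lambda>x y. tpure B ?BB (aone B) (tpure B B x y))"
    by (intro lin_intros; simp)+
  have 1: "eee (leg13 B S) = ee S"
    unfolding leg13_def lmap_lift_comm[OF leee a13 S_closed]
    by (rule lift_cong) (simp add: eee_pure bcounit_one)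
  have 2: "eee (leg23 B S) = ee S"
    unfolding leg23_def lmap_lift_comm[OF leee a23 S_closed]
    by (rule lift_cong) (simp add: eee_pure bcounit_one)
  have leg: "leg13 B S \<in> carrier (tensor B ?BB)" "leg23 B S \<in> carrier (tensor B ?BB)"
    unfolding leg13_def leg23_def by (simp_all add: lift_closed[OF a13] lift_closed[OF a23])
  have "eee (tassoc B B B (tmap B B ?BB B (bcomult B) (\<lambda>y. y) S)) = ee S"
    unfolding tmap_def lmap_lift_comm[OF lmap_comp[OF leee lmap_tassoc[OF vspace vspace vspace]]
        adm_tmap[OF D lmap_id[OF vspace]] S_closed]
  proof (rule lift_cong)
    fix x y assume xy: "x \<in> carrier B" "y \<in> carrier B"
    have "eee (tassoc B B B (tpure ?BB B (bcomult B x) y)) = tlift B B kspace (\<lambda>a b. ?e a * (?e b * ?e y)) (bcomult B x)"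
      unfolding tassoc_pure[OF vspace vspace vspace bcomult_closed[OF bialgebra xy(1)] xy(2)]
        lmap_lift_comm[OF leee adm_tassoc_inner[OF vspace vspace vspace xy(2)] bcomult_closed[OF bialgebra xy(1)]]
      using xy by (intro lift_cong) (simp add: eee_pure)
    also have "\<dots> = ?e x * ?e y"
      using counit_lift(1)[OF coalgebra lmap_times(2)[OF lmap_counit] xy(1)] by simp
    finally show "eee (tassoc B B B (tpure ?BB B (bcomult B x) y)) = ?e x * ?e y" .
  qed
  moreover have "tassoc B B B (tmap B B ?BB B (bcomult B) (\<lambda>y. y) S) =
      amult (tensor_alg B (tensor_alg B B)) (leg13 B S) (leg23 B S)"
    using triangular by (simp add: is_triangular_def is_quasitriangular_def)
  ultimately have "ee S * ee S = ee S" using eee_mult[OF leg] 1 2 by simp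
  moreover have inv: "ee S * ee S' = 1"
    using ee_mult[OF S_closed S'_closed] by (simp add: S_S' lift_pure[OF adm_ee] bcounit_one)
  ultimately show "ee S = 1" by auto
  then show "ee S' = 1" using inv by simp
qed

text \<open>The maps \<open>f \<otimes> f\<close> and \<open>f \<otimes> (f \<otimes> f)\<close> are
  multiplicative and commute with the leg maps, with \<open>\<Delta>\<close> in one leg and with the
  flip, so every axiom about \<open>R\<close> alone is carried over. The condition on
  \<open>\<Delta>\<close> at elements outside the image of \<open>f\<close> cannot be obtained in
  this way and is the premise of the last claim.\<close>

lemma triangular_image:
  fixes H :: "('k, 'c, 'n) bialg_scheme"
  assumes H: "is_hopf_algebra H" and f: "f \<in> bialg_hom B H"
  defines "R \<equiv> tmap B B H H f f S" and "R' \<equiv> tmap B B H H f f S'"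
  shows "R \<in> carrier (tensor H H)" "R' \<in> carrier (tensor H H)" "alg_inverse (tensor_alg H H) R = R'"
    "amult (tensor_alg H H) R R' = tpure H H (aone H) (aone H)"
    "amult (tensor_alg H H) R' R = tpure H H (aone H) (aone H)"
    and "(\<And>x. x \<in> carrier H \<Longrightarrow> tflip H H (bcomult H x) =
        amult (tensor_alg H H) (amult (tensor_alg H H) R (bcomult H x)) R') \<Longrightarrow> is_triangular H R"
proof -
  interpret H: hopf H using H by unfold_locales
  let ?BB = "tensor B B" and ?HH = "tensor H H"
  note fl = bialg_hom_lmap[OF f bialgebra H.bialgebra]
  note fa = bialg_hom_alg_map[OF f bialgebra H.bialgebra]
  have fc: "f x \<in> carrier H" if "x \<in> carrier B" for x using fl that by (rule lmap_closed)
  note ffa = alg_map_tmap[OF fa fa]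
  note ffl = lmap_tmap[OF fl fl]
  show RR: "R \<in> carrier ?HH" "R' \<in> carrier ?HH" unfolding R_def R'_def by (simp_all add: tmap_closed[OF fl fl])
  show inv: "amult (tensor_alg H H) R R' = tpure H H (aone H) (aone H)"
    "amult (tensor_alg H H) R' R = tpure H H (aone H) (aone H)"
    using alg_map_mult[OF ffa, of S S', symmetric] alg_map_mult[OF ffa, of S' S, symmetric] alg_map_one[OF ffa]
    by (simp_all add: R_def R'_def S_S' S'_S)
  show R': "alg_inverse (tensor_alg H H) R = R'"
    by (rule alg_inverse_eq) (simp_all add: RR inv is_algebra_tensor)
  assume coc: "\<And>x. x \<in> carrier H \<Longrightarrow> tflip H H (bcomult H x) =
        amult (tensor_alg H H) (amult (tensor_alg H H) R (bcomult H x)) R'"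
  let ?\<Phi> = "\<lambda>t. tmap B ?BB H ?HH f (\<lambda>t. tmap B B H H f f t) t"
  note \<Phi>a = alg_map_tmap[OF fa ffa]
  note \<Phi>l = lmap_tmap[OF fl ffl]
  have \<Phi>_mult: "?\<Phi> (amult (tensor_alg B (tensor_alg B B)) s t) = amult (tensor_alg H (tensor_alg H H)) (?\<Phi> s) (?\<Phi> t)"
    if "s \<in> carrier (tensor B ?BB)" "t \<in> carrier (tensor B ?BB)" for s t
    using alg_map_mult[OF \<Phi>a] that by (simp add: tmap_same[OF same_vs_refl same_tensor_alg same_vs_refl same_tensor_alg])
  have \<Phi>_pure: "?\<Phi> (tpure B ?BB x (tpure B B y z)) = tpure H ?HH (f x) (tpure H H (f y) (f z))"
    if "x \<in> carrier B" "y \<in> carrier B" "z \<in> carrier B" for x y z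
    using that by (simp add: tmap_pure[OF fl ffl] tmap_pure[OF fl fl])
  have b: "adm {} B B (tensor B ?BB) (\<lambda>x y. tpure B ?BB x (tpure B B y (aone B)))"
    "adm {} B B (tensor B ?BB) (\<lambda>x y. tpure B ?BB x (tpure B B (aone B) y))"
    "adm {} B B (tensor B ?BB) (\<lambda>x y. tpure B ?BB (aone B) (tpure B B x y))"
    by (intro lin_intros; simp)+
  have h: "bil H H (tensor H ?HH) (\<lambda>x y. tpure H ?HH x (tpure H H y (aone H)))"
    "bil H H (tensor H ?HH) (\<lambda>x y. tpure H ?HH x (tpure H H (aone H) y))"
    "bil H H (tensor H ?HH) (\<lambda>x y. tpure H ?HH (aone H) (tpure H H x y))"
    by (intro lin_intros; simp)+
  have legs: "?\<Phi> (leg12 B S) = leg12 H R" "?\<Phi> (leg13 B S) = leg13 H R" "?\<Phi> (leg23 B S) = leg23 H R"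
    unfolding leg12_def leg13_def leg23_def R_def tlift_tmap[OF fl fl h(1) S_closed]
      tlift_tmap[OF fl fl h(2) S_closed] tlift_tmap[OF fl fl h(3) S_closed] lmap_lift_comm[OF \<Phi>l b(1) S_closed]
      lmap_lift_comm[OF \<Phi>l b(2) S_closed] lmap_lift_comm[OF \<Phi>l b(3) S_closed]
    by (intro lift_cong; simp add: \<Phi>_pure bialg_hom_one[OF f])+
  have legc: "leg12 B S \<in> carrier (tensor B ?BB)" "leg13 B S \<in> carrier (tensor B ?BB)" "leg23 B S \<in> carrier (tensor B ?BB)"
    unfolding leg12_def leg13_def leg23_def
    by (simp_all add: lift_closed[OF b(1)] lift_closed[OF b(2)] lift_closed[OF b(3)])
  have DB: "lmap B ?BB (\<lambda>x. bcomult B x)" and DH: "lmap H ?HH (\<lambda>x. bcomult H x)"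
    by (intro lin_intros; simp)+
  have q1: "tmap H H H ?HH (\<lambda>y. y) (bcomult H) R
       = amult (tensor_alg H (tensor_alg H H)) (leg13 H R) (leg12 H R)"
  proof -
    have "tmap H H H ?HH (\<lambda>y. y) (bcomult H) R = tmap B B H ?HH (\<lambda>x. f x) (\<lambda>y. bcomult H (f y)) S"
      unfolding R_def by (rule tmap_tmap[OF fl fl lmap_id[OF H.vspace] DH S_closed])
    also have "\<dots> = tmap B B H ?HH (\<lambda>x. f x) (\<lambda>y. tmap B B H H f f (bcomult B y)) S"
      by (rule tmap_cong) (simp_all add: bialg_hom_comult[OF f])
    also have "\<dots> = ?\<Phi> (tmap B B B ?BB (\<lambda>y. y) (bcomult B) S)"
      by (rule tmap_tmap[OF lmap_id[OF vspace] DB fl ffl S_closed, symmetric])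
    also have "tmap B B B ?BB (\<lambda>y. y) (bcomult B) S = amult (tensor_alg B (tensor_alg B B)) (leg13 B S) (leg12 B S)"
      using triangular by (simp add: is_triangular_def is_quasitriangular_def)
    finally show ?thesis by (simp add: \<Phi>_mult legc legs)
  qed
  \<comment> \<open>Naturality of the associator: applying \<open>\<Delta>\<close> to the first leg
    brackets the triple tensor to the left, and \<open>tassoc\<close> brings it to the form in which
    the leg maps are stated.\<close>
  have nat: "\<forall>t\<in>carrier (tensor ?BB B). tassoc H H H (tmap ?BB B ?HH H (\<lambda>t. tmap B B H H f f t) f t) = ?\<Phi> (tassoc B B B t)"
  proof (rule tspace_eqI)
    show "lmap (tensor ?BB B) (tensor H ?HH) (\<lambda>t. tassoc H H H (tmap ?BB B ?HH H (\<lambda>t. tmap B B H H f f t) f t))"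
      "lmap (tensor ?BB B) (tensor H ?HH) (\<lambda>t. ?\<Phi> (tassoc B B B t))"
      by (intro lin_intros ffl fl; simp)+
    fix s z assume s: "s \<in> carrier ?BB" and z: "z \<in> carrier B"
    have "\<forall>s\<in>carrier ?BB. tassoc H H H (tmap ?BB B ?HH H (\<lambda>t. tmap B B H H f f t) f (tpure ?BB B s z)) =
        ?\<Phi> (tassoc B B B (tpure ?BB B s z))"
    proof (rule tspace_eqI)
      show "lmap ?BB (tensor H ?HH) (\<lambda>s. tassoc H H H (tmap ?BB B ?HH H (\<lambda>t. tmap B B H H f f t) f (tpure ?BB B s z)))"
        "lmap ?BB (tensor H ?HH) (\<lambda>s. ?\<Phi> (tassoc B B B (tpure ?BB B s z)))"
        by (intro lin_intros ffl fl; simp add: z)+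
    qed (simp add: z fc tmap_pure[OF ffl fl] tmap_pure[OF fl fl] tassoc_pure_pure \<Phi>_pure)
    then show "tassoc H H H (tmap ?BB B ?HH H (\<lambda>t. tmap B B H H f f t) f (tpure ?BB B s z)) =
        ?\<Phi> (tassoc B B B (tpure ?BB B s z))" using s by blast
  qed
  have q2: "tassoc H H H (tmap H H ?HH H (bcomult H) (\<lambda>y. y) R)
       = amult (tensor_alg H (tensor_alg H H)) (leg13 H R) (leg23 H R)"
  proof -
    have "tmap H H ?HH H (bcomult H) (\<lambda>y. y) R = tmap B B ?HH H (\<lambda>x. bcomult H (f x)) (\<lambda>y. f y) S"
      unfolding R_def by (rule tmap_tmap[OF fl fl DH lmap_id[OF H.vspace] S_closed])
    also have "\<dots> = tmap B B ?HH H (\<lambda>x. tmap B B H H f f (bcomult B x)) (\<lambda>y. f y) S"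
      by (rule tmap_cong) (simp_all add: bialg_hom_comult[OF f])
    also have "\<dots> = tmap ?BB B ?HH H (\<lambda>t. tmap B B H H f f t) f (tmap B B ?BB B (bcomult B) (\<lambda>y. y) S)"
      by (rule tmap_tmap[OF DB lmap_id[OF vspace] ffl fl S_closed, symmetric])
    finally have "tassoc H H H (tmap H H ?HH H (bcomult H) (\<lambda>y. y) R) =
        ?\<Phi> (tassoc B B B (tmap B B ?BB B (bcomult B) (\<lambda>y. y) S))"
      using nat tmap_closed[OF DB lmap_id[OF vspace] S_closed] by simp
    also have "tassoc B B B (tmap B B ?BB B (bcomult B) (\<lambda>y. y) S) =
        amult (tensor_alg B (tensor_alg B B)) (leg13 B S) (leg23 B S)"
      using triangular by (simp add: is_triangular_def is_quasitriangular_def)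
    finally show ?thesis by (simp add: \<Phi>_mult legc legs)
  qed
  \<comment> \<open>Triangularity proper: the flip commutes with
    \<open>f \<otimes> f\<close>.\<close>
  have "S' = tflip B B S" using triangular by (simp add: is_triangular_def)
  then have "R' = tflip H H R" unfolding R'_def R_def by (simp add: tflip_tmap[OF fl fl])
  moreover have "alg_invertible (tensor_alg H H) R"
    unfolding alg_invertible_def using RR inv by auto
  ultimately show "is_triangular H R"
    unfolding is_triangular_def is_quasitriangular_def using H q1 q2 coc by (simp add: R')
qed

end

section \<open>Bimodules\<close>

text \<open>Bilinearity of the two actions is what maps out of tensor products ask for. Unlike the
  full bimodule axioms, it is also established for the results of \<open>bullet\<close> and
  \<open>circ\<close>.\<close>

definition bimod_space ::
  "('k::field, 'b, 'm) vspace_scheme \<Rightarrow> ('k, 'b, 'a, 'n) bimod_scheme \<Rightarrow> bool" where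
  "bimod_space B M \<longleftrightarrow> is_vspace B \<and> is_vspace M \<and> bil B M M (lact M) \<and> bil M B M (ract M)"

definition bimod_map ::
  "('k::field, 'b, 'm) vspace_scheme \<Rightarrow> ('k, 'b, 'a, 'n) bimod_scheme \<Rightarrow> ('k, 'b, 'c, 'l) bimod_scheme
   \<Rightarrow> ('a \<Rightarrow> 'c) \<Rightarrow> bool" where
  "bimod_map B M N f \<longleftrightarrow> bimod_space B M \<and> bimod_space B N \<and> lmap M N f \<and> (\<forall>b\<in>carrier B. \<forall>x\<in>carrier M.
     f (lact M b x) = lact N b (f x) \<and> f (ract M x b) = ract N (f x) b)"

lemma bimod_mapD:
  assumes "bimod_map B M N f"
  shows "bimod_space B M" "bimod_space B N" "lmap M N f"
    "b \<in> carrier B \<Longrightarrow> x \<in> carrier M \<Longrightarrow> f (lact M b x) = lact N b (f x)"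
    "b \<in> carrier B \<Longrightarrow> x \<in> carrier M \<Longrightarrow> f (ract M x b) = ract N (f x) b"
  using assms unfolding bimod_map_def by blast+

lemma bimodule_space: "is_bimodule B M \<Longrightarrow> is_algebra B \<Longrightarrow> bimod_space B M"
  unfolding bimod_space_def is_bimodule_def
  using bilinear_iff_bil[of B M M "lact M"] bilinear_iff_bil[of M B M "ract M"] by (blast intro: algebra_vspace)

lemma bimodule_lact_ract:
  "is_bimodule B M \<Longrightarrow> a \<in> carrier B \<Longrightarrow> b \<in> carrier B \<Longrightarrow> x \<in> carrier M \<Longrightarrow>
    ract M (lact M a x) b = lact M a (ract M x b)"
  unfolding is_bimodule_def by blast

lemma bimod_space_vspace: "bimod_space B M \<Longrightarrow> is_vspace M"
  by (simp add: bimod_space_def)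

lemma opure_balanced:
  assumes "x \<in> carrier M" "b \<in> carrier B" "y \<in> carrier N"
  shows "opure B M N (ract M x b) y = opure B M N x (lact N b y)"
proof -
  have "gen (ract M x b) y - gen x (lact N b y) \<in> balanced_relations B M N"
    using assms unfolding balanced_relations_def by blast
  then show ?thesis unfolding pure_def tcoset_eq_iff tnull_def by (intro fs.span_base) blast
qed

section \<open>Underlying vector spaces of the duoidal operations\<close>

lemma same_circ: "same_vs (circ B M N) (ospace B M N)"
  by (simp add: same_vs_def circ_def vspace.defs bimod.defs)

lemma same_bullet: "same_vs (bullet B M N) (tensor M N)"
  by (simp add: same_vs_def bullet_def vspace.defs bimod.defs)

lemma same_unit_I: "same_vs (unit_I B) B"
  by (simp add: same_vs_def unit_I_def vspace.defs bimod.defs)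

lemma same_unit_J: "same_vs (unit_J B) kspace"
  by (simp add: same_vs_def unit_J_def vspace.defs bimod.defs)

lemma same_bimod_rev: "same_vs (bimod_rev B M) M"
  by (simp add: same_vs_def bimod_rev_def vspace.defs bimod.defs)

lemma duoidal_carriers [simp]:
  "carrier (circ B M N) = carrier (ospace B M N)" "vscale (circ B M N) = vscale (ospace B M N)"
  "carrier (bullet B M N) = carrier (tensor M N)" "vscale (bullet B M N) = vscale (tensor M N)"
  "carrier (unit_I B) = carrier B" "carrier (unit_J B') = UNIV" "carrier (bimod_rev B M) = carrier M"
  "vscale (unit_J B') = (*)" "vscale (unit_I B) = vscale B"
  using same_circ[of B M N] same_bullet[of B M N] same_unit_I[of B] same_unit_J[of B'] same_bimod_rev[of B M]
  by (simp_all add: same_vs_def)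

lemmas duoidal_same [simp] =
  is_vspace_same[OF same_circ] is_vspace_same[OF same_bullet] is_vspace_same[OF same_unit_I]
  is_vspace_same[OF same_unit_J] is_vspace_same[OF same_bimod_rev]
  lmap_same[OF same_circ same_vs_refl] lmap_same[OF same_vs_refl same_circ]
  lmap_same[OF same_bullet same_vs_refl] lmap_same[OF same_vs_refl same_bullet]
  lmap_same[OF same_unit_I same_vs_refl] lmap_same[OF same_vs_refl same_unit_I]
  lmap_same[OF same_unit_J same_vs_refl] lmap_same[OF same_vs_refl same_unit_J]
  lmap_same[OF same_bimod_rev same_vs_refl] lmap_same[OF same_vs_refl same_bimod_rev]

lemma bil_same:
  "same_vs V V' \<Longrightarrow> same_vs W W' \<Longrightarrow> same_vs U U' \<Longrightarrow> bil V W U f \<longleftrightarrow> bil V' W' U' f"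
  using lmap_same[of V V' U U'] lmap_same[of W W' U U'] by (simp add: bil_def) (simp add: same_vs_def)

lemma lmap_tgt:
  "lmap U (tensor M N) f \<Longrightarrow> lmap U (bullet B M N) f" "lmap U (ospace B M N) f \<Longrightarrow> lmap U (circ B M N) f"
  "lmap U B f' \<Longrightarrow> lmap U (unit_I B) f'" "lmap U kspace g \<Longrightarrow> lmap U (unit_J B') g"
  by simp_all

context triangular
begin

lemma lact_bil: "bimod_space B M \<Longrightarrow> bil B M M (lact M)"
  and ract_bil: "bimod_space B M \<Longrightarrow> bil M B M (ract M)"
  by (simp_all add: bimod_space_def)

lemma lmap_actions [lin_intros]:
  "bimod_space B M \<Longrightarrow> lmap X B h \<Longrightarrow> x \<in> carrier M \<Longrightarrow> lmap X M (\<lambda>b. lact M (h b) x)"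
  "bimod_space B M \<Longrightarrow> lmap X M g \<Longrightarrow> b \<in> carrier B \<Longrightarrow> lmap X M (\<lambda>x. lact M b (g x))"
  "bimod_space B M \<Longrightarrow> lmap X B h \<Longrightarrow> x \<in> carrier M \<Longrightarrow> lmap X M (\<lambda>b. ract M x (h b))"
  "bimod_space B M \<Longrightarrow> lmap X M g \<Longrightarrow> b \<in> carrier B \<Longrightarrow> lmap X M (\<lambda>x. ract M (g x) b)"
  by (blast intro: bil_comp1[OF lact_bil] bil_comp2[OF lact_bil] bil_comp1[OF ract_bil] bil_comp2[OF ract_bil])+

lemma action_closed [simp]:
  "bimod_space B M \<Longrightarrow> b \<in> carrier B \<Longrightarrow> x \<in> carrier M \<Longrightarrow> lact M b x \<in> carrier M"
  "bimod_space B M \<Longrightarrow> b \<in> carrier B \<Longrightarrow> x \<in> carrier M \<Longrightarrow> ract M x b \<in> carrier M"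
  by (rule bil_closed[OF lact_bil] bil_closed[OF ract_bil]; assumption)+

lemma adm_olift:
  assumes "bimod_space B M" "bimod_space B N" "bil M N U F"
    and "\<And>x b y. x \<in> carrier M \<Longrightarrow> b \<in> carrier B \<Longrightarrow> y \<in> carrier N \<Longrightarrow> F (ract M x b) y = F x (lact N b y)"
  shows "adm (balanced_relations B M N) M N U F"
  using assms by (intro adm_balanced) (simp_all add: bimod_space_vspace)

section \<open>Componentwise actions and the product over the field\<close>

context
  fixes M N
  assumes M: "bimod_space B M" and N: "bimod_space B N"
begin

lemma vs [simp]: "is_vspace M" "is_vspace N"
  using M N by (simp_all add: bimod_space_def)

lemma lact2_eq: "lact2 B M N s t = tlift B B (tensor M N) (\<lambda>b b'.
    tlift M N (tensor M N) (\<lambda>x y. tpure M N (lact M b x) (lact N b' y)) t) s"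
  by (simp add: lact2_def tmap_def)

lemma ract2_eq: "ract2 B M N t s = tlift B B (tensor M N) (\<lambda>b b'.
    tlift M N (tensor M N) (\<lambda>x y. tpure M N (ract M x b) (ract N y b')) t) s"
  by (simp add: ract2_def tmap_def)

lemma bil_lact2: "bil (tensor B B) (tensor M N) (tensor M N) (\<lambda>s t. lact2 B M N s t)"
  unfolding lact2_eq by (intro lin_intros M N) (simp_all add: M N)

lemma bil_ract2: "bil (tensor M N) (tensor B B) (tensor M N) (\<lambda>t s. ract2 B M N t s)"
  unfolding ract2_eq by (intro lin_intros M N) (simp_all add: M N)

lemma lact2_pure:
  assumes "b \<in> carrier B" "b' \<in> carrier B" "x \<in> carrier M" "y \<in> carrier N"
  shows "lact2 B M N (tpure B B b b') (tpure M N x y) = tpure M N (lact M b x) (lact N b' y)"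
proof -
  have a1: "adm {} M N (tensor M N) (\<lambda>x y. tpure M N (lact M b x) (lact N b' y))"
    using assms by (intro lin_intros M N) (simp_all add: M N)
  have a2: "adm {} B B (tensor M N) (\<lambda>b b'. tlift M N (tensor M N) (\<lambda>x y. tpure M N (lact M b x) (lact N b' y)) (tpure M N x y))"
    using assms by (intro lin_intros M N) (simp_all add: M N)
  show ?thesis unfolding lact2_eq using assms by (simp add: lift_pure[OF a2] lift_pure[OF a1])
qed

lemma ract2_pure:
  assumes "b \<in> carrier B" "b' \<in> carrier B" "x \<in> carrier M" "y \<in> carrier N"
  shows "ract2 B M N (tpure M N x y) (tpure B B b b') = tpure M N (ract M x b) (ract N y b')"
proof -
  have a1: "adm {} M N (tensor M N) (\<lambda>x y. tpure M N (ract M x b) (ract N y b'))"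
    using assms by (intro lin_intros M N) (simp_all add: M N)
  have a2: "adm {} B B (tensor M N) (\<lambda>b b'. tlift M N (tensor M N) (\<lambda>x y. tpure M N (ract M x b) (ract N y b')) (tpure M N x y))"
    using assms by (intro lin_intros M N) (simp_all add: M N)
  show ?thesis unfolding ract2_eq using assms by (simp add: lift_pure[OF a2] lift_pure[OF a1])
qed

lemmas lmap_lact2 = bil_comp1[OF bil_lact2] bil_comp2[OF bil_lact2]
lemmas lmap_ract2 = bil_comp1[OF bil_ract2] bil_comp2[OF bil_ract2]
lemmas lact2_closed = bil_closed[OF bil_lact2]
lemmas ract2_closed = bil_closed[OF bil_ract2]

lemma bullet_actions:
  "b \<in> carrier B \<Longrightarrow> t \<in> carrier (tensor M N) \<Longrightarrow> lact (bullet B M N) b t = lact2 B M N (bcomult B b) t"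
  "b \<in> carrier B \<Longrightarrow> t \<in> carrier (tensor M N) \<Longrightarrow> ract (bullet B M N) t b = ract2 B M N t (bcomult B b)"
  by (simp_all add: bullet_def vspace.defs bimod.defs)

lemma bimod_space_bullet: "bimod_space B (bullet B M N)"
proof -
  have D: "lmap B (tensor B B) (\<lambda>b. bcomult B b)" by (intro lin_intros) simp_all
  have "bil B (tensor M N) (tensor M N) (\<lambda>b t. lact2 B M N (bcomult B b) t)"
    "bil (tensor M N) B (tensor M N) (\<lambda>t b. ract2 B M N t (bcomult B b))"
    by (intro bilI lmap_lact2 lmap_ract2 D lmap_id; simp)+
  then have "bil B (tensor M N) (tensor M N) (lact (bullet B M N))"
    "bil (tensor M N) B (tensor M N) (ract (bullet B M N))"
    by (simp_all add: bil_def bullet_actions cong: lmap_cong_iff)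
  then show ?thesis by (simp add: bimod_space_def bil_def)
qed

end

text \<open>The diagonal action of \<open>b\<close> is the componentwise action of
  \<open>\<Delta>(b)\<close>, in general not a pure tensor. Compatibility is therefore proved for
  every \<open>s\<close> in \<open>B \<otimes> B\<close>: there it is linear in \<open>s\<close> and
  can be checked on pure tensors.\<close>

lemma bimod_map_tmap:
  assumes f: "bimod_map B M M' f" and g: "bimod_map B N N' g"
  shows "bimod_map B (bullet B M N) (bullet B M' N') (\<lambda>t. tmap M N M' N' f g t)"
proof -
  note sp = bimod_mapD(1,2)[OF f] bimod_mapD(1,2)[OF g]
  note fl = bimod_mapD(3)[OF f] and gl = bimod_mapD(3)[OF g]
  note cl = lmap_closed[OF fl] lmap_closed[OF gl]
  note eqs = bimod_mapD(4,5)[OF f] bimod_mapD(4,5)[OF g]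
  let ?h = "\<lambda>t. tmap M N M' N' f g t"
  note hl = lmap_comp[OF lmap_tmap[OF fl gl]]
  have l: "\<forall>t\<in>carrier (tensor M N). ?h (lact2 B M N s t) = lact2 B M' N' s (?h t)"
    if s: "s \<in> carrier (tensor B B)" for s
  proof (rule tspace_eqI)
    show "lmap (tensor M N) (tensor M' N') (\<lambda>t. ?h (lact2 B M N s t))"
      "lmap (tensor M N) (tensor M' N') (\<lambda>t. lact2 B M' N' s (?h t))"
      by (intro hl lmap_lact2 sp s lmap_id; simp)+
    fix x y assume xy: "x \<in> carrier M" "y \<in> carrier N"
    have "\<forall>s\<in>carrier (tensor B B). ?h (lact2 B M N s (tpure M N x y)) = lact2 B M' N' s (?h (tpure M N x y))"
    proof (rule tspace_eqI)
      show "lmap (tensor B B) (tensor M' N') (\<lambda>s. ?h (lact2 B M N s (tpure M N x y)))"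
        "lmap (tensor B B) (tensor M' N') (\<lambda>s. lact2 B M' N' s (?h (tpure M N x y)))"
        by (intro hl lmap_lact2 sp lmap_id; simp add: xy tmap_closed[OF fl gl])+
    qed (use xy in \<open>simp add: lact2_pure sp tmap_pure[OF fl gl] cl eqs\<close>)
    then show "?h (lact2 B M N s (tpure M N x y)) = lact2 B M' N' s (?h (tpure M N x y))" using s by blast
  qed
  have r: "\<forall>t\<in>carrier (tensor M N). ?h (ract2 B M N t s) = ract2 B M' N' (?h t) s"
    if s: "s \<in> carrier (tensor B B)" for s
  proof (rule tspace_eqI)
    show "lmap (tensor M N) (tensor M' N') (\<lambda>t. ?h (ract2 B M N t s))"
      "lmap (tensor M N) (tensor M' N') (\<lambda>t. ract2 B M' N' (?h t) s)"
      by (intro hl lmap_ract2 sp s lmap_id; simp)+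
    fix x y assume xy: "x \<in> carrier M" "y \<in> carrier N"
    have "\<forall>s\<in>carrier (tensor B B). ?h (ract2 B M N (tpure M N x y) s) = ract2 B M' N' (?h (tpure M N x y)) s"
    proof (rule tspace_eqI)
      show "lmap (tensor B B) (tensor M' N') (\<lambda>s. ?h (ract2 B M N (tpure M N x y) s))"
        "lmap (tensor B B) (tensor M' N') (\<lambda>s. ract2 B M' N' (?h (tpure M N x y)) s)"
        by (intro hl lmap_ract2 sp lmap_id; simp add: xy tmap_closed[OF fl gl])+
    qed (use xy in \<open>simp add: ract2_pure sp tmap_pure[OF fl gl] cl eqs\<close>)
    then show "?h (ract2 B M N (tpure M N x y) s) = ract2 B M' N' (?h (tpure M N x y)) s" using s by blast
  qed
  show ?thesis
    unfolding bimod_map_def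
    using l r by (simp add: bimod_space_bullet sp lmap_tmap[OF fl gl] bullet_actions tmap_closed[OF fl gl])
qed

lemma bimod_space_unit_I: "bimod_space B (unit_I B)"
  and unit_I_actions: "lact (unit_I B) = amult B" "ract (unit_I B) = amult B"
  using amult_bil[OF algebra]
  by (simp_all add: bimod_space_def bil_same[OF same_vs_refl same_unit_I same_unit_I]
    bil_same[OF same_unit_I same_vs_refl same_unit_I])
   (simp_all add: unit_I_def vspace.defs bimod.defs)

lemma unit_J_actions:
  "b \<in> carrier B \<Longrightarrow> lact (unit_J B) b k = bcounit B b * k"
  "b \<in> carrier B \<Longrightarrow> ract (unit_J B) k b = k * bcounit B b"
  by (simp_all add: unit_J_def vspace.defs bimod.defs)

lemma bimod_space_unit_J: "bimod_space B (unit_J B)"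
proof -
  have "bil B kspace kspace (\<lambda>b k. bcounit B b * k)" "bil kspace B kspace (\<lambda>k b. k * bcounit B b)"
    by (intro bilI lin_intros lmap_counit; simp)+
  then have "bil B kspace kspace (lact (unit_J B))" "bil kspace B kspace (ract (unit_J B))"
    by (simp_all add: bil_def unit_J_actions cong: lmap_cong_iff)
  then show ?thesis by (simp add: bimod_space_def bil_def)
qed

section \<open>The product over \<open>B\<close>\<close>

context
  fixes M N
  assumes M: "is_bimodule B M" and N: "is_bimodule B N"
begin

lemmas spM = bimodule_space[OF M algebra] and spN = bimodule_space[OF N algebra]

lemma adm_circ:
  "b \<in> carrier B \<Longrightarrow> adm (balanced_relations B M N) M N (ospace B M N) (\<lambda>x y. opure B M N (lact M b x) y)"
  "b \<in> carrier B \<Longrightarrow> adm (balanced_relations B M N) M N (ospace B M N) (\<lambda>x y. opure B M N x (ract N y b))"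
  by (rule adm_olift[OF spM spN]; (intro lin_intros spM spN)?;
    simp add: spM spN opure_balanced bimod_space_vspace[OF spM] bimod_space_vspace[OF spN]
      bimodule_lact_ract[OF N] bimodule_lact_ract[OF M, symmetric])+

lemma circ_actions:
  "b \<in> carrier B \<Longrightarrow> t \<in> carrier (ospace B M N) \<Longrightarrow>
    lact (circ B M N) b t = olift B M N (ospace B M N) (\<lambda>x y. opure B M N (lact M b x) y) t"
  "b \<in> carrier B \<Longrightarrow> t \<in> carrier (ospace B M N) \<Longrightarrow>
    ract (circ B M N) t b = olift B M N (ospace B M N) (\<lambda>x y. opure B M N x (ract N y b)) t"
  by (simp_all add: circ_def vspace.defs bimod.defs)

lemma circ_actions_pure:
  assumes "b \<in> carrier B" "x \<in> carrier M" "y \<in> carrier N"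
  shows "lact (circ B M N) b (opure B M N x y) = opure B M N (lact M b x) y"
    "ract (circ B M N) (opure B M N x y) b = opure B M N x (ract N y b)"
  using assms by (simp_all add: circ_actions lift_pure[OF adm_circ(1)] lift_pure[OF adm_circ(2)])

lemma bimod_space_circ: "bimod_space B (circ B M N)"
proof -
  note vs = bimod_space_vspace[OF spM] bimod_space_vspace[OF spN]
  have "bil B (ospace B M N) (ospace B M N) (\<lambda>b t. olift B M N (ospace B M N) (\<lambda>x y. opure B M N (lact M b x) y) t)"
    "bil (ospace B M N) B (ospace B M N) (\<lambda>t b. olift B M N (ospace B M N) (\<lambda>x y. opure B M N x (ract N y b)) t)"
    by (intro bilI lmap_lift lmap_lift_fun lmap_pure1 lmap_pure2 lmap_actions adm_circ spM spN lmap_id; simp add: vs spM spN)+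
  then have "bil B (ospace B M N) (ospace B M N) (lact (circ B M N))"
    "bil (ospace B M N) B (ospace B M N) (ract (circ B M N))"
    by (simp_all add: bil_def circ_actions cong: lmap_cong_iff)
  then show ?thesis by (simp add: bimod_space_def bil_def)
qed

end

context
  fixes M N M' N' f g
  assumes f: "bimod_map B M M' f" and g: "bimod_map B N N' g"
begin

lemma adm_omap: "adm (balanced_relations B M N) M N (ospace B M' N') (\<lambda>x y. opure B M' N' (f x) (g y))"
proof -
  note sp = bimod_mapD(1,2)[OF f] bimod_mapD(1,2)[OF g]
  note fl = bimod_mapD(3)[OF f] and gl = bimod_mapD(3)[OF g]
  show ?thesis
    by (rule adm_olift; (intro bilI lmap_pure1 lmap_pure2 fl gl)?;
      simp add: sp lmap_closed[OF fl] lmap_closed[OF gl] bimod_mapD(4,5)[OF f] bimod_mapD(4,5)[OF g]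
        opure_balanced bimod_space_vspace[OF sp(2)] bimod_space_vspace[OF sp(4)])
qed

lemma lmap_omap: "lmap (ospace B M N) (ospace B M' N') (\<lambda>t. omap B M N M' N' f g t)"
  unfolding omap_def by (rule lmap_lift[OF adm_omap])

lemma omap_pure: "x \<in> carrier M \<Longrightarrow> y \<in> carrier N \<Longrightarrow> omap B M N M' N' f g (opure B M N x y) = opure B M' N' (f x) (g y)"
  unfolding omap_def by (rule lift_pure[OF adm_omap])

end

lemma bimod_map_of_hom: "f \<in> bimod_hom B M N \<Longrightarrow> bimod_space B M \<Longrightarrow> bimod_space B N \<Longrightarrow> bimod_map B M N f"
  unfolding bimod_hom_def bimod_map_def using lmap_of_lin[of f M N] bimod_space_vspace[of B] by auto

section \<open>The interchange law and the multiplication of \<open>J\<close>\<close>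

context
  fixes A E C D
  assumes A: "is_bimodule B A" and E: "is_bimodule B E" and C: "is_bimodule B C" and D: "is_bimodule B D"
begin

lemmas sps = bimodule_space[OF A algebra] bimodule_space[OF E algebra] bimodule_space[OF C algebra] bimodule_space[OF D algebra]
lemmas spv = sps[THEN bimod_space_vspace]

text \<open>The interchange law on representatives, before passing to the quotient over
  \<open>B\<close>; \<open>zeta\<close> is its lift once it is known to be balanced.\<close>

abbreviation zeta2 where "zeta2 s t \<equiv> (let T = tensor (circ B A C) (circ B E D) in tlift A E T
           (\<lambda>a e. tlift C D T
              (\<lambda>c d. tpure (circ B A C) (circ B E D) (opure B A C a c) (opure B E D e d)) t) s)"

lemma bil_zeta2: "bil (tensor A E) (tensor C D) (tensor (circ B A C) (circ B E D)) (\<lambda>s t. zeta2 s t)"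
  unfolding Let_def by (intro lin_intros lmap_tgt) (simp_all add: spv)

lemma zeta2_pure:
  assumes "a \<in> carrier A" "e \<in> carrier E" "c \<in> carrier C" "d \<in> carrier D"
  shows "zeta2 (tpure A E a e) (tpure C D c d) = tpure (circ B A C) (circ B E D) (opure B A C a c) (opure B E D e d)"
proof -
  let ?T = "tensor (circ B A C) (circ B E D)"
  have a1: "adm {} C D ?T (\<lambda>c d. tpure (circ B A C) (circ B E D) (opure B A C a c) (opure B E D e d))"
    using assms by (intro lin_intros lmap_tgt) (simp_all add: spv)
  have a2: "adm {} A E ?T (\<lambda>a e. tlift C D ?T (\<lambda>c d. tpure (circ B A C) (circ B E D) (opure B A C a c) (opure B E D e d)) (tpure C D c d))"
    using assms by (intro lin_intros lmap_tgt) (simp_all add: spv)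
  show ?thesis using assms by (simp add: lift_pure[OF a2] lift_pure[OF a1])
qed

lemmas lmap_zeta2 = bil_comp1[OF bil_zeta2] bil_comp2[OF bil_zeta2]

text \<open>Balancing over the diagonal action is the case \<open>r = \<Delta>(b)\<close>. For pure
  \<open>r = b \<otimes> b'\<close> the identity is the balancing relation of
  \<open>A \<circ> C\<close> for \<open>b\<close> and that of \<open>E \<circ> D\<close> for
  \<open>b'\<close>; linearity in \<open>r\<close> gives the rest.\<close>

lemma zeta2_balanced:
  assumes s: "s \<in> carrier (tensor A E)" and r: "r \<in> carrier (tensor B B)" and t: "t \<in> carrier (tensor C D)"
  shows "zeta2 (ract2 B A E s r) t = zeta2 s (lact2 B C D r t)"
proof -
  let ?T = "tensor (circ B A C) (circ B E D)"
  note l = lmap_zeta2 lmap_lact2[OF sps(3,4)] lmap_ract2[OF sps(1,2)] lmap_id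
  note c = lact2_closed[OF sps(3,4)] ract2_closed[OF sps(1,2)] pure_closed
  have "\<forall>s\<in>carrier (tensor A E). zeta2 (ract2 B A E s r) t = zeta2 s (lact2 B C D r t)"
  proof (rule tspace_eqI[where U = ?T])
    show "lmap (tensor A E) ?T (\<lambda>s. zeta2 (ract2 B A E s r) t)" "lmap (tensor A E) ?T (\<lambda>s. zeta2 s (lact2 B C D r t))"
      by (intro l c r t; simp)+
    fix a e assume ae: "a \<in> carrier A" "e \<in> carrier E"
    have "\<forall>r\<in>carrier (tensor B B). zeta2 (ract2 B A E (tpure A E a e) r) t = zeta2 (tpure A E a e) (lact2 B C D r t)"
    proof (rule tspace_eqI[where U = ?T])
      show "lmap (tensor B B) ?T (\<lambda>r. zeta2 (ract2 B A E (tpure A E a e) r) t)"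
        "lmap (tensor B B) ?T (\<lambda>r. zeta2 (tpure A E a e) (lact2 B C D r t))"
        by (intro l c ae t; simp)+
      fix b b' assume b: "b \<in> carrier B" "b' \<in> carrier B"
      have "\<forall>t\<in>carrier (tensor C D). zeta2 (ract2 B A E (tpure A E a e) (tpure B B b b')) t =
          zeta2 (tpure A E a e) (lact2 B C D (tpure B B b b') t)"
      proof (rule tspace_eqI[where U = ?T])
        show "lmap (tensor C D) ?T (\<lambda>t. zeta2 (ract2 B A E (tpure A E a e) (tpure B B b b')) t)"
          "lmap (tensor C D) ?T (\<lambda>t. zeta2 (tpure A E a e) (lact2 B C D (tpure B B b b') t))"
          by (intro l c ae b; simp)+
        fix x y assume "x \<in> carrier C" "y \<in> carrier D"
        then show "zeta2 (ract2 B A E (tpure A E a e) (tpure B B b b')) (tpure C D x y) =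
          zeta2 (tpure A E a e) (lact2 B C D (tpure B B b b') (tpure C D x y))"
          using ae b sps by (simp only: ract2_pure lact2_pure action_closed zeta2_pure opure_balanced)
      qed
      then show "zeta2 (ract2 B A E (tpure A E a e) (tpure B B b b')) t =
          zeta2 (tpure A E a e) (lact2 B C D (tpure B B b b') t)" using t by blast
    qed
    then show "zeta2 (ract2 B A E (tpure A E a e) r) t = zeta2 (tpure A E a e) (lact2 B C D r t)" using r by blast
  qed
  then show ?thesis using s by blast
qed

lemma adm_zeta: "adm (balanced_relations B (bullet B A E) (bullet B C D)) (bullet B A E) (bullet B C D)
    (tensor (circ B A C) (circ B E D)) (\<lambda>s t. zeta2 s t)"
proof (rule adm_olift[OF bimod_space_bullet bimod_space_bullet])
  show "bil (bullet B A E) (bullet B C D) (tensor (circ B A C) (circ B E D)) (\<lambda>s t. zeta2 s t)"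
    using bil_zeta2 by (subst bil_same[OF same_bullet same_bullet same_vs_refl])
qed (use zeta2_balanced sps in \<open>simp_all add: bullet_actions\<close>)

lemma zeta_pure:
  assumes "s \<in> carrier (tensor A E)" "t \<in> carrier (tensor C D)"
  shows "zeta B A E C D (opure B (bullet B A E) (bullet B C D) s t) = zeta2 s t"
  using lift_pure[OF adm_zeta] assms by (simp add: zeta_def Let_def)

lemma lmap_zeta: "lmap (ospace B (bullet B A E) (bullet B C D)) (tensor (circ B A C) (circ B E D)) (\<lambda>t. zeta B A E C D t)"
  using lmap_lift[OF adm_zeta] by (simp add: zeta_def Let_def)

lemma lmap_tlift_zeta2:
  assumes \<Phi>: "lmap (tensor (circ B A C) (circ B E D)) U \<Phi>" and s: "s \<in> carrier (tensor A E)" and t: "t \<in> carrier (tensor C D)"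
  shows "\<Phi> (zeta2 s t) = tlift A E U (\<lambda>a e. tlift C D U
    (\<lambda>c d. \<Phi> (tpure (circ B A C) (circ B E D) (opure B A C a c) (opure B E D e d))) t) s"
proof -
  let ?T = "tensor (circ B A C) (circ B E D)"
  have a1: "adm {} C D ?T (\<lambda>c d. tpure (circ B A C) (circ B E D) (opure B A C a c) (opure B E D e d))"
    if "a \<in> carrier A" "e \<in> carrier E" for a e
    using that by (intro lin_intros lmap_tgt) (simp_all add: spv)
  have a2: "adm {} A E ?T (\<lambda>a e. tlift C D ?T (\<lambda>c d. tpure (circ B A C) (circ B E D) (opure B A C a c) (opure B E D e d)) t)"
    using t by (intro lin_intros lmap_tgt) (simp_all add: spv)
  show ?thesis
    unfolding Let_def lmap_lift_comm[OF \<Phi> a2 s]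
    by (rule lift_cong) (rule lmap_lift_comm[OF \<Phi> a1 t])
qed

end

lemma mult_J_pure: "mult_J B (opure B (unit_J B) (unit_J B) k k') = k * k'"
  and lmap_mult_J: "lmap (ospace B (unit_J B) (unit_J B)) kspace (\<lambda>t. mult_J B t)"
proof -
  have "bil kspace kspace kspace (\<lambda>k k'. k * k')" by (intro lin_intros) simp_all
  then have a: "adm (balanced_relations B (unit_J B) (unit_J B)) (unit_J B) (unit_J B) kspace (\<lambda>k k'. k * k')"
    by (intro adm_olift bimod_space_unit_J)
      (simp_all add: bil_same[OF same_unit_J same_unit_J same_vs_refl] unit_J_actions)
  show "mult_J B (opure B (unit_J B) (unit_J B) k k') = k * k'"
    unfolding mult_J_def by (rule lift_pure[OF a]) simp_all
  show "lmap (ospace B (unit_J B) (unit_J B)) kspace (\<lambda>t. mult_J B t)"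
    unfolding mult_J_def by (rule lmap_lift[OF a])
qed

end

section \<open>Bimodules over a bialgebra induced by an algebra map\<close>

text \<open>\<open>conv_phi\<close> and \<open>conv_psi\<close> are the left-hand sides of the two
  antipode axioms in \<open>is_hopf_monoid\<close>, with the comultiplied element replaced by an
  arbitrary tensor \<open>t\<close>. The right-hand sides are multiples of \<open>phi_in\<close> and
  \<open>psi_in\<close> at the unit.\<close>

abbreviation conv_phi where "conv_phi B X \<Sigma> t \<equiv>
  omap B (bullet B (circ B X X) (unit_I B)) (unit_J B) (bullet B X (unit_I B)) (unit_J B)
    (tmap (circ B X X) (unit_I B) X (unit_I B) (hmult X) (\<lambda>b. b)) (\<lambda>k. k)
    (rev_phi B X X (tmap X X X (bimod_rev B X) (\<lambda>x. x) \<Sigma> t))"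

abbreviation conv_psi where "conv_psi B X \<Sigma> t \<equiv>
  omap B (unit_J B) (bullet B (unit_I B) (circ B X X)) (unit_J B) (bullet B (unit_I B) X)
    (\<lambda>k. k) (tmap (unit_I B) (circ B X X) (unit_I B) X (\<lambda>b. b) (hmult X))
    (rev_psi B X X (tmap X X (bimod_rev B X) X \<Sigma> (\<lambda>x. x) t))"

abbreviation phi_in where
  "phi_in B X z \<equiv> opure B (bullet B X (unit_I B)) (unit_J B) (tpure X (unit_I B) z (aone B)) 1"

abbreviation psi_in where
  "psi_in B X z \<equiv> opure B (unit_J B) (bullet B (unit_I B) X) 1 (tpure (unit_I B) X (aone B) z)"

text \<open>
  The common setting of both directions of the correspondence. The algebra \<open>H\<close> and the comonoid \<open>X\<close> are
  separate records on the same vector space.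
\<close>

locale induced_bimodule = triangular B S
  for B :: "('k::field, 'b, 'm) bialg_scheme" and S +
  fixes H :: "('k, 'a, 'n) alg_scheme" and X :: "('k, 'b, 'a, 'l) bimon_scheme" and f :: "'b \<Rightarrow> 'a"
  assumes same: "same_vs X H" and bim: "is_bimodule B X" and fa: "alg_map B H f"
    and lact_X: "\<And>b x. b \<in> carrier B \<Longrightarrow> x \<in> carrier H \<Longrightarrow> lact X b x = amult H (f b) x"
    and ract_X: "\<And>b x. b \<in> carrier B \<Longrightarrow> x \<in> carrier H \<Longrightarrow> ract X x b = amult H x (f b)"
begin

abbreviation HH where "HH \<equiv> tensor H H"
abbreviation T where "T \<equiv> tensor_alg H H"
abbreviation R where "R \<equiv> tmap B B H H f f S"
abbreviation R' where "R' \<equiv> tmap B B H H f f S'"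

lemma carrier_X [simp]: "carrier X = carrier H" and vscale_X [simp]: "vscale X = vscale H"
  using same by (simp_all add: same_vs_def)

lemma H_algebra [simp]: "is_algebra H"
  using fa by (rule alg_map_algebra)

lemma H_vspace [simp]: "is_vspace H"
  by simp

lemma same_to_H:
  "tensor X X = HH" "tpure X X = tpure H H" "tlift X X U F = tlift H H U F" "tflip X X = tflip H H"
  "tmap X X U2 W2 F2 G2 = tmap H H U2 W2 F2 G2" "tmap U' W' X X F' G' = tmap U' W' H H F' G'"
  "lift E V W X F3 = lift E V W H F3"
  by (rule tspace_same[OF same same] lift_same[OF same same same_vs_refl] tflip_same[OF same same]
      tmap_same[OF same same same_vs_refl same_vs_refl] tmap_same[OF same_vs_refl same_vs_refl same same]
      lift_same[OF same_vs_refl same_vs_refl same])+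

lemma lmap_X [simp]: "lmap X U F \<longleftrightarrow> lmap H U F" "lmap U X G \<longleftrightarrow> lmap U H G"
  by (rule lmap_same[OF same same_vs_refl] lmap_same[OF same_vs_refl same])+

lemma X_vspace [simp]: "is_vspace X"
  using is_vspace_same[OF same] by simp

lemmas f_lmap = alg_map_lmap[OF fa]
lemmas lmap_f [lin_intros] = lmap_comp[OF f_lmap]

lemma f_closed [simp, lin_intros]: "b \<in> carrier B \<Longrightarrow> f b \<in> carrier H"
  by (rule lmap_closed[OF f_lmap])

lemma R_closed [simp]: "R \<in> carrier HH" "R' \<in> carrier HH"
  by (simp_all add: tmap_closed[OF f_lmap f_lmap])

lemma R_inv: "amult T R R' = tpure H H (aone H) (aone H)" "amult T R' R = tpure H H (aone H) (aone H)"
  using alg_map_mult[OF alg_map_tmap[OF fa fa], of S S', symmetric] alg_map_mult[OF alg_map_tmap[OF fa fa], of S' S, symmetric]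
    alg_map_one[OF alg_map_tmap[OF fa fa]] by (simp_all add: S_S' S'_S)

lemmas spX = bimodule_space[OF bim algebra]

lemmas lmap_lact2_X = lmap_lact2[OF spX spX, unfolded same_to_H]
lemmas lmap_ract2_X = lmap_ract2[OF spX spX, unfolded same_to_H]
lemmas ff_lmap = lmap_tmap[OF f_lmap f_lmap]

text \<open>The passage from bimodules to algebras: actions induced by \<open>f\<close> are
  multiplications. Together with \<open>ract2_X\<close> it turns the braiding into conjugation of
  the flipped tensor by \<open>R\<close>.\<close>

lemma lact2_X:
  assumes s: "s \<in> carrier (tensor B B)" and t: "t \<in> carrier HH"
  shows "lact2 B X X s t = amult T (tmap B B H H f f s) t"
proof -
  have "\<forall>s\<in>carrier (tensor B B). lact2 B X X s t = amult T (tmap B B H H f f s) t"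
  proof (rule tspace_eqI[where U = HH])
    show "lmap (tensor B B) HH (\<lambda>s. lact2 B X X s t)" "lmap (tensor B B) HH (\<lambda>s. amult T (tmap B B H H f f s) t)"
      by (intro lmap_lact2_X lmap_amult_tensor ff_lmap t lmap_id; simp)+
    fix b b' assume b: "b \<in> carrier B" "b' \<in> carrier B"
    have "\<forall>t\<in>carrier HH. lact2 B X X (tpure B B b b') t = amult T (tmap B B H H f f (tpure B B b b')) t"
    proof (rule tspace_eqI[where U = HH])
      show "lmap HH HH (\<lambda>t. lact2 B X X (tpure B B b b') t)"
        "lmap HH HH (\<lambda>t. amult T (tmap B B H H f f (tpure B B b b')) t)"
        by (intro lmap_lact2_X lmap_amult_tensor lmap_id; simp add: b tmap_closed[OF f_lmap f_lmap])+
    qed (use b lact2_pure[OF spX spX, unfolded same_to_H] in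
        \<open>simp add: tmap_pure[OF f_lmap f_lmap] amult_tensor_pure lact_X\<close>)
    then show "lact2 B X X (tpure B B b b') t = amult T (tmap B B H H f f (tpure B B b b')) t" using t by blast
  qed
  then show ?thesis using s by blast
qed

lemma ract2_X:
  assumes s: "s \<in> carrier (tensor B B)" and t: "t \<in> carrier HH"
  shows "ract2 B X X t s = amult T t (tmap B B H H f f s)"
proof -
  have "\<forall>s\<in>carrier (tensor B B). ract2 B X X t s = amult T t (tmap B B H H f f s)"
  proof (rule tspace_eqI[where U = HH])
    show "lmap (tensor B B) HH (\<lambda>s. ract2 B X X t s)" "lmap (tensor B B) HH (\<lambda>s. amult T t (tmap B B H H f f s))"
      by (intro lmap_ract2_X lmap_amult_tensor ff_lmap t lmap_id; simp)+
    fix b b' assume b: "b \<in> carrier B" "b' \<in> carrier B"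
    have "\<forall>t\<in>carrier HH. ract2 B X X t (tpure B B b b') = amult T t (tmap B B H H f f (tpure B B b b'))"
    proof (rule tspace_eqI[where U = HH])
      show "lmap HH HH (\<lambda>t. ract2 B X X t (tpure B B b b'))"
        "lmap HH HH (\<lambda>t. amult T t (tmap B B H H f f (tpure B B b b')))"
        by (intro lmap_ract2_X lmap_amult_tensor lmap_id; simp add: b tmap_closed[OF f_lmap f_lmap])+
    qed (use b ract2_pure[OF spX spX, unfolded same_to_H] in
        \<open>simp add: tmap_pure[OF f_lmap f_lmap] amult_tensor_pure ract_X\<close>)
    then show "ract2 B X X t (tpure B B b b') = amult T t (tmap B B H H f f (tpure B B b b'))" using t by blast
  qed
  then show ?thesis using s by blast
qed

lemma braiding_X: "t \<in> carrier HH \<Longrightarrow> braiding B S X X t = amult T R' (amult T (tflip H H t) R)"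
  by (simp add: braiding_def same_to_H ract2_X lact2_X tflip_closed)

text \<open>For \<open>t = \<Delta>(x)\<close> this equates cocommutativity in the braided category
  with \<open>\<Delta>\<^sup>o\<^sup>p = R \<Delta> R\<^sup>-\<^sup>1\<close>; one multiplies by
  \<open>R\<close> on the left and by \<open>R'\<close> on the right.\<close>

lemma braiding_fixed_iff:
  assumes t: "t \<in> carrier HH"
  shows "braiding B S X X t = t \<longleftrightarrow> tflip H H t = amult T (amult T R t) R'"
proof -
  have fc: "tflip H H t \<in> carrier HH" using t by (simp add: tflip_closed)
  have TA: "is_algebra T" by (simp add: is_algebra_tensor)
  have 1: "amult T (amult T x y) z = amult T x (amult T y z)"
    if "x \<in> carrier HH" "y \<in> carrier HH" "z \<in> carrier HH" for x y z
    using amult_assoc[OF TA] that by simp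
  have one: "amult T (tpure H H (aone H) (aone H)) x = x" "amult T x (tpure H H (aone H) (aone H)) = x"
    if "x \<in> carrier HH" for x
    using aone_mult[OF TA] that by simp_all
  have 2: "amult T R (amult T R' x) = x" "amult T R' (amult T R x) = x"
    if "x \<in> carrier HH" for x
    using that 1[of R R' x] 1[of R' R x] by (simp_all add: R_inv one)
  show ?thesis
  proof
    assume "braiding B S X X t = t"
    then have "amult T R t = amult T R (amult T R' (amult T (tflip H H t) R))" using t by (simp add: braiding_X)
    then have "amult T R t = amult T (tflip H H t) R" by (simp add: 2 fc)
    then show "tflip H H t = amult T (amult T R t) R'" by (simp add: 1 fc R_inv one)
  next
    assume "tflip H H t = amult T (amult T R t) R'"
    then show "braiding B S X X t = t" using t by (simp add: braiding_X 1 2 R_inv one)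
  qed
qed

text \<open>Balancing holds because \<open>(x f(b)) y = x (f(b) y)\<close>.\<close>

lemma adm_amult: "adm (balanced_relations B X X) X X H (\<lambda>x y. amult H x y)"
  by (rule adm_olift[OF spX spX]; (intro lin_intros)?; simp add: lact_X ract_X amult_assoc lmap_id)

lemma bimod_map_bullet:
  assumes D: "lmap H HH D" and f: "\<And>b. b \<in> carrier B \<Longrightarrow> D (f b) = tmap B B H H f f (bcomult B b)"
    and mult: "\<And>x y. x \<in> carrier H \<Longrightarrow> y \<in> carrier H \<Longrightarrow> D (amult H x y) = amult T (D x) (D y)"
  shows "bimod_map B X (bullet B X X) D"
  unfolding bimod_map_def
  using D by (simp add: spX bimod_space_bullet same_to_H bullet_actions lmap_closed[OF D] lact_X ract_X lact2_X ract2_X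
      mult f)

lemma bimod_map_J:
  assumes D: "lmap H kspace D" and f: "\<And>b. b \<in> carrier B \<Longrightarrow> D (f b) = bcounit B b"
    and mult: "\<And>x y. x \<in> carrier H \<Longrightarrow> y \<in> carrier H \<Longrightarrow> D (amult H x y) = D x * D y"
  shows "bimod_map B X (unit_J B) D"
  unfolding bimod_map_def
  using D by (simp add: spX bimod_space_unit_J lact_X ract_X unit_J_actions mult f)

end

text \<open>Multiplicativity of \<open>comult\<close> and \<open>counit\<close> is left out on
  purpose: for a bialgebra it is an axiom, for an internal group it has to be extracted from
  \<open>hmult\<close> being a morphism of comonoids. The locale holds what both directions can
  supply at the start.\<close>

locale induced_bimonoid = induced_bimodule B S H X f
  for B :: "('k::field, 'b, 'm) bialg_scheme" and S and H :: "('k, 'a, 'n) alg_scheme"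
    and X :: "('k, 'b, 'a, 'l) bimon_scheme" and f :: "'b \<Rightarrow> 'a" +
  assumes hmult_lmap: "lmap (ospace B X X) X (hmult X)"
    and hmult_pure: "\<And>x y. x \<in> carrier H \<Longrightarrow> y \<in> carrier H \<Longrightarrow> hmult X (opure B X X x y) = amult H x y"
    and comult_map: "bimod_map B X (bullet B X X) (comult X)"
    and counit_map: "bimod_map B X (unit_J B) (counit X)"
    and coalg: "is_coalgebra X (comult X) (counit X)"
begin

abbreviation \<Delta> where "\<Delta> \<equiv> comult X"
abbreviation \<epsilon> where "\<epsilon> \<equiv> counit X"

lemma coalg_H: "is_coalgebra H \<Delta> \<epsilon>"
  using coalg is_coalgebra_same[OF same] by blast

lemmas \<Delta>_lmap = coalgebra_lmap(1)[OF coalg_H] and \<epsilon>_lmap = coalgebra_lmap(2)[OF coalg_H]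
lemmas lmap_\<Delta> [lin_intros] = lmap_comp[OF \<Delta>_lmap]
lemmas lmap_\<epsilon> [lin_intros] = lmap_comp[OF \<epsilon>_lmap]

lemma \<Delta>_closed [simp, lin_intros]: "x \<in> carrier H \<Longrightarrow> \<Delta> x \<in> carrier HH"
  by (rule lmap_closed[OF \<Delta>_lmap])

lemma hmult_bimod_map: "bimod_map B (circ B X X) X (hmult X)"
proof -
  note sp = bimod_space_circ[OF bim bim]
  have m: "lmap (ospace B X X) H (hmult X)" using hmult_lmap by simp
  have l: "\<forall>t\<in>carrier (ospace B X X). hmult X (lact (circ B X X) b t) = amult H (f b) (hmult X t)"
    and r: "\<forall>t\<in>carrier (ospace B X X). hmult X (ract (circ B X X) t b) = amult H (hmult X t) (f b)"
    if b: "b \<in> carrier B" for b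
  proof -
    have "lmap (circ B X X) (circ B X X) (\<lambda>t. lact (circ B X X) b t)"
      "lmap (circ B X X) (circ B X X) (\<lambda>t. ract (circ B X X) t b)"
      using b by (intro lmap_actions sp lmap_id; simp)+
    then have "lmap (ospace B X X) (ospace B X X) (\<lambda>t. lact (circ B X X) b t)"
      "lmap (ospace B X X) (ospace B X X) (\<lambda>t. ract (circ B X X) t b)"
      by simp_all
    note lm = lmap_comp[OF m this(1)] lmap_comp[OF m this(2)]
    show "\<forall>t\<in>carrier (ospace B X X). hmult X (lact (circ B X X) b t) = amult H (f b) (hmult X t)"
      by (rule tspace_eqI[OF lm(1)]; (intro lmap_amult2 m)?;
          simp add: b circ_actions_pure[OF bim bim] hmult_pure lact_X amult_assoc)
    show "\<forall>t\<in>carrier (ospace B X X). hmult X (ract (circ B X X) t b) = amult H (hmult X t) (f b)"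
      by (rule tspace_eqI[OF lm(2)]; (intro lmap_amult1 m)?;
          simp add: b circ_actions_pure[OF bim bim] hmult_pure ract_X amult_assoc)
  qed
  show ?thesis unfolding bimod_map_def using sp spX m l r lmap_closed[OF m] by (simp add: lact_X ract_X)
qed

lemma hmult_circ_lmap: "lmap (circ B X X) X (hmult X)"
  using hmult_lmap by simp

abbreviation mm where "mm \<equiv> (\<lambda>t. tmap (circ B X X) (circ B X X) X X (hmult X) (hmult X) t)"
abbreviation Z where "Z \<equiv> zeta B X X X X"

lemma mm_lmap: "lmap (tensor (circ B X X) (circ B X X)) HH mm"
  using lmap_tmap[OF hmult_circ_lmap hmult_circ_lmap] by (simp only: same_to_H)

text \<open>The reason why the duoidal compatibility between multiplication and comultiplication is
  the bialgebra axiom: \<zeta> regroups \<open>(a \<otimes> e) (c \<otimes> d)\<close> exactly as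
  the product of \<open>H \<otimes> H\<close> does.\<close>

lemma mm_zeta:
  assumes s: "s \<in> carrier HH" and t: "t \<in> carrier HH"
  shows "mm (Z (opure B (bullet B X X) (bullet B X X) s t)) = amult T s t"
proof -
  have st: "s \<in> carrier (tensor X X)" "t \<in> carrier (tensor X X)" using s t by (simp_all add: same_to_H)
  have "mm (Z (opure B (bullet B X X) (bullet B X X) s t)) = tlift X X HH (\<lambda>a e. tlift X X HH
    (\<lambda>c d. mm (tpure (circ B X X) (circ B X X) (opure B X X a c) (opure B X X e d))) t) s"
    unfolding zeta_pure[OF bim bim bim bim st] by (rule lmap_tlift_zeta2[OF bim bim bim bim mm_lmap st])
  also have "\<dots> = tlift H H HH (\<lambda>a e. tlift H H HH (\<lambda>c d. tpure H H (amult H a c) (amult H e d)) t) s"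
    unfolding same_to_H by (intro lift_cong)
      (simp add: tmap_pure[OF hmult_circ_lmap hmult_circ_lmap, unfolded same_to_H] hmult_pure)
  finally show ?thesis by (simp add: amult_tensor s t)
qed

abbreviation OD where "OD \<equiv> omap B X X (bullet B X X) (bullet B X X) \<Delta> \<Delta>"

lemma comult_circ:
  "t \<in> carrier (ospace B X X) \<Longrightarrow> comult (comon_circ B X X) t = Z (OD t)"
  "t \<in> carrier (ospace B X X) \<Longrightarrow> counit (comon_circ B X X) t = mult_J B (omap B X X (unit_J B) (unit_J B) \<epsilon> \<epsilon> t)"
  by (simp_all add: comon_circ_def bimod.defs comon.defs compose_eq)

lemma lmap_comult_circ: "lmap (ospace B X X) (tensor (circ B X X) (circ B X X)) (\<lambda>t. Z (OD t))"
  by (rule lmap_comp[OF lmap_zeta[OF bim bim bim bim] lmap_omap[OF comult_map comult_map]])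

lemma mm_comult_circ_pure:
  "x \<in> carrier H \<Longrightarrow> y \<in> carrier H \<Longrightarrow> mm (Z (OD (opure B X X x y))) = amult T (\<Delta> x) (\<Delta> y)"
  by (simp add: omap_pure[OF comult_map comult_map] mm_zeta)

lemma counit_circ_pure:
  "x \<in> carrier H \<Longrightarrow> y \<in> carrier H \<Longrightarrow>
    mult_J B (omap B X X (unit_J B) (unit_J B) \<epsilon> \<epsilon> (opure B X X x y)) = \<epsilon> x * \<epsilon> y"
  by (simp add: omap_pure[OF counit_map counit_map] mult_J_pure)

lemma hmult_comult:
  assumes "\<And>x y. x \<in> carrier H \<Longrightarrow> y \<in> carrier H \<Longrightarrow> \<Delta> (amult H x y) = amult T (\<Delta> x) (\<Delta> y)"
  shows "\<forall>t\<in>carrier (ospace B X X). \<Delta> (hmult X t) = mm (Z (OD t))"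
proof (rule tspace_eqI)
  have "lmap (ospace B X X) H (hmult X)" using hmult_lmap by simp
  then show "lmap (ospace B X X) HH (\<lambda>t. \<Delta> (hmult X t))" by (rule lmap_\<Delta>)
  show "lmap (ospace B X X) HH (\<lambda>t. mm (Z (OD t)))" by (rule lmap_comp[OF mm_lmap lmap_comult_circ])
qed (use assms in \<open>simp add: hmult_pure mm_comult_circ_pure\<close>)

lemma hmult_counit:
  assumes "\<And>x y. x \<in> carrier H \<Longrightarrow> y \<in> carrier H \<Longrightarrow> \<epsilon> (amult H x y) = \<epsilon> x * \<epsilon> y"
  shows "\<forall>t\<in>carrier (ospace B X X). \<epsilon> (hmult X t) = mult_J B (omap B X X (unit_J B) (unit_J B) \<epsilon> \<epsilon> t)"
proof (rule tspace_eqI)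
  have "lmap (ospace B X X) H (hmult X)" using hmult_lmap by simp
  then show "lmap (ospace B X X) kspace (\<lambda>t. \<epsilon> (hmult X t))" by (rule lmap_\<epsilon>)
  show "lmap (ospace B X X) kspace (\<lambda>t. mult_J B (omap B X X (unit_J B) (unit_J B) \<epsilon> \<epsilon> t))"
    by (rule lmap_comp[OF lmap_mult_J lmap_omap[OF counit_map counit_map]])
qed (use assms in \<open>simp add: hmult_pure counit_circ_pure\<close>)

lemma same_comon_circ: "same_vs (comon_circ B X X) (circ B X X)"
  by (simp add: same_vs_def comon_circ_def bimod.defs comon.defs)

lemma tmap_comon_circ: "tmap (comon_circ B X X) (comon_circ B X X) X X (hmult X) (hmult X) = mm"
  by (rule tmap_same[OF same_comon_circ same_comon_circ same_vs_refl same_vs_refl])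


subsection \<open>The comultiplication of a product of comonoids\<close>

abbreviation TT where "TT \<equiv> tensor HH HH"
abbreviation br where "br \<equiv> braiding B S X X"

text \<open>The middle argument is an arbitrary tensor \<open>w\<close> instead of a pair, so that
  it can be the result of a braiding or a coproduct.\<close>

definition middle :: "'a \<Rightarrow> ('k, 'a, 'a) tens \<Rightarrow> 'a \<Rightarrow> ('k, ('k, 'a, 'a) tens, ('k, 'a, 'a) tens) tens" where
  "middle c w d = tlift H H TT (\<lambda>y x. tpure HH HH (tpure H H c y) (tpure H H x d)) w"

lemma middle_lmap:
  "w \<in> carrier HH \<Longrightarrow> d \<in> carrier H \<Longrightarrow> lmap H TT (\<lambda>c. middle c w d)"
  "c \<in> carrier H \<Longrightarrow> d \<in> carrier H \<Longrightarrow> lmap HH TT (\<lambda>w. middle c w d)"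
  "w \<in> carrier HH \<Longrightarrow> c \<in> carrier H \<Longrightarrow> lmap H TT (\<lambda>d. middle c w d)"
  unfolding middle_def by (intro lin_intros; simp)+

lemmas lmap_middle = lmap_comp[OF middle_lmap(1)] lmap_comp[OF middle_lmap(2)] lmap_comp[OF middle_lmap(3)]

lemma middle_pure:
  assumes "c \<in> carrier H" "y \<in> carrier H" "x \<in> carrier H" "d \<in> carrier H"
  shows "middle c (tpure H H y x) d = tpure HH HH (tpure H H c y) (tpure H H x d)"
proof -
  have "adm {} H H TT (\<lambda>y x. tpure HH HH (tpure H H c y) (tpure H H x d))"
    using assms by (intro lin_intros) simp_all
  then show ?thesis unfolding middle_def by (simp add: lift_pure assms)
qed

lemma br_lmap: "lmap HH HH br"
  by (rule lmap_cong[of _ _ "\<lambda>t. amult T R' (amult T (tflip H H t) R)"])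
    ((intro lin_intros)?; simp add: braiding_X)+

lemma br_closed: "t \<in> carrier HH \<Longrightarrow> br t \<in> carrier HH"
  by (rule lmap_closed[OF br_lmap])

abbreviation shuffle where "shuffle g s t \<equiv> tlift H H TT (\<lambda>c c'. tlift H H TT
    (\<lambda>d d'. middle c (g (tpure H H c' d)) d') t) s"

context
  fixes g
  assumes g: "lmap HH HH g"
begin

lemmas g_closed = lmap_closed[OF g]
lemmas lmap_g = lmap_comp[OF g]

lemma bil_shuffle: "bil HH HH TT (\<lambda>s t. shuffle g s t)"
  by (intro lin_intros lmap_middle lmap_g) (simp_all add: g_closed)

text \<open>Of the four coproduct factors of \<open>h\<close>, the inner two are by coassociativity
  the factors of one element \<open>w\<close>, so \<open>g\<close> is evaluated at
  \<open>\<Delta>(w)\<close>. In this form a \<open>g\<close> that fixes all coproducts can be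
  erased.\<close>

lemma shuffle_comult:
  assumes h: "h \<in> carrier H"
  shows "tlift H H TT (\<lambda>x y. shuffle g (\<Delta> x) (\<Delta> y)) (\<Delta> h) =
    tlift H H TT (\<lambda>c z. tlift H H TT (\<lambda>w d'. middle c (g (\<Delta> w)) d') (\<Delta> z)) (\<Delta> h)"
proof -
  have t1: "tril H H H TT (\<lambda>c c' y. tlift H H TT (\<lambda>d d'. middle c (g (tpure H H c' d)) d') (\<Delta> y))"
    by (intro trilI lin_intros lmap_middle lmap_g) (simp_all add: g_closed)
  have t2: "tril H H H TT (\<lambda>c' d d'. middle c (g (tpure H H c' d)) d')" if "c \<in> carrier H" for c
    using that by (intro trilI lmap_middle lin_intros lmap_g) (simp_all add: g_closed)
  have "tlift H H TT (\<lambda>x y. shuffle g (\<Delta> x) (\<Delta> y)) (\<Delta> h) =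
    tlift H H TT (\<lambda>c z. tlift H H TT (\<lambda>c' y. tlift H H TT (\<lambda>d d'. middle c (g (tpure H H c' d)) d') (\<Delta> y)) (\<Delta> z)) (\<Delta> h)"
    by (rule coassoc_lift[OF coalg_H t1 h])
  also have "\<dots> = tlift H H TT (\<lambda>c z. tlift H H TT (\<lambda>w d'. middle c (g (\<Delta> w)) d') (\<Delta> z)) (\<Delta> h)"
  proof (rule lift_cong)
    fix c z assume cz: "c \<in> carrier H" "z \<in> carrier H"
    have "tlift H H TT (\<lambda>c' y. tlift H H TT (\<lambda>d d'. middle c (g (tpure H H c' d)) d') (\<Delta> y)) (\<Delta> z) =
      tlift H H TT (\<lambda>w d'. tlift H H TT (\<lambda>c' d. middle c (g (tpure H H c' d)) d') (\<Delta> w)) (\<Delta> z)"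
      by (rule coassoc_lift[OF coalg_H t2[OF cz(1)] cz(2), symmetric])
    also have "\<dots> = tlift H H TT (\<lambda>w d'. middle c (g (\<Delta> w)) d') (\<Delta> z)"
    proof (rule lift_cong)
      fix w d' assume wd: "w \<in> carrier H" "d' \<in> carrier H"
      have "tlift H H TT (\<lambda>c' d. middle c (g (tpure H H c' d)) d') (\<Delta> w) =
        middle c (g (tlift H H HH (\<lambda>c' d. tpure H H c' d) (\<Delta> w))) d'"
        by (rule lmap_lift_comm[OF _ adm_pure \<Delta>_closed[OF wd(1)], symmetric])
          (intro lmap_middle lmap_g lmap_id cz wd; simp)
      then show "tlift H H TT (\<lambda>c' d. middle c (g (tpure H H c' d)) d') (\<Delta> w) = middle c (g (\<Delta> w)) d'"
        using wd by (simp add: lift_id)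
    qed
    finally show "tlift H H TT (\<lambda>c' y. tlift H H TT (\<lambda>d d'. middle c (g (tpure H H c' d)) d') (\<Delta> y)) (\<Delta> z) =
      tlift H H TT (\<lambda>w d'. middle c (g (\<Delta> w)) d') (\<Delta> z)" .
  qed
  finally show ?thesis .
qed

end

lemma adm_shuffle: "adm {} HH HH TT (\<lambda>s t. shuffle br s t)"
  by (rule adm_tensor[OF _ _ bil_shuffle[OF br_lmap]]) simp_all

lemma mid_braiding_eq: "mid_braiding B S X X = tlift HH HH TT (\<lambda>s t. shuffle br s t)"
  by (simp add: mid_braiding_def Let_def same_to_H middle_def)

lemma \<Delta>\<Delta>_eq: "tmap X X (tensor X X) (tensor X X) \<Delta> \<Delta> u = tlift H H TT (\<lambda>x y. tpure HH HH (\<Delta> x) (\<Delta> y)) u"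
  by (simp add: tmap_def same_to_H)

lemma comult_bullet:
  assumes u: "u \<in> carrier HH"
  shows "comult (comon_bullet B S X X) u = tlift H H TT (\<lambda>x y. shuffle br (\<Delta> x) (\<Delta> y)) u"
proof -
  have a: "adm {} H H TT (\<lambda>x y. tpure HH HH (\<Delta> x) (\<Delta> y))" by (intro lin_intros) simp_all
  have "comult (comon_bullet B S X X) u = mid_braiding B S X X (tmap X X (tensor X X) (tensor X X) \<Delta> \<Delta> u)"
    using u by (simp add: comon_bullet_def bimod.defs comon.defs compose_eq same_to_H)
  also have "\<dots> = tlift H H TT (\<lambda>x y. shuffle br (\<Delta> x) (\<Delta> y)) u"
    unfolding mid_braiding_eq \<Delta>\<Delta>_eq lift_lift[OF adm_shuffle a u]
    by (rule lift_cong) (simp add: lift_pure[OF adm_shuffle])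
  finally show ?thesis .
qed

lemma counit_bullet: "counit (comon_bullet B S X X) = tlift H H kspace (\<lambda>x y. \<epsilon> x * \<epsilon> y)"
  by (simp add: comon_bullet_def bimod.defs comon.defs same_to_H)

lemma same_comon_bullet: "same_vs (comon_bullet B S X X) HH"
  using same_bullet[of B X X] by (simp add: same_vs_def comon_bullet_def bimod.defs comon.defs same_to_H)

text \<open>
  Both sides of the compatibility of \<open>\<Delta>\<close> with the comultiplication of \<open>X \<bullet> X\<close> are obtained by
  shuffling, once with the braiding and once with the identity; cocommutativity makes them agree.
\<close>

lemma comult_bullet_comult:
  assumes coc: "\<And>x. x \<in> carrier H \<Longrightarrow> br (\<Delta> x) = \<Delta> x" and h: "h \<in> carrier H"
  shows "comult (comon_bullet B S X X) (\<Delta> h) = tmap X X (comon_bullet B S X X) (comon_bullet B S X X) \<Delta> \<Delta> (\<Delta> h)"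
proof -
  have l: "lmap HH HH (\<lambda>t. t)" by (rule lmap_id) simp
  have "comult (comon_bullet B S X X) (\<Delta> h) =
      tlift H H TT (\<lambda>c z. tlift H H TT (\<lambda>w d'. middle c (br (\<Delta> w)) d') (\<Delta> z)) (\<Delta> h)"
    using h by (simp add: comult_bullet shuffle_comult[OF br_lmap])
  also have "\<dots> = tlift H H TT (\<lambda>c z. tlift H H TT (\<lambda>w d'. middle c (\<Delta> w) d') (\<Delta> z)) (\<Delta> h)"
    by (intro lift_cong) (simp add: coc)
  also have "\<dots> = tlift H H TT (\<lambda>x y. shuffle (\<lambda>t. t) (\<Delta> x) (\<Delta> y)) (\<Delta> h)"
    by (rule shuffle_comult[OF l h, symmetric])
  also have "\<dots> = tlift H H TT (\<lambda>x y. tpure HH HH (\<Delta> x) (\<Delta> y)) (\<Delta> h)"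
  proof (rule lift_cong)
    fix x y assume xy: "x \<in> carrier H" "y \<in> carrier H"
    have lt: "lmap HH TT (\<lambda>s. tpure HH HH s t)" "lmap HH TT (\<lambda>s. tpure HH HH t s)" if "t \<in> carrier HH" for t
      using that by (intro lin_intros; simp)+
    have "shuffle (\<lambda>t. t) (\<Delta> x) (\<Delta> y) = tlift H H TT (\<lambda>c c'. tlift H H TT
        (\<lambda>d d'. tpure HH HH (tpure H H c c') (tpure H H d d')) (\<Delta> y)) (\<Delta> x)"
      by (intro lift_cong) (simp add: middle_pure)
    also have "\<dots> = tlift H H TT (\<lambda>c c'. tpure HH HH (tpure H H c c') (\<Delta> y)) (\<Delta> x)"
    proof (rule lift_cong)
      fix c c' assume c: "c \<in> carrier H" "c' \<in> carrier H"
      show "tlift H H TT (\<lambda>d d'. tpure HH HH (tpure H H c c') (tpure H H d d')) (\<Delta> y) = tpure HH HH (tpure H H c c') (\<Delta> y)"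
        using lmap_lift_comm[OF lt(2)[OF pure_closed[OF c]] adm_pure \<Delta>_closed[OF xy(2)]] xy by (simp add: lift_id)
    qed
    also have "\<dots> = tpure HH HH (\<Delta> x) (\<Delta> y)"
      using lmap_lift_comm[OF lt(1)[OF \<Delta>_closed[OF xy(2)]] adm_pure \<Delta>_closed[OF xy(1)]] xy by (simp add: lift_id)
    finally show "shuffle (\<lambda>t. t) (\<Delta> x) (\<Delta> y) = tpure HH HH (\<Delta> x) (\<Delta> y)" .
  qed
  also have "\<dots> = tmap H H HH HH \<Delta> \<Delta> (\<Delta> h)" by (simp add: tmap_def)
  finally show ?thesis
    by (simp only: same_to_H tmap_same[OF same_vs_refl same_vs_refl same_comon_bullet same_comon_bullet])
qed

lemma counit_actions:
  "b \<in> carrier B \<Longrightarrow> x \<in> carrier H \<Longrightarrow> \<epsilon> (lact X b x) = bcounit B b * \<epsilon> x"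
  "b \<in> carrier B \<Longrightarrow> x \<in> carrier H \<Longrightarrow> \<epsilon> (ract X x b) = \<epsilon> x * bcounit B b"
  using bimod_mapD(4,5)[OF counit_map] by (simp_all add: unit_J_actions)

abbreviation EE where "EE \<equiv> tlift H H kspace (\<lambda>x y. \<epsilon> x * \<epsilon> y)"

lemma adm_EE: "adm {} H H kspace (\<lambda>x y. \<epsilon> x * \<epsilon> y)"
  by (intro lin_intros \<epsilon>_lmap) simp_all

text \<open>The componentwise action of all of \<open>B \<otimes> B\<close> is considered because
  the braiding acts by \<open>S\<close> and its inverse, which need not be coproducts; linearity in
  \<open>s\<close> and \<open>t\<close> leaves pure tensors.\<close>

lemma EE_actions:
  assumes s: "s \<in> carrier (tensor B B)" and t: "t \<in> carrier HH"
  shows "EE (lact2 B X X s t) = ee s * EE t" "EE (ract2 B X X t s) = EE t * ee s"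
proof -
  note lE = lmap_comp[OF lmap_lift[OF adm_EE]] and le = lmap_lift[OF adm_ee]
  have "\<forall>s\<in>carrier (tensor B B). EE (lact2 B X X s t) = ee s * EE t"
  proof (rule tspace_eqI)
    show "lmap (tensor B B) kspace (\<lambda>s. EE (lact2 B X X s t))" "lmap (tensor B B) kspace (\<lambda>s. ee s * EE t)"
      by (intro lE lmap_lact2_X lmap_times le t lmap_id; simp)+
    fix b b' assume b: "b \<in> carrier B" "b' \<in> carrier B"
    have "\<forall>t\<in>carrier HH. EE (lact2 B X X (tpure B B b b') t) = ee (tpure B B b b') * EE t"
    proof (rule tspace_eqI)
      show "lmap HH kspace (\<lambda>t. EE (lact2 B X X (tpure B B b b') t))" "lmap HH kspace (\<lambda>t. ee (tpure B B b b') * EE t)"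
        by (intro lE lmap_lact2_X lmap_times lmap_id; simp add: b)+
    qed (simp add: b lact2_pure[OF spX spX, unfolded same_to_H] counit_actions lift_pure[OF adm_EE]
          lift_pure[OF adm_ee] action_closed[OF spX, unfolded carrier_X] ac_simps)
    then show "EE (lact2 B X X (tpure B B b b') t) = ee (tpure B B b b') * EE t" using t by blast
  qed
  then show "EE (lact2 B X X s t) = ee s * EE t" using s by blast
  have "\<forall>s\<in>carrier (tensor B B). EE (ract2 B X X t s) = EE t * ee s"
  proof (rule tspace_eqI)
    show "lmap (tensor B B) kspace (\<lambda>s. EE (ract2 B X X t s))" "lmap (tensor B B) kspace (\<lambda>s. EE t * ee s)"
      by (intro lE lmap_ract2_X lmap_times le t lmap_id; simp)+
    fix b b' assume b: "b \<in> carrier B" "b' \<in> carrier B"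
    have "\<forall>t\<in>carrier HH. EE (ract2 B X X t (tpure B B b b')) = EE t * ee (tpure B B b b')"
    proof (rule tspace_eqI)
      show "lmap HH kspace (\<lambda>t. EE (ract2 B X X t (tpure B B b b')))" "lmap HH kspace (\<lambda>t. EE t * ee (tpure B B b b'))"
        by (intro lE lmap_ract2_X lmap_times lmap_id; simp add: b)+
    qed (simp add: b ract2_pure[OF spX spX, unfolded same_to_H] counit_actions lift_pure[OF adm_EE]
          lift_pure[OF adm_ee] action_closed[OF spX, unfolded carrier_X] ac_simps)
    then show "EE (ract2 B X X t (tpure B B b b')) = EE t * ee (tpure B B b b')" using t by blast
  qed
  then show "EE (ract2 B X X t s) = EE t * ee s" using s by blast
qed

text \<open>The braiding multiplies the flipped tensor by \<open>S'\<close> and \<open>S\<close>, to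
  which \<open>\<epsilon> \<otimes> \<epsilon>\<close> assigns \<open>1\<close>; apart from that the
  two counits just trade places.\<close>

lemma EE_braiding:
  assumes "x \<in> carrier H" "y \<in> carrier H"
  shows "EE (br (tpure H H x y)) = \<epsilon> x * \<epsilon> y"
  using assms ract2_closed[OF spX spX, unfolded same_to_H]
  by (simp add: braiding_def same_to_H tflip_pure EE_actions ee_S ee_S' lift_pure[OF adm_EE])

text \<open>
  The Eckmann--Hilton argument: applying the counits to the two middle factors of \<open>X \<bullet> X \<bullet> X \<bullet> X\<close>
  undoes the comultiplication of \<open>X \<bullet> X\<close>.
\<close>

lemma hcomult_eq_comult:
  assumes hom: "hcomult X \<in> comon_hom B X (comon_bullet B S X X)"
    and hcoalg: "is_coalgebra X (hcomult X) (hcounit X)"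
    and hcounit: "\<And>x. x \<in> carrier H \<Longrightarrow> hcounit X x = \<epsilon> x"
    and x: "x \<in> carrier H"
  shows "hcomult X x = \<Delta> x"
proof -
  let ?D = "hcomult X"
  have hc: "is_coalgebra H ?D (hcounit X)" using hcoalg is_coalgebra_same[OF same] by blast
  have Dl: "lmap H HH ?D" by (rule coalgebra_lmap(1)[OF hc])
  have Dc: "?D x \<in> carrier HH" using Dl x by (rule lmap_closed)
  \<comment> \<open>\<open>?p\<close> is \<open>Id \<otimes> \<epsilon>\<close> and
    \<open>?q\<close> is \<open>\<epsilon> \<otimes> Id\<close>, so \<open>?P\<close> below keeps
    the outer two of four factors.\<close>
  let ?p = "\<lambda>t. tlift H H H (\<lambda>a b. vscale H (\<epsilon> b) a) t" and ?q = "\<lambda>t. tlift H H H (\<lambda>a b. vscale H (\<epsilon> a) b) t"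
  have ap: "adm {} H H H (\<lambda>a b. vscale H (\<epsilon> b) a)" and aq: "adm {} H H H (\<lambda>a b. vscale H (\<epsilon> a) b)"
    by (intro lin_intros \<epsilon>_lmap; simp)+
  note pl = lmap_lift[OF ap] and ql = lmap_lift[OF aq]
  let ?P = "\<lambda>t. tmap HH HH H H ?p ?q t"
  note Pl = lmap_tmap[OF pl ql]
  have P_middle: "?P (middle c w d) = vscale HH (EE w) (tpure H H c d)"
    if c: "c \<in> carrier H" and w: "w \<in> carrier HH" and d: "d \<in> carrier H" for c w d
  proof -
    have "\<forall>w\<in>carrier HH. ?P (middle c w d) = vscale HH (EE w) (tpure H H c d)"
    proof (rule tspace_eqI)
      show "lmap HH HH (\<lambda>w. ?P (middle c w d))"
        by (intro lmap_comp[OF Pl] lmap_middle lmap_id c d) simp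
      show "lmap HH HH (\<lambda>w. vscale HH (EE w) (tpure H H c d))"
        by (intro lmap_vscale_left lmap_lift adm_EE) (simp_all add: c d)
      fix y x assume xy: "y \<in> carrier H" "x \<in> carrier H"
      have s1: "tpure H H (vscale H k u) v = vscale HH k (tpure H H u v)" "tpure H H u (vscale H k v) = vscale HH k (tpure H H u v)"
        if "u \<in> carrier H" "v \<in> carrier H" for u v k
        using lmap_scale[OF lmap_pure1[OF lmap_id that(2)] that(1)] lmap_scale[OF lmap_pure2[OF lmap_id that(1)] that(2)]
        by simp_all
      show "?P (middle c (tpure H H y x) d) = vscale HH (EE (tpure H H y x)) (tpure H H c d)"
        using xy c d by (simp add: middle_pure tmap_pure[OF pl ql] lift_pure[OF ap] lift_pure[OF aq]
            lift_pure[OF adm_EE] s1 mult.commute flip: vscale_mult)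
    qed
    then show ?thesis using w by blast
  qed
  \<comment> \<open>The braiding only moves the inner factors, where by \<open>EE_braiding\<close>
    the counits do not notice it; what is left are the counit laws at \<open>x\<close> and at
    \<open>y\<close>.\<close>
  have P_shuffle: "?P (shuffle br (\<Delta> x) (\<Delta> y)) = tpure H H x y" if xy: "x \<in> carrier H" "y \<in> carrier H" for x y
  proof -
    have a1: "adm {} H H TT (\<lambda>d d'. middle c (br (tpure H H c' d)) d')" if "c \<in> carrier H" "c' \<in> carrier H" for c c'
      using that by (intro lin_intros lmap_middle lmap_comp[OF br_lmap]) (simp_all add: br_closed)
    have a2: "adm {} H H TT (\<lambda>c c'. tlift H H TT (\<lambda>d d'. middle c (br (tpure H H c' d)) d') (\<Delta> y))"
      using xy by (intro lin_intros lmap_middle lmap_comp[OF br_lmap]) (simp_all add: br_closed)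
    have "?P (shuffle br (\<Delta> x) (\<Delta> y)) = tlift H H HH (\<lambda>c c'. tlift H H HH
        (\<lambda>d d'. ?P (middle c (br (tpure H H c' d)) d')) (\<Delta> y)) (\<Delta> x)"
      unfolding lmap_lift_comm[OF Pl a2 \<Delta>_closed[OF xy(1)]]
      by (rule lift_cong) (rule lmap_lift_comm[OF Pl a1 \<Delta>_closed[OF xy(2)]])
    also have "\<dots> = tlift H H HH (\<lambda>c c'. tlift H H HH (\<lambda>d d'. vscale HH (\<epsilon> d) (vscale HH (\<epsilon> c') (tpure H H c d'))) (\<Delta> y)) (\<Delta> x)"
      by (intro lift_cong) (simp add: P_middle br_closed EE_braiding vscale_mult vscale_commute)
    also have "\<dots> = tlift H H HH (\<lambda>c c'. vscale HH (\<epsilon> c') (tpure H H c y)) (\<Delta> x)"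
      by (intro lift_cong counit_lift(1)[OF coalg_H] lin_intros xy) simp_all
    also have "\<dots> = tpure H H x y"
      by (intro counit_lift(2)[OF coalg_H] lin_intros xy) (simp_all add: xy)
    finally show ?thesis .
  qed
  \<comment> \<open>\<open>hcomult\<close> is a morphism of comonoids into
    \<open>X \<bullet> X\<close>. Applying \<open>?P\<close> to this equation returns
    \<open>hcomult x\<close> on the left and, by the counit laws of \<open>hcomult\<close>,
    \<open>\<Delta> x\<close> on the right.\<close>
  have "comult (comon_bullet B S X X) (?D x) = tmap X X (comon_bullet B S X X) (comon_bullet B S X X) ?D ?D (\<Delta> x)"
    using hom x by (simp add: comon_hom_def)
  also have "\<dots> = tmap H H HH HH ?D ?D (\<Delta> x)"
    by (simp only: same_to_H tmap_same[OF same_vs_refl same_vs_refl same_comon_bullet same_comon_bullet])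
  finally have eq: "tlift H H TT (\<lambda>x y. shuffle br (\<Delta> x) (\<Delta> y)) (?D x) = tmap H H HH HH ?D ?D (\<Delta> x)"
    by (simp add: comult_bullet Dc)
  have a3: "adm {} H H TT (\<lambda>x y. shuffle br (\<Delta> x) (\<Delta> y))"
    by (intro adm_tensor bilI bil_comp1[OF bil_shuffle[OF br_lmap]] bil_comp2[OF bil_shuffle[OF br_lmap]] \<Delta>_lmap) simp_all
  have "?P (tlift H H TT (\<lambda>x y. shuffle br (\<Delta> x) (\<Delta> y)) (?D x)) = tlift H H HH (\<lambda>x y. tpure H H x y) (?D x)"
    unfolding lmap_lift_comm[OF Pl a3 Dc] by (rule lift_cong) (rule P_shuffle)
  also have "\<dots> = ?D x" by (rule lift_id[OF Dc])
  finally have L: "?P (tlift H H TT (\<lambda>x y. shuffle br (\<Delta> x) (\<Delta> y)) (?D x)) = ?D x" .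
  have pD: "?p (?D y) = y" "?q (?D y) = y" if "y \<in> carrier H" for y
    using counit_lift[OF hc lmap_id that] that hcounit
    by (simp_all add: lift_cong[of H H "\<lambda>a b. vscale H (hcounit X b) a" "\<lambda>a b. vscale H (\<epsilon> b) a"]
        lift_cong[of H H "\<lambda>a b. vscale H (hcounit X a) b" "\<lambda>a b. vscale H (\<epsilon> a) b"])
  have "?P (tmap H H HH HH ?D ?D (\<Delta> x)) = tmap H H H H (\<lambda>y. ?p (?D y)) (\<lambda>y. ?q (?D y)) (\<Delta> x)"
    by (rule tmap_tmap[OF Dl Dl pl ql]) (simp add: x)
  also have "\<dots> = tmap H H H H (\<lambda>y. y) (\<lambda>y. y) (\<Delta> x)" by (rule tmap_cong) (simp_all add: pD)
  also have "\<dots> = \<Delta> x" by (rule tmap_id) (simp add: x)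
  finally show ?thesis using L eq by simp
qed


subsection \<open>Antipodes\<close>

abbreviation Q where "Q \<equiv> bullet B X (unit_I B)"
abbreviation Q' where "Q' \<equiv> bullet B (unit_I B) X"


lemma in_lmap: "lmap H (ospace B Q (unit_J B)) (\<lambda>z. phi_in B X z)" "lmap H (ospace B (unit_J B) Q') (\<lambda>z. psi_in B X z)"
  by (intro lin_intros lmap_tgt; simp add: lmap_id)+

lemma bimod_map_id: "bimod_map B (unit_I B) (unit_I B) (\<lambda>b. b)" "bimod_map B (unit_J B) (unit_J B) (\<lambda>k. k)"
  by (simp_all add: bimod_map_def bimod_space_unit_I bimod_space_unit_J lmap_id)

context
  fixes \<Sigma> t
  assumes \<Sigma>: "lmap H H \<Sigma>" and t: "t \<in> carrier HH"
begin

text \<open>Multiplication is a bimodule map, so it acts inside both products and meets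
  \<open>x \<circ> \<Sigma>(y)\<close> directly. What remains is an ordinary convolution product,
  embedded by \<open>phi_in\<close>.\<close>

lemma antipode_left_side:
  "conv_phi B X \<Sigma> t =
   phi_in B X (tlift H H H (\<lambda>x y. amult H x (\<Sigma> y)) t)"
proof -
  let ?P = "bullet B (circ B X X) (unit_I B)"
  let ?F = "\<lambda>x y. opure B ?P (unit_J B) (tpure (circ B X X) (unit_I B) (opure B X X x y) (aone B)) 1"
  note sr = same_vs_trans[OF same_bimod_rev same]
  have F: "bil H H (ospace B ?P (unit_J B)) ?F" by (intro lin_intros lmap_tgt) (simp_all add: lmap_id)
  have F': "adm {} H H (ospace B ?P (unit_J B)) (\<lambda>x y. ?F x (\<Sigma> y))"
    by (intro adm_tensor bilI bil_lmap1[OF F] bil_comp2[OF F] \<Sigma>) (simp_all add: lmap_closed[OF \<Sigma>])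
  have "rev_phi B X X (tmap X X X (bimod_rev B X) (\<lambda>x. x) \<Sigma> t) =
      tlift H H (ospace B ?P (unit_J B)) ?F (tmap H H H H (\<lambda>x. x) \<Sigma> t)"
    unfolding rev_phi_def lift_same[OF same sr same_vs_refl] tmap_same[OF same same same sr] ..
  also have "\<dots> = tlift H H (ospace B ?P (unit_J B)) (\<lambda>x y. ?F x (\<Sigma> y)) t"
    by (rule tlift_tmap[OF lmap_id \<Sigma> F t]) simp
  finally have 1: "rev_phi B X X (tmap X X X (bimod_rev B X) (\<lambda>x. x) \<Sigma> t) =
    tlift H H (ospace B ?P (unit_J B)) (\<lambda>x y. ?F x (\<Sigma> y)) t" .
  note b1 = bimod_map_tmap[OF hmult_bimod_map bimod_map_id(1)]
  have li: "lmap (unit_I B) (unit_I B) (\<lambda>b. b)" by (simp add: lmap_id)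
  have a: "adm {} H H H (\<lambda>x y. amult H x (\<Sigma> y))" by (intro lin_intros \<Sigma>) (simp_all add: lmap_closed[OF \<Sigma>])
  show ?thesis
    unfolding 1 lmap_lift_comm[OF lmap_omap[OF b1 bimod_map_id(2)] F' t] lmap_lift_comm[OF in_lmap(1) a t]
    by (rule lift_cong) (simp add: omap_pure[OF b1 bimod_map_id(2)] tmap_pure[OF hmult_circ_lmap li] hmult_pure
      lmap_closed[OF \<Sigma>])
qed

lemma antipode_right_side:
  "conv_psi B X \<Sigma> t =
   psi_in B X (tlift H H H (\<lambda>x y. amult H (\<Sigma> x) y) t)"
proof -
  let ?P = "bullet B (unit_I B) (circ B X X)"
  let ?F = "\<lambda>x y. opure B (unit_J B) ?P 1 (tpure (unit_I B) (circ B X X) (aone B) (opure B X X x y))"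
  note sr = same_vs_trans[OF same_bimod_rev same]
  have F: "bil H H (ospace B (unit_J B) ?P) ?F" by (intro lin_intros lmap_tgt) (simp_all add: lmap_id)
  have F': "adm {} H H (ospace B (unit_J B) ?P) (\<lambda>x y. ?F (\<Sigma> x) y)"
    by (intro adm_tensor bilI bil_comp1[OF F] bil_lmap2[OF F] \<Sigma>) (simp_all add: lmap_closed[OF \<Sigma>])
  have "rev_psi B X X (tmap X X (bimod_rev B X) X \<Sigma> (\<lambda>x. x) t) =
      tlift H H (ospace B (unit_J B) ?P) ?F (tmap H H H H \<Sigma> (\<lambda>x. x) t)"
    unfolding rev_psi_def lift_same[OF sr same same_vs_refl] tmap_same[OF same same sr same] ..
  also have "\<dots> = tlift H H (ospace B (unit_J B) ?P) (\<lambda>x y. ?F (\<Sigma> x) y) t"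
    by (rule tlift_tmap[OF \<Sigma> lmap_id F t]) simp
  finally have 1: "rev_psi B X X (tmap X X (bimod_rev B X) X \<Sigma> (\<lambda>x. x) t) =
    tlift H H (ospace B (unit_J B) ?P) (\<lambda>x y. ?F (\<Sigma> x) y) t" .
  note b1 = bimod_map_tmap[OF bimod_map_id(1) hmult_bimod_map]
  have li: "lmap (unit_I B) (unit_I B) (\<lambda>b. b)" by (simp add: lmap_id)
  have a: "adm {} H H H (\<lambda>x y. amult H (\<Sigma> x) y)" by (intro lin_intros \<Sigma>) (simp_all add: lmap_closed[OF \<Sigma>])
  show ?thesis
    unfolding 1 lmap_lift_comm[OF lmap_omap[OF bimod_map_id(2) b1] F' t] lmap_lift_comm[OF in_lmap(2) a t]
    by (rule lift_cong) (simp add: omap_pure[OF bimod_map_id(2) b1] tmap_pure[OF li hmult_circ_lmap] hmult_pure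
      lmap_closed[OF \<Sigma>])
qed

end

text \<open>
  The maps \<open>(h \<bullet> b) \<circ> k \<mapsto> k h f(S b)\<close> and \<open>k \<circ> (b \<bullet> h) \<mapsto> k f(S b) h\<close>, with \<open>S\<close> the antipode
  of \<open>B\<close>, are well defined and split the embeddings of \<open>X\<close>.
\<close>

lemma phi_in_inj: "inj_on (\<lambda>z. phi_in B X z) (carrier H)"
proof -
  let ?I = "unit_I B" and ?J = "unit_J B" and ?S = "antipode B"
  note spI = bimod_space_unit_I
  have aw: "adm {} X ?I H (\<lambda>h b. amult H h (f (?S b)))"
    by (intro lin_intros lmap_f) (simp_all add: lmap_id lmap_antipode)
  define w where "w = tlift X ?I H (\<lambda>h b. amult H h (f (?S b)))"
  have wl: "lmap (tensor X ?I) H w" unfolding w_def by (rule lmap_lift[OF aw])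
  have wp: "w (tpure X ?I h b) = amult H h (f (?S b))" if "h \<in> carrier H" "b \<in> carrier B" for h b
    unfolding w_def using that by (intro lift_pure[OF aw]) simp_all
  \<comment> \<open>This balances the map over \<open>J\<close>: \<open>h f(c\<^sub>1) f(S(b
    c\<^sub>2)) = h f(c\<^sub>1 S(c\<^sub>2)) f(S(b)) = \<epsilon>(c) h f(S(b))\<close>, because the
    antipode reverses products.\<close>
  have w: "\<forall>u\<in>carrier (tensor X ?I). w (ract2 B X ?I u (bcomult B c)) = vscale H (bcounit B c) (w u)"
    if c: "c \<in> carrier B" for c
  proof (rule tspace_eqI)
    show "lmap (tensor X ?I) H (\<lambda>u. w (ract2 B X ?I u (bcomult B c)))"
      by (intro lmap_comp[OF wl] lmap_ract2[OF spX spI] lmap_id) (simp_all add: c)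
    show "lmap (tensor X ?I) H (\<lambda>u. vscale H (bcounit B c) (w u))" by (intro lmap_vscale wl)
    fix h b assume h: "h \<in> carrier X" and b: "b \<in> carrier ?I"
    let ?G = "\<lambda>s. w (ract2 B X ?I (tpure X ?I h b) s)"
    have Gl: "lmap (tensor B B) H ?G"
      by (intro lmap_comp[OF wl] lmap_ract2[OF spX spI] lmap_id pure_closed h b) simp
    have gl: "lmap B H (\<lambda>z. amult H h (amult H (f z) (f (?S b))))" using h b by (intro lin_intros) simp_all
    have a: "adm {} B B B (\<lambda>y z. amult B y (?S z))" by (intro lin_intros) simp_all
    have "?G (bcomult B c) = ?G (tlift B B (tensor B B) (\<lambda>x y. tpure B B x y) (bcomult B c))"
      using c by (simp add: lift_id)
    also have "\<dots> = tlift B B H (\<lambda>x y. ?G (tpure B B x y)) (bcomult B c)"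
      by (rule lmap_lift_comm[OF Gl adm_pure]) (simp add: c)
    also have "\<dots> = tlift B B H (\<lambda>x y. amult H h (amult H (f (amult B x (?S y))) (f (?S b)))) (bcomult B c)"
    proof (rule lift_cong)
      fix x y assume "x \<in> carrier B" "y \<in> carrier B"
      then show "?G (tpure B B x y) = amult H h (amult H (f (amult B x (?S y))) (f (?S b)))"
        using h b by (simp add: ract2_pure[OF spX spI] ract_X unit_I_actions wp antipode_mult alg_map_mult[OF fa] amult_assoc)
    qed
    also have "\<dots> = amult H h (amult H (f (vscale B (bcounit B c) (aone B))) (f (?S b)))"
      using lmap_lift_comm[OF gl a bcomult_closed[OF bialgebra c]] c by (simp add: antipode_right)
    also have "\<dots> = vscale H (bcounit B c) (w (tpure X ?I h b))"
      using h b by (simp add: lmap_scale[OF f_lmap] alg_map_one[OF fa] amult_vscale wp)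
    finally show "?G (bcomult B c) = vscale H (bcounit B c) (w (tpure X ?I h b))" .
  qed
  have "adm (balanced_relations B Q ?J) Q ?J H (\<lambda>u k. vscale H k (w u))"
  proof (rule adm_olift[OF bimod_space_bullet[OF spX spI] bimod_space_unit_J])
    show "bil Q ?J H (\<lambda>u k. vscale H k (w u))"
      using lmap_closed[OF wl] wl by (intro bilI lmap_vscale lmap_vscale_left) (simp_all add: lmap_id)
    fix u c k assume "u \<in> carrier Q" "c \<in> carrier B" "k \<in> carrier ?J"
    then show "vscale H k (w (ract Q u c)) = vscale H (lact ?J c k) (w u)"
      using w lmap_closed[OF wl] by (simp add: bullet_actions[OF spX spI] unit_J_actions mult.commute flip: vscale_mult)
  qed
  note th = lift_pure[OF this]
  \<comment> \<open>At \<open>(z \<bullet> 1) \<circ> 1\<close> the retraction gives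
    \<open>z f(S(1)) = z\<close>.\<close>
  have "lift (balanced_relations B Q ?J) Q ?J H (\<lambda>u k. vscale H k (w u)) (phi_in B X z) = z" if "z \<in> carrier H" for z
    using that by (subst th) (simp_all add: wp antipode_one alg_map_one[OF fa])
  then show ?thesis by (rule inj_on_inverseI[where g = "lift (balanced_relations B Q ?J) Q ?J H (\<lambda>u k. vscale H k (w u))"])
qed

lemma psi_in_inj: "inj_on (\<lambda>z. psi_in B X z) (carrier H)"
proof -
  let ?I = "unit_I B" and ?J = "unit_J B" and ?S = "antipode B"
  note spI = bimod_space_unit_I
  have aw: "adm {} ?I X H (\<lambda>b h. amult H (f (?S b)) h)"
    by (intro lin_intros lmap_f) (simp_all add: lmap_id lmap_antipode)
  define w where "w = tlift ?I X H (\<lambda>b h. amult H (f (?S b)) h)"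
  have wl: "lmap (tensor ?I X) H w" unfolding w_def by (rule lmap_lift[OF aw])
  have wp: "w (tpure ?I X b h) = amult H (f (?S b)) h" if "h \<in> carrier H" "b \<in> carrier B" for h b
    unfolding w_def using that by (intro lift_pure[OF aw]) simp_all
  \<comment> \<open>Mirror image, with the other antipode axiom: \<open>f(S(c\<^sub>1 b))
    f(c\<^sub>2) h = f(S(b)) f(S(c\<^sub>1) c\<^sub>2) h = \<epsilon>(c) f(S(b)) h\<close>.\<close>
  have w: "\<forall>u\<in>carrier (tensor ?I X). w (lact2 B ?I X (bcomult B c) u) = vscale H (bcounit B c) (w u)"
    if c: "c \<in> carrier B" for c
  proof (rule tspace_eqI)
    show "lmap (tensor ?I X) H (\<lambda>u. w (lact2 B ?I X (bcomult B c) u))"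
      by (intro lmap_comp[OF wl] lmap_lact2[OF spI spX] lmap_id) (simp_all add: c)
    show "lmap (tensor ?I X) H (\<lambda>u. vscale H (bcounit B c) (w u))" by (intro lmap_vscale wl)
    fix b h assume b: "b \<in> carrier ?I" and h: "h \<in> carrier X"
    let ?G = "\<lambda>s. w (lact2 B ?I X s (tpure ?I X b h))"
    have Gl: "lmap (tensor B B) H ?G"
      by (intro lmap_comp[OF wl] lmap_lact2[OF spI spX] lmap_id pure_closed h b) simp
    have gl: "lmap B H (\<lambda>z. amult H (f (?S b)) (amult H (f z) h))" using h b by (intro lin_intros) simp_all
    have a: "adm {} B B B (\<lambda>y z. amult B (?S y) z)" by (intro lin_intros) simp_all
    have "?G (bcomult B c) = ?G (tlift B B (tensor B B) (\<lambda>x y. tpure B B x y) (bcomult B c))"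
      using c by (simp add: lift_id)
    also have "\<dots> = tlift B B H (\<lambda>x y. ?G (tpure B B x y)) (bcomult B c)"
      by (rule lmap_lift_comm[OF Gl adm_pure]) (simp add: c)
    also have "\<dots> = tlift B B H (\<lambda>x y. amult H (f (?S b)) (amult H (f (amult B (?S x) y)) h)) (bcomult B c)"
    proof (rule lift_cong)
      fix x y assume "x \<in> carrier B" "y \<in> carrier B"
      then show "?G (tpure B B x y) = amult H (f (?S b)) (amult H (f (amult B (?S x) y)) h)"
        using h b by (simp add: lact2_pure[OF spI spX] lact_X unit_I_actions wp antipode_mult alg_map_mult[OF fa] amult_assoc)
    qed
    also have "\<dots> = amult H (f (?S b)) (amult H (f (vscale B (bcounit B c) (aone B))) h)"
      using lmap_lift_comm[OF gl a bcomult_closed[OF bialgebra c]] c by (simp add: antipode_left)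
    also have "\<dots> = vscale H (bcounit B c) (w (tpure ?I X b h))"
      using h b by (simp add: lmap_scale[OF f_lmap] alg_map_one[OF fa] amult_vscale wp)
    finally show "?G (bcomult B c) = vscale H (bcounit B c) (w (tpure ?I X b h))" .
  qed
  have "adm (balanced_relations B ?J Q') ?J Q' H (\<lambda>k u. vscale H k (w u))"
  proof (rule adm_olift[OF bimod_space_unit_J bimod_space_bullet[OF spI spX]])
    show "bil ?J Q' H (\<lambda>k u. vscale H k (w u))"
      using lmap_closed[OF wl] wl by (intro bilI lmap_vscale lmap_vscale_left) (simp_all add: lmap_id)
    fix k c u assume "k \<in> carrier ?J" "c \<in> carrier B" "u \<in> carrier Q'"
    then show "vscale H (ract ?J k c) (w u) = vscale H k (w (lact Q' c u))"
      using w lmap_closed[OF wl] by (simp add: bullet_actions[OF spI spX] unit_J_actions flip: vscale_mult)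
  qed
  note th = lift_pure[OF this]
  have "lift (balanced_relations B ?J Q') ?J Q' H (\<lambda>k u. vscale H k (w u)) (psi_in B X z) = z" if "z \<in> carrier H" for z
    using that by (subst th) (simp_all add: wp antipode_one alg_map_one[OF fa])
  then show ?thesis by (rule inj_on_inverseI[where g = "lift (balanced_relations B ?J Q') ?J Q' H (\<lambda>k u. vscale H k (w u))"])
qed

text \<open>Both sides of each Hopf monoid axiom are images under an injective linear map, so they
  may be compared before embedding. For \<open>t = \<Delta>(h)\<close> and
  \<open>c = \<epsilon>(h)\<close> the right-hand equations are the two antipode axioms.\<close>

lemma antipode_equations_iff:
  assumes \<Sigma>: "lmap H H \<Sigma>" and t: "t \<in> carrier HH"
  shows "conv_phi B X \<Sigma> t =
     vscale (circ B Q (unit_J B)) c (phi_in B X (aone H))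
    \<longleftrightarrow> tlift H H H (\<lambda>x y. amult H x (\<Sigma> y)) t = vscale H c (aone H)"
    and "conv_psi B X \<Sigma> t =
     vscale (circ B (unit_J B) Q') c (psi_in B X (aone H))
    \<longleftrightarrow> tlift H H H (\<lambda>x y. amult H (\<Sigma> x) y) t = vscale H c (aone H)"
proof -
  have a: "adm {} H H H (\<lambda>x y. amult H x (\<Sigma> y))" "adm {} H H H (\<lambda>x y. amult H (\<Sigma> x) y)"
    by (intro lin_intros \<Sigma>; simp add: lmap_closed[OF \<Sigma>])+
  have "phi_in B X (vscale H c (aone H)) = vscale (ospace B Q (unit_J B)) c (phi_in B X (aone H))"
    "psi_in B X (vscale H c (aone H)) = vscale (ospace B (unit_J B) Q') c (psi_in B X (aone H))"
    using lmap_scale[OF in_lmap(1)] lmap_scale[OF in_lmap(2)] by simp_all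
  then have r: "vscale (circ B Q (unit_J B)) c (phi_in B X (aone H)) =
      phi_in B X (vscale H c (aone H))"
    "vscale (circ B (unit_J B) Q') c (psi_in B X (aone H)) =
      psi_in B X (vscale H c (aone H))"
    by (simp_all add:)
  show "conv_phi B X \<Sigma> t =
     vscale (circ B Q (unit_J B)) c (phi_in B X (aone H))
    \<longleftrightarrow> tlift H H H (\<lambda>x y. amult H x (\<Sigma> y)) t = vscale H c (aone H)"
    unfolding antipode_left_side[OF \<Sigma> t] r
    by (rule inj_on_eq_iff[OF phi_in_inj]) (simp_all add: lift_closed[OF a(1) t])
  show "conv_psi B X \<Sigma> t =
     vscale (circ B (unit_J B) Q') c (psi_in B X (aone H))
    \<longleftrightarrow> tlift H H H (\<lambda>x y. amult H (\<Sigma> x) y) t = vscale H c (aone H)"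
    unfolding antipode_right_side[OF \<Sigma> t] r
    by (rule inj_on_eq_iff[OF psi_in_inj]) (simp_all add: lift_closed[OF a(2) t])
qed

end

section \<open>From Hopf algebras under B to internal groups and back\<close>

lemma bimod_hom_iff:
  assumes "bimod_space B M" "bimod_space B N"
  shows "g \<in> bimod_hom B M N \<longleftrightarrow> bimod_map B M N g \<and> g \<in> extensional (carrier M)"
  using assms bimod_space_vspace[OF assms(1)] bimod_space_vspace[OF assms(2)]
  unfolding bimod_hom_def bimod_map_def by (auto simp: lin_iff_lmap)

lemma bimod_hom_same:
  assumes "same_vs M M'" "lact M = lact M'" "ract M = ract M'" "same_vs N N'" "lact N = lact N'" "ract N = ract N'"
  shows "bimod_hom B M N = bimod_hom B M' N'"
proof -
  have "carrier M = carrier M'" using assms(1) by (simp add: same_vs_def)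
  then show ?thesis using assms by (simp add: bimod_hom_def lin_same[OF assms(1,4)])
qed

lemma same_comon_I: "same_vs (comon_I B) B"
  using same_unit_I[of B] by (simp add: same_vs_def comon_I_def bimod.defs comon.defs)

lemma same_comon_J: "same_vs (comon_J B) kspace"
  using same_unit_J[of B] by (simp add: same_vs_def comon_J_def bimod.defs comon.defs)

lemma same_comon_rev: "same_vs (comon_rev B M) M"
  using same_bimod_rev[of B M] by (simp add: same_vs_def comon_rev_def bimod.defs comon.defs)

lemma comon_hom_bimod:
  "bimod_hom B (comon_circ B M N) L = bimod_hom B (circ B M N) L"
  "bimod_hom B (comon_I B) L = bimod_hom B (unit_I B) L"
  "bimod_hom B L' (comon_bullet B S M N) = bimod_hom B L' (bullet B M N)"
  "bimod_hom B L'' (comon_J B) = bimod_hom B L'' (unit_J B)"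
  by (rule bimod_hom_same; simp add: same_vs_def comon_circ_def comon_I_def comon_bullet_def comon_J_def bimod.defs comon.defs)+

text \<open>A record of its own because the multiplication of \<open>induced_bimon\<close> is a map
  out of the product over \<open>B\<close>, which can be formed only when the actions are given. The
  restrictions make the actions extensional.\<close>

definition induced_bimod ::
  "('k::field, 'b, 'm) alg_scheme \<Rightarrow> ('k, 'a, 'n) alg_scheme \<Rightarrow> ('b \<Rightarrow> 'a) \<Rightarrow> ('k, 'b, 'a) bimod" where
  "induced_bimod B H f = vspace.extend (vspace.truncate H) (bimod.fields
     (\<lambda>b\<in>carrier B. \<lambda>x\<in>carrier H. amult H (f b) x) (\<lambda>x\<in>carrier H. \<lambda>b\<in>carrier B. amult H x (f b)))"

definition induced_bimon ::
  "('k::field, 'b, 'm) alg_scheme \<Rightarrow> ('k, 'a, 'n) bialg_scheme \<Rightarrow> ('b \<Rightarrow> 'a) \<Rightarrow> ('k, 'b, 'a) bimon" where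
  "induced_bimon B H f = (let M = induced_bimod B H f in
     comon.extend (bimod.extend M (comon.fields (bcomult H) (bcounit H)))
       (bimon.fields (olift B M M M (amult H)) f (bcomult H) (bcounit H)))"

text \<open>The product is restricted to the carrier so that it is extensional and a given bialgebra
  can be recovered on the nose. Of the two comonoid structures the first is taken; for internal
  groups the second is shown equal to it.\<close>

definition group_bialg ::
  "('k::field, 'b, 'm) alg_scheme \<Rightarrow> ('k, 'b, 'a, 'n) bimon_scheme \<Rightarrow> ('k, 'a) bialg" where
  "group_bialg B X = alg.extend (vspace.extend (vspace.truncate X) (alg.fields
     (\<lambda>x\<in>carrier X. \<lambda>y\<in>carrier X. hmult X (opure B X X x y)) (hunit X (aone B))))
     (bialg.fields (comult X) (counit X))"

lemma induced_bimon_simps [simp]: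
  "carrier (induced_bimon B H f) = carrier H" "vadd (induced_bimon B H f) = vadd H"
  "vzero (induced_bimon B H f) = vzero H" "vscale (induced_bimon B H f) = vscale H"
  "lact (induced_bimon B H f) = (\<lambda>b\<in>carrier B. \<lambda>x\<in>carrier H. amult H (f b) x)"
  "ract (induced_bimon B H f) = (\<lambda>x\<in>carrier H. \<lambda>b\<in>carrier B. amult H x (f b))"
  "comult (induced_bimon B H f) = bcomult H" "counit (induced_bimon B H f) = bcounit H"
  "hunit (induced_bimon B H f) = f" "hcomult (induced_bimon B H f) = bcomult H"
  "hcounit (induced_bimon B H f) = bcounit H"
  by (simp_all add: induced_bimon_def induced_bimod_def Let_def vspace.defs bimod.defs comon.defs bimon.defs)

lemma same_induced_bimon: "same_vs (induced_bimon B H f) H"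
  by (simp add: same_vs_def)

lemma hmult_induced_bimon:
  "hmult (induced_bimon B H f) = olift B (induced_bimon B H f) (induced_bimon B H f) H (amult H)"
proof -
  let ?M = "induced_bimod B H f" and ?X = "induced_bimon B H f"
  have s: "same_vs ?M ?X" "same_vs ?M H"
    by (simp_all add: same_vs_def induced_bimod_def vspace.defs bimod.defs)
  have "balanced_relations B ?M ?M = balanced_relations B ?X ?X"
    by (simp add: balanced_relations_def) (simp add: induced_bimod_def vspace.defs bimod.defs)
  moreover have "hmult ?X = olift B ?M ?M ?M (amult H)"
    by (simp add: induced_bimon_def Let_def bimod.defs comon.defs bimon.defs)
  ultimately show ?thesis using lift_same[OF s(1) s(1) s(2)] by (simp add: fun_eq_iff)
qed

lemma group_bialg_simps [simp]:
  "carrier (group_bialg B X) = carrier X" "vadd (group_bialg B X) = vadd X"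
  "vzero (group_bialg B X) = vzero X" "vscale (group_bialg B X) = vscale X"
  "amult (group_bialg B X) = (\<lambda>x\<in>carrier X. \<lambda>y\<in>carrier X. hmult X (opure B X X x y))"
  "aone (group_bialg B X) = hunit X (aone B)"
  "bcomult (group_bialg B X) = comult X" "bcounit (group_bialg B X) = counit X"
  by (simp_all add: group_bialg_def vspace.defs alg.defs bialg.defs)

lemma same_group_bialg: "same_vs X (group_bialg B X)"
  by (simp add: same_vs_def)

lemma induced_bimodule_induced_bimon:
  assumes S: "is_triangular B S" and f: "alg_map B H f"
  shows "induced_bimodule B S H (induced_bimon B H f) f"
proof -
  let ?X = "induced_bimon B H f"
  interpret triangular B S using S by unfold_locales
  have H: "is_algebra H" using f by (rule alg_map_algebra)
  note fl = alg_map_lmap[OF f]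
  have fc: "f b \<in> carrier H" if "b \<in> carrier B" for b using fl that by (rule lmap_closed)
  have X: "is_vspace ?X" using H by (simp add: is_vspace_same[OF same_induced_bimon])
  have "bil B H H (\<lambda>b x. amult H (f b) x)" "bil H B H (\<lambda>x b. amult H x (f b))"
    by (intro bilI lmap_amult1 lmap_amult2 lmap_id fl; simp add: H fc)+
  then have "bil B H H (lact ?X)" "bil H B H (ract ?X)"
    by (simp_all add: bil_def cong: lmap_cong_iff)
  then have b: "bil B ?X ?X (lact ?X)" "bil ?X B ?X (ract ?X)"
    using bil_same[OF same_vs_refl same_induced_bimon same_induced_bimon]
      bil_same[OF same_induced_bimon same_vs_refl same_induced_bimon] by blast+
  moreover have "lact ?X \<in> carrier B \<rightarrow>\<^sub>E carrier ?X \<rightarrow>\<^sub>E carrier ?X" "ract ?X \<in> carrier ?X \<rightarrow>\<^sub>E carrier B \<rightarrow>\<^sub>E carrier ?X"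
    using H fc by (simp_all add: restrict_PiE_iff)
  ultimately have "bilinear B ?X ?X (lact ?X)" "bilinear ?X B ?X (ract ?X)"
    using X by (simp_all only: bilinear_iff_bil vspace)
  then have "is_bimodule B ?X"
    unfolding is_bimodule_def using X H fc
    by (simp add: alg_map_mult[OF f] alg_map_one[OF f] amult_assoc)
  then show ?thesis
    using f same_induced_bimon by unfold_locales simp_all
qed

lemma induced_bimonoid_induced_bimon:
  assumes S: "is_triangular B S" and H: "is_bialgebra H" and f: "f \<in> bialg_hom B H"
  shows "induced_bimonoid B S H (induced_bimon B H f) f"
proof -
  let ?X = "induced_bimon B H f"
  interpret triangular B S using S by unfold_locales
  have fa: "alg_map B H f" using f bialgebra H by (rule bialg_hom_alg_map)
  interpret I: induced_bimodule B S H ?X f using S fa by (rule induced_bimodule_induced_bimon)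
  note C = bialgebra_coalgebra[OF H]
  show ?thesis
  proof unfold_locales
    show "lmap (ospace B ?X ?X) ?X (hmult ?X)"
      using lmap_lift[OF I.adm_amult] by (simp add: hmult_induced_bimon)
    show "hmult ?X (opure B ?X ?X x y) = amult H x y" if "x \<in> carrier H" "y \<in> carrier H" for x y
      using lift_pure[OF I.adm_amult] that by (simp add: hmult_induced_bimon)
    show "bimod_map B ?X (bullet B ?X ?X) (comult ?X)"
      by (rule I.bimod_map_bullet) (simp_all add: coalgebra_lmap[OF C] bialg_hom_comult[OF f] bcomult_mult H)
    show "bimod_map B ?X (unit_J B) (counit ?X)"
      by (rule I.bimod_map_J) (simp_all add: coalgebra_lmap[OF C] bialg_hom_counit[OF f] bcounit_mult H)
    show "is_coalgebra ?X (comult ?X) (counit ?X)"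
      using C by (simp add: is_coalgebra_same[OF same_induced_bimon])
  qed
qed

text \<open>The second comonoid structure is taken equal to the first. That \<open>\<Delta>\<close>
  is then a morphism into \<open>X \<bullet> X\<close> is a further use of cocommutativity, and
  hence of \<open>R\<close>.\<close>

lemma hopf_monoid_induced_bimon:
  fixes B :: "('k::field, 'b, 'm) bialg_scheme" and H :: "('k, 'a, 'n) bialg_scheme"
  assumes S: "is_triangular B S" and R: "is_triangular H R" and f: "f \<in> bialg_hom B H"
    and fR: "tmap B B H H f f S = R"
  shows "is_hopf_monoid B S (induced_bimon B H f)"
proof -
  interpret triangular B S using S by unfold_locales
  interpret H: triangular H R using R by unfold_locales
  define X where "X = induced_bimon B H f"
  have sel: "comult X = bcomult H" "counit X = bcounit H" "hcomult X = bcomult H" "hcounit X = bcounit H" "hunit X = f"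
    by (simp_all add: X_def)
  interpret I: induced_bimonoid B S H X f
    unfolding X_def using S H.bialgebra f by (rule induced_bimonoid_induced_bimon)
  have ext: "bcomult H \<in> extensional (carrier H)" "bcounit H \<in> extensional (carrier H)"
    using H.coalgebra unfolding is_coalgebra_def by (auto simp: lin_iff_lmap)
  have fe: "f \<in> extensional (carrier B)"
    using f by (auto simp: bialg_hom_def lin_iff_lmap)
  note fl = I.f_lmap
  have "tflip H H (bcomult H x) = amult (tensor_alg H H) (amult (tensor_alg H H) R (bcomult H x)) (alg_inverse (tensor_alg H H) R)"
    if "x \<in> carrier H" for x
    using R that by (simp add: is_triangular_def is_quasitriangular_def)
  moreover have "alg_inverse (tensor_alg H H) R = tmap B B H H f f (alg_inverse (tensor_alg B B) S)"
    using triangular_image(3)[OF H.hopf f] by (simp add: fR)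
  ultimately have coc: "braiding B S X X (bcomult H x) = bcomult H x" if "x \<in> carrier H" for x
    using that I.braiding_fixed_iff[of "bcomult H x"] by (simp add: fR)
  have hc: "bcomult H \<in> bimod_hom B X (bullet B X X)" and hu: "bcounit H \<in> bimod_hom B X (unit_J B)"
    using I.comult_map I.counit_map ext
    by (simp_all add: sel bimod_hom_iff I.spX bimod_space_bullet bimod_space_unit_J)
  have c1: "is_comon_coc B S X"
    unfolding is_comon_coc_def using I.bim I.coalg hc hu coc by (simp add: sel)
  have hm: "\<forall>t\<in>carrier (ospace B X X). bcomult H (hmult X t) = I.mm (I.Z (I.OD t))"
    using I.hmult_comult by (simp add: sel bcomult_mult)
  have hm': "\<forall>t\<in>carrier (ospace B X X). bcounit H (hmult X t) = mult_J B (omap B X X (unit_J B) (unit_J B) (bcounit H) (bcounit H) t)"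
    using I.hmult_counit by (simp add: sel bcounit_mult)
  have "hmult X \<in> extensional (carrier (circ B X X))"
    using lift_lin[OF I.adm_amult] unfolding X_def hmult_induced_bimon by (simp add: lin_iff_lmap)
  then have c2: "hmult X \<in> comon_hom B (comon_circ B X X) X"
    using I.hmult_bimod_map hm hm' I.same_comon_circ
    unfolding comon_hom_def comon_hom_bimod
    by (simp add: I.tmap_comon_circ bimod_hom_iff I.spX bimod_space_circ[OF I.bim I.bim] I.comult_circ sel same_vs_def)
  have "bimod_map B (unit_I B) X f"
    unfolding bimod_map_def using fl
    by (simp add: bimod_space_unit_I I.spX unit_I_actions I.lact_X I.ract_X alg_map_mult[OF I.fa])
  then have c3: "hunit X \<in> comon_hom B (comon_I B) X"
    using fe same_comon_I[of B]
    unfolding comon_hom_def comon_hom_bimod tmap_same[OF same_comon_I same_comon_I I.same I.same]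
    by (simp add: bimod_hom_iff I.spX bimod_space_unit_I sel same_vs_def bialg_hom_comult[OF f] bialg_hom_counit[OF f])
      (simp add: comon_I_def bimod.defs comon.defs)
  have c4: "hcomult X \<in> comon_hom B X (comon_bullet B S X X)"
    using hc I.comult_bullet_comult coc counit_lift(1)[OF H.coalgebra coalgebra_lmap(2)[OF H.coalgebra]]
    unfolding comon_hom_def comon_hom_bimod by (simp add: sel I.counit_bullet)
  \<comment> \<open>The point is \<open>\<Sum> \<epsilon>(h\<^sub>1) \<otimes> \<epsilon>(h\<^sub>2)
    = \<epsilon>(h) \<otimes> 1\<close>: the second scalar moves across the tensor product of the
    field with itself.\<close>
  have c5: "hcounit X \<in> comon_hom B X (comon_J B)"
  proof -
    have el: "lmap H kspace (bcounit H)" by (rule coalgebra_lmap(2)[OF H.coalgebra])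
    have l1: "lmap kspace (tensor kspace kspace) (\<lambda>k. tpure kspace kspace k (1 :: 'k))"
      by (intro lin_intros) simp_all
    have "tmap H H kspace kspace (bcounit H) (bcounit H) (bcomult H x) = tpure kspace kspace (bcounit H x) 1"
      if x: "x \<in> carrier H" for x
    proof -
      have a: "adm {} H H kspace (\<lambda>y z. bcounit H y * bcounit H z)" by (intro lin_intros el) simp_all
      have "tpure kspace kspace (bcounit H x) (1 :: 'k) =
          tpure kspace kspace (tlift H H kspace (\<lambda>y z. bcounit H y * bcounit H z) (bcomult H x)) 1"
        using counit_lift(1)[OF H.coalgebra el x] by simp
      also have "\<dots> = tlift H H (tensor kspace kspace) (\<lambda>y z. tpure kspace kspace (bcounit H y * bcounit H z) 1) (bcomult H x)"
        by (rule lmap_lift_comm[OF l1 a]) (simp add: x)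
      also have "\<dots> = tmap H H kspace kspace (bcounit H) (bcounit H) (bcomult H x)"
        unfolding tmap_def
      proof (rule lift_cong)
        fix y z
        have "tpure kspace kspace (bcounit H z * bcounit H y) (1 :: 'k) = vscale (tensor kspace kspace) (bcounit H z) (tpure kspace kspace (bcounit H y) 1)"
          using lmap_scale[OF l1, of "bcounit H y" "bcounit H z"] by simp
        moreover have "lmap kspace (tensor kspace kspace) (\<lambda>k. tpure kspace kspace (bcounit H y) (k :: 'k))"
          by (intro lin_intros) simp_all
        from lmap_scale[OF this, of 1 "bcounit H z"]
        have "tpure kspace kspace (bcounit H y) (bcounit H z) = vscale (tensor kspace kspace) (bcounit H z) (tpure kspace kspace (bcounit H y) 1)"
          by simp
        ultimately show "tpure kspace kspace (bcounit H y * bcounit H z) 1 = tpure kspace kspace (bcounit H y) (bcounit H z)"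
          by (simp add: mult.commute)
      qed
      finally show ?thesis by simp
    qed
    then show ?thesis
      using hu unfolding comon_hom_def comon_hom_bimod tmap_same[OF I.same I.same same_comon_J same_comon_J]
      by (simp add: sel) (simp add: comon_J_def bimod.defs comon.defs)
  qed
  have bimon: "is_bimonoid B S X"
    unfolding is_bimonoid_def
    using c1 c2 c3 c4 c5 I.coalg hm hm'
    by (simp add: sel I.hmult_pure I.lact_X I.ract_X amult_assoc bialg_hom_comult[OF f] bialg_hom_counit[OF f]
        tmap_same[OF same_vs_refl same_vs_refl I.same I.same])
  let ?\<Sigma> = "antipode H"
  \<comment> \<open>Writing \<open>S\<close> for both antipodes,
    \<open>S(f(b) x) = S(x) f(S(b))\<close> exchanges left and right actions as the reversed
    bimodule demands, and the flip in \<open>comon_rev\<close> cancels the one in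
    \<open>bcomult_antipode\<close>.\<close>
  have sigma: "?\<Sigma> \<in> comon_hom B X (comon_rev B X)"
  proof -
    have "?\<Sigma> \<in> bimod_hom B X (comon_rev B X)"
      using H.antipode_lin unfolding bimod_hom_def lin_same[OF I.same same_vs_trans[OF same_comon_rev I.same]]
      by (simp add: I.lact_X I.ract_X comon_rev_def bimod_rev_def vspace.defs bimod.defs comon.defs
          H.antipode_mult bialg_hom_antipode[OF f hopf H.hopf])
    moreover have "tflip H H (bcomult H (?\<Sigma> x)) = tmap H H H H ?\<Sigma> ?\<Sigma> (bcomult H x)" if x: "x \<in> carrier H" for x
    proof -
      have a: "adm {} H H (tensor H H) (\<lambda>a b. tpure H H (?\<Sigma> b) (?\<Sigma> a))" by (intro lin_intros) simp_all
      show ?thesis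
        unfolding H.bcomult_antipode[OF x] lmap_lift_comm[OF lmap_tflip[OF H.vspace H.vspace] a bcomult_closed[OF H.bialgebra x]] tmap_def
        by (rule lift_cong) (simp add: tflip_pure)
    qed
    ultimately show ?thesis
      unfolding comon_hom_def tmap_same[OF I.same I.same same_vs_trans[OF same_comon_rev I.same] same_vs_trans[OF same_comon_rev I.same]]
      by (simp add: sel comon_rev_def bimod.defs comon.defs) (simp add: H.bcounit_antipode compose_eq I.same_to_H)
  qed
  show ?thesis
    unfolding X_def[symmetric] is_hopf_monoid_def
  proof (intro conjI bimon bexI[OF _ sigma] ballI)
    fix h assume h: "h \<in> carrier X"
    note eqs = I.antipode_equations_iff[OF H.antipode_lmap, of "bcomult H h" "bcounit H h"]
    show "conv_phi B X ?\<Sigma> (hcomult X h)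
        = vscale (circ B (bullet B X (unit_I B)) (unit_J B)) (hcounit X h)
            (phi_in B X (hunit X (aone B)))"
      using h eqs(1) H.antipode_right by (simp only: sel bialg_hom_one[OF f] I.carrier_X bcomult_closed[OF H.bialgebra])
    show "conv_psi B X ?\<Sigma> (hcomult X h)
        = vscale (circ B (unit_J B) (bullet B (unit_I B) X)) (hcounit X h)
            (psi_in B X (hunit X (aone B)))"
      using h eqs(2) H.antipode_left by (simp only: sel bialg_hom_one[OF f] I.carrier_X bcomult_closed[OF H.bialgebra])
  qed
qed

text \<open>With \<open>u\<close> for \<open>hunit\<close>, the laws of a monoid for
  \<open>\<circ>\<close> read on pure tensors are associativity, \<open>u(b) x = b x\<close> and
  \<open>x u(b) = x b\<close>. At \<open>b = 1\<close> they give the unit of an algebra; for general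
  \<open>b\<close> they say that both actions come from \<open>u\<close>.\<close>

lemma bimonoid_induced_bimonoid:
  assumes S: "is_triangular B S" and X: "is_bimonoid B S X"
  shows "induced_bimonoid B S (group_bialg B X) X (hunit X)"
proof -
  interpret triangular B S using S by unfold_locales
  let ?H = "group_bialg B X" and ?f = "hunit X"
  have coc: "is_comon_coc B S X" and m: "hmult X \<in> comon_hom B (comon_circ B X X) X"
    and u: "?f \<in> comon_hom B (comon_I B) X"
    using X unfolding is_bimonoid_def by blast+
  have assoc: "hmult X (opure B X X (hmult X (opure B X X x y)) z) = hmult X (opure B X X x (hmult X (opure B X X y z)))"
    if "x \<in> carrier X" "y \<in> carrier X" "z \<in> carrier X" for x y z
    using X that unfolding is_bimonoid_def by blast
  have unit: "hmult X (opure B X X (?f b) x) = lact X b x" "hmult X (opure B X X x (?f b)) = ract X x b"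
    if "b \<in> carrier B" "x \<in> carrier X" for b x
    using X that unfolding is_bimonoid_def by blast+
  have bim: "is_bimodule B X" using coc by (simp add: is_comon_coc_def)
  note sp = bimodule_space[OF bim algebra]
  have Xv [simp]: "is_vspace X" by (rule bimod_space_vspace[OF sp])
  have mm: "bimod_map B (circ B X X) X (hmult X)"
    using m unfolding comon_hom_def comon_hom_bimod by (simp add: bimod_hom_iff sp bimod_space_circ[OF bim bim])
  have uu: "bimod_map B (unit_I B) X ?f"
    using u unfolding comon_hom_def comon_hom_bimod by (simp add: bimod_hom_iff sp bimod_space_unit_I)
  have ml: "lmap (ospace B X X) X (hmult X)" using bimod_mapD(3)[OF mm] by simp
  have ul: "lmap B X ?f" using bimod_mapD(3)[OF uu] by simp
  have uc: "?f b \<in> carrier X" if "b \<in> carrier B" for b using ul that by (rule lmap_closed)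
  have mc: "hmult X (opure B X X x y) \<in> carrier X" if "x \<in> carrier X" "y \<in> carrier X" for x y
    using ml by (rule lmap_closed) (simp add: that)
  have Hv: "is_vspace ?H" using is_vspace_same[OF same_group_bialg[of X B]] by simp
  have H: "is_algebra ?H"
  proof -
    have "bil X X X (\<lambda>x y. hmult X (opure B X X x y))"
      by (intro bilI lmap_comp[OF ml] lin_intros) simp_all
    then have "bil X X X (amult ?H)" by (simp add: bil_def cong: lmap_cong_iff)
    then have "bil ?H ?H ?H (amult ?H)"
      using bil_same[OF same_group_bialg same_group_bialg same_group_bialg] by blast
    moreover have "amult ?H \<in> carrier ?H \<rightarrow>\<^sub>E carrier ?H \<rightarrow>\<^sub>E carrier ?H"
      using mc by (simp add: restrict_PiE_iff)
    ultimately have "bilinear ?H ?H ?H (amult ?H)" by (simp only: bilinear_iff_bil[OF Hv Hv Hv])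
    moreover have "lact X (aone B) x = x" "ract X x (aone B) = x" if "x \<in> carrier X" for x
      using bim that unfolding is_bimodule_def by blast+
    moreover have "amult ?H (amult ?H x y) z = amult ?H x (amult ?H y z)"
      if "x \<in> carrier X" "y \<in> carrier X" "z \<in> carrier X" for x y z
      using that mc assoc[OF that] by simp
    moreover have "amult ?H (aone ?H) x = x" "amult ?H x (aone ?H) = x" if "x \<in> carrier X" for x
      using that calculation(2,3)[OF that] unit[of "aone B" x] uc[of "aone B"] by simp_all
    moreover have "aone ?H \<in> carrier ?H" using uc by simp
    ultimately show ?thesis
      unfolding is_algebra_def group_bialg_simps(1) using Hv by blast
  qed
  have lmapH: "lmap B ?H ?f" using ul lmap_same[OF same_vs_refl same_group_bialg] by blast
  \<comment> \<open>As \<open>hunit\<close> is left linear on the unit object \<open>B\<close>,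
    \<open>u(a b) = a u(b) = u(a) u(b)\<close>.\<close>
  have fa: "alg_map B ?H ?f"
    unfolding alg_map_def using H lmapH uc unit(1) bimod_mapD(4)[OF uu] by (simp add: unit_I_actions)
  show ?thesis
  proof unfold_locales
    show "bimod_map B X (bullet B X X) (comult X)" "bimod_map B X (unit_J B) (counit X)"
      using coc by (simp_all add: is_comon_coc_def bimod_map_of_hom sp bimod_space_bullet bimod_space_unit_J)
    show "is_coalgebra X (comult X) (counit X)" using coc by (simp add: is_comon_coc_def)
  qed (use same_group_bialg bim fa uc unit ml in simp_all)
qed

text \<open>The two comonoid structures are identified before the antipode is treated, since the
  antipode axioms of a Hopf monoid are stated with \<open>hcomult\<close> and those of the bialgebra
  with \<open>comult\<close>.\<close>

lemma hopf_monoid_group_bialg: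
  assumes S: "is_triangular B S" and X: "is_hopf_monoid B S X"
  shows "induced_bimonoid B S (group_bialg B X) X (hunit X)"
    and "hcomult X = comult X" and "hcounit X = counit X"
    and "is_hopf_algebra (group_bialg B X)" and "hunit X \<in> bialg_hom B (group_bialg B X)"
    and "is_triangular (group_bialg B X) (tmap B B (group_bialg B X) (group_bialg B X) (hunit X) (hunit X) S)"
proof -
  interpret triangular B S using S by unfold_locales
  let ?H = "group_bialg B X" and ?f = "hunit X"
  have bimon: "is_bimonoid B S X" using X by (simp add: is_hopf_monoid_def)
  show I: "induced_bimonoid B S ?H X ?f" using S bimon by (rule bimonoid_induced_bimonoid)
  then interpret I: induced_bimonoid B S ?H X ?f .
  \<comment> \<open>Here \<open>H\<close> is itself built from \<open>X\<close>, so rewriting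
    \<open>carrier X\<close> to the carrier of \<open>H\<close> would loop with the simplification
    rules of \<open>group_bialg\<close>.\<close>
  note [simp del] = I.carrier_X I.vscale_X
  have coc: "is_comon_coc B S X" and m: "hmult X \<in> comon_hom B (comon_circ B X X) X"
    and u: "?f \<in> comon_hom B (comon_I B) X" and c: "hcomult X \<in> comon_hom B X (comon_bullet B S X X)"
    and e: "hcounit X \<in> comon_hom B X (comon_J B)" and hco: "is_coalgebra X (hcomult X) (hcounit X)"
    using bimon unfolding is_bimonoid_def by blast+
  \<comment> \<open>\<open>hcounit\<close> preserves counits and the counit of \<open>J\<close> is
    the identity, so it equals the counit of \<open>X\<close>.\<close>
  have he: "hcounit X x = counit X x" if "x \<in> carrier X" for x
  proof -
    have "counit (comon_J B) (hcounit X x) = counit X x" using e that unfolding comon_hom_def by blast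
    then show ?thesis by (simp add: comon_J_def bimod.defs comon.defs)
  qed
  have hd: "hcomult X x = comult X x" if "x \<in> carrier X" for x
    using I.hcomult_eq_comult[OF c hco] he that by simp
  have ext: "hcomult X \<in> extensional (carrier X)" "comult X \<in> extensional (carrier X)"
    "hcounit X \<in> extensional (carrier X)" "counit X \<in> extensional (carrier X)"
    using hco I.coalg unfolding is_coalgebra_def by (auto simp: lin_iff_lmap)
  show hd': "hcomult X = comult X" by (rule extensionalityI[OF ext(1,2)]) (rule hd)
  show he': "hcounit X = counit X" by (rule extensionalityI[OF ext(3,4)]) (rule he)
  \<comment> \<open>That \<open>hmult\<close> is a morphism of comonoids is evaluated at
    \<open>x \<circ> y\<close>; by \<open>mm_zeta\<close> the result is a product of
    coproducts.\<close>
  have comult_mult: "comult X (amult ?H x y) = amult (tensor_alg ?H ?H) (comult X x) (comult X y)"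
    and counit_mult: "counit X (amult ?H x y) = counit X x * counit X y"
    if xy: "x \<in> carrier X" "y \<in> carrier X" for x y
  proof -
    let ?t = "opure B X X x y"
    have t: "?t \<in> carrier (ospace B X X)" using xy by simp
    then have t': "?t \<in> carrier (comon_circ B X X)" using I.same_comon_circ by (simp add: same_vs_def)
    have xy': "x \<in> carrier ?H" "y \<in> carrier ?H" using xy by simp_all
    have m1: "comult X (hmult X ?t) = tmap (comon_circ B X X) (comon_circ B X X) X X (hmult X) (hmult X) (comult (comon_circ B X X) ?t)"
      "counit X (hmult X ?t) = counit (comon_circ B X X) ?t"
      using m t' unfolding comon_hom_def by blast+
    show "comult X (amult ?H x y) = amult (tensor_alg ?H ?H) (comult X x) (comult X y)"
      using m1(1) I.mm_comult_circ_pure[OF xy'] I.hmult_pure[OF xy']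
      unfolding I.tmap_comon_circ I.comult_circ(1)[OF t] by simp
    show "counit X (amult ?H x y) = counit X x * counit X y"
      using m1(2) I.counit_circ_pure[OF xy'] I.hmult_pure[OF xy'] unfolding I.comult_circ(2)[OF t] by simp
  qed
  have fcomult: "comult X (?f b) = tmap B B ?H ?H ?f ?f (bcomult B b)" "counit X (?f b) = bcounit B b"
    if b: "b \<in> carrier B" for b
  proof -
    have b': "b \<in> carrier (comon_I B)" using b same_comon_I[of B] by (simp add: same_vs_def)
    have "comult X (?f b) = tmap (comon_I B) (comon_I B) X X ?f ?f (comult (comon_I B) b)"
      "counit X (?f b) = counit (comon_I B) b"
      using u b' unfolding comon_hom_def by blast+
    then show "comult X (?f b) = tmap B B ?H ?H ?f ?f (bcomult B b)" "counit X (?f b) = bcounit B b"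
      unfolding tmap_same[OF same_comon_I same_comon_I I.same I.same]
      by (simp_all add: comon_I_def bimod.defs comon.defs)
  qed
  have one: "aone ?H = ?f (aone B)" by simp
  have bialg: "is_bialgebra ?H"
    unfolding is_bialgebra_def
  proof (intro conjI ballI)
    show "is_algebra ?H" by (rule I.H_algebra)
    show "is_coalgebra ?H (bcomult ?H) (bcounit ?H)" using I.coalg_H by simp
    show "bcomult ?H (aone ?H) = aone (tensor_alg ?H ?H)"
      unfolding one using fcomult(1)[of "aone B"]
      by (simp only: group_bialg_simps(7) tensor_alg_simps(5) one bcomult_one[OF bialgebra] aone_closed[OF algebra]
          tmap_pure[OF I.f_lmap I.f_lmap])
    show "bcounit ?H (aone ?H) = 1"
      unfolding one using fcomult(2)[of "aone B"] by (simp add: bcounit_one)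
  qed (use comult_mult counit_mult in \<open>simp_all only: group_bialg_simps(1,7,8)\<close>)
  have "?f \<in> extensional (carrier B)"
    using u same_comon_I[of B] unfolding comon_hom_def bimod_hom_def lin_def by (auto simp: PiE_iff same_vs_def)
  then have fh: "?f \<in> lin B ?H" using I.f_lmap by (simp add: lin_iff_lmap)
  show f: "?f \<in> bialg_hom B ?H"
    unfolding bialg_hom_def using fh alg_map_mult[OF I.fa] alg_map_one[OF I.fa] fcomult
    by (simp only: mem_Collect_eq group_bialg_simps(7,8)) blast
  from X obtain \<Sigma> where Sig: "\<Sigma> \<in> comon_hom B X (comon_rev B X)"
    and eqs: "\<And>h. h \<in> carrier X \<Longrightarrow>
        conv_phi B X \<Sigma> (hcomult X h)
        = vscale (circ B (bullet B X (unit_I B)) (unit_J B)) (hcounit X h)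
            (phi_in B X (hunit X (aone B)))"
      "\<And>h. h \<in> carrier X \<Longrightarrow>
        conv_psi B X \<Sigma> (hcomult X h)
        = vscale (circ B (unit_J B) (bullet B (unit_I B) X)) (hcounit X h)
            (psi_in B X (hunit X (aone B)))"
    unfolding is_hopf_monoid_def by blast
  have Sl: "\<Sigma> \<in> lin ?H ?H"
    using Sig unfolding comon_hom_def bimod_hom_def lin_same[OF I.same same_vs_trans[OF same_comon_rev I.same]] by blast
  then have Sl': "lmap ?H ?H \<Sigma>" using I.H_vspace by (simp only: lin_iff_lmap)
  have "is_antipode ?H \<Sigma>"
    unfolding is_antipode_def
  proof (intro conjI Sl ballI)
    fix x assume x: "x \<in> carrier ?H"
    then have x': "x \<in> carrier X" by simp
    note iff = I.antipode_equations_iff[OF Sl' I.\<Delta>_closed[OF x], of "counit X x"]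
    show "tlift ?H ?H ?H (\<lambda>y z. amult ?H (\<Sigma> y) z) (bcomult ?H x) = vscale ?H (bcounit ?H x) (aone ?H)"
      using eqs(2)[OF x'] iff(2) unfolding hd' he' one group_bialg_simps(7,8) by blast
    show "tlift ?H ?H ?H (\<lambda>y z. amult ?H y (\<Sigma> z)) (bcomult ?H x) = vscale ?H (bcounit ?H x) (aone ?H)"
      using eqs(1)[OF x'] iff(1) unfolding hd' he' one group_bialg_simps(7,8) by blast
  qed
  then show hopfH: "is_hopf_algebra ?H" using bialg by (auto simp: is_hopf_algebra_def)
  show "is_triangular ?H (tmap B B ?H ?H ?f ?f S)"
  proof (rule triangular_image(6)[OF hopfH f])
    fix x assume x: "x \<in> carrier ?H"
    then have "braiding B S X X (comult X x) = comult X x" using coc by (simp add: is_comon_coc_def)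
    then show "tflip ?H ?H (bcomult ?H x) = amult (tensor_alg ?H ?H) (amult (tensor_alg ?H ?H) (tmap B B ?H ?H ?f ?f S) (bcomult ?H x))
        (tmap B B ?H ?H ?f ?f S')"
      using I.braiding_fixed_iff[OF I.\<Delta>_closed[OF x]] by (simp only: group_bialg_simps(7))
  qed
qed

lemma restrict_curried_eq:
  assumes "h \<in> extensional A" "\<And>x. x \<in> A \<Longrightarrow> h x \<in> extensional A'"
    and "\<And>x y. x \<in> A \<Longrightarrow> y \<in> A' \<Longrightarrow> g x y = h x y"
  shows "(\<lambda>x\<in>A. \<lambda>y\<in>A'. g x y) = h"
proof (rule extensionalityI[OF restrict_extensional assms(1)])
  fix x assume "x \<in> A"
  moreover from this have "(\<lambda>y\<in>A'. g x y) = h x"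
    by (intro extensionalityI[OF restrict_extensional assms(2)]) (simp_all add: assms(3))
  ultimately show "(\<lambda>x\<in>A. \<lambda>y\<in>A'. g x y) x = h x" by simp
qed

text \<open>Equality of records, field by field: the actions are recovered from the unit laws,
  \<open>hmult\<close> from its values on pure tensors, the second comonoid structure from the
  Eckmann--Hilton argument. Extensionality upgrades agreement on carriers to equality.\<close>

lemma induced_bimon_group_bialg:
  assumes S: "is_triangular B S" and X: "is_hopf_monoid B S X"
  shows "induced_bimon B (group_bialg B X) (hunit X) = (X :: ('k::field, 'b, 'a) bimon)"
proof -
  let ?H = "group_bialg B X" and ?f = "hunit X"
  let ?Y = "induced_bimon B ?H ?f"
  note hm = hopf_monoid_group_bialg[OF S X]
  interpret I: induced_bimonoid B S ?H X ?f by (rule hm(1))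
  note [simp del] = I.carrier_X I.vscale_X
  have bil: "bilinear B X X (lact X)" "bilinear X B X (ract X)" using I.bim unfolding is_bimodule_def by blast+
  then have pi: "lact X \<in> carrier B \<rightarrow>\<^sub>E carrier X \<rightarrow>\<^sub>E carrier X" "ract X \<in> carrier X \<rightarrow>\<^sub>E carrier B \<rightarrow>\<^sub>E carrier X"
    unfolding bilinear_def by blast+
  have ext: "lact X \<in> extensional (carrier B)" "ract X \<in> extensional (carrier X)"
    "\<And>b. b \<in> carrier B \<Longrightarrow> lact X b \<in> extensional (carrier X)"
    "\<And>x. x \<in> carrier X \<Longrightarrow> ract X x \<in> extensional (carrier B)"
    using pi by (simp_all add: PiE_iff)
  have act: "amult ?H (?f b) x = lact X b x" "amult ?H x (?f b) = ract X x b" if "b \<in> carrier B" "x \<in> carrier X" for b x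
    using that I.lact_X[of b x] I.ract_X[of b x] unfolding group_bialg_simps(1) by (simp_all only: simp_thms)
  have l: "lact ?Y = lact X" and r: "ract ?Y = ract X"
    unfolding induced_bimon_simps group_bialg_simps(1)
    by (intro restrict_curried_eq ext act; assumption)+
  \<comment> \<open>Equal actions give equal relations, so both records define the same product over
    \<open>B\<close> and their multiplications can be compared.\<close>
  have bal: "balanced_relations B ?Y ?Y = balanced_relations B X X"
    unfolding balanced_relations_def l r by simp
  have m: "hmult ?Y = hmult X"
  proof (rule extensionalityI[of _ "carrier (ospace B X X)"])
    have eq: "hmult ?Y = olift B X X ?H (amult ?H)"
      unfolding hmult_induced_bimon bal
      by (intro lift_same same_vs_refl same_vs_trans[OF same_induced_bimon same_vs_sym[OF I.same]])
    show "hmult ?Y \<in> extensional (carrier (ospace B X X))"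
      using lift_lin[OF I.adm_amult] I.H_vspace unfolding eq by (simp only: lin_iff_lmap is_vspace_tspace)
    have "is_bimonoid B S X" using X by (simp add: is_hopf_monoid_def)
    then have "hmult X \<in> comon_hom B (comon_circ B X X) X" unfolding is_bimonoid_def by blast
    then show "hmult X \<in> extensional (carrier (ospace B X X))"
      unfolding comon_hom_def bimod_hom_def lin_same[OF I.same_comon_circ same_vs_refl] by (simp add: lin_def PiE_iff)
    fix t assume t: "t \<in> carrier (ospace B X X)"
    have "lmap (ospace B X X) ?H (hmult X)" using I.hmult_lmap I.lmap_X(2) by blast
    then show "hmult ?Y t = hmult X t"
      unfolding eq by (rule lift_eqI[OF I.adm_amult _ t]) (simp only: I.hmult_pure group_bialg_simps(1))
  qed
  show ?thesis
    by (rule bimon.equality) (use l r m hm(2,3) in \<open>simp_all only: induced_bimon_simps group_bialg_simps\<close>, simp_all)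
qed

lemma group_bialg_induced_bimon:
  assumes S: "is_triangular B S" and H: "is_bialgebra H" and f: "f \<in> bialg_hom B H"
  shows "group_bialg B (induced_bimon B H f) = (H :: ('k::field, 'a) bialg)"
proof -
  let ?X = "induced_bimon B H f"
  interpret I: induced_bimonoid B S H ?X f using S H f by (rule induced_bimonoid_induced_bimon)
  have "bilinear H H H (amult H)" using bialgebra_algebra[OF H] unfolding is_algebra_def by blast
  then have pi: "amult H \<in> carrier H \<rightarrow>\<^sub>E carrier H \<rightarrow>\<^sub>E carrier H" unfolding bilinear_def by blast
  have ext: "amult H \<in> extensional (carrier H)" "\<And>x. x \<in> carrier H \<Longrightarrow> amult H x \<in> extensional (carrier H)"
    using pi by (simp_all add: PiE_iff)
  have m: "amult (group_bialg B ?X) = amult H"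
    unfolding group_bialg_simps induced_bimon_simps
    by (intro restrict_curried_eq ext I.hmult_pure; assumption)
  show ?thesis
    by (rule bialg.equality) (use m bialg_hom_one[OF f] in \<open>simp_all only: induced_bimon_simps group_bialg_simps\<close>, simp_all)
qed

text \<open>Preservation of \<open>hunit\<close> is the condition \<open>h f = g\<close> of the
  coslice. Given it, multiplicativity yields \<open>h(f(b) x) = g(b) h(x)\<close> and its mirror
  image, that is, linearity for the induced actions.\<close>

lemma bimonoid_hom_eq:
  assumes X: "induced_bimonoid B S H X f" and Y: "induced_bimonoid B S K Y g"
    and HK: "is_bialgebra H" "is_bialgebra K"
    and selX: "comult X = bcomult H" "counit X = bcounit H" "hcomult X = bcomult H" "hcounit X = bcounit H" "hunit X = f"
    and selY: "comult Y = bcomult K" "counit Y = bcounit K" "hcomult Y = bcomult K" "hcounit Y = bcounit K" "hunit Y = g"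
    and fe: "f \<in> extensional (carrier B)" "g \<in> extensional (carrier B)"
  shows "bimonoid_hom B X Y = {h \<in> bialg_hom H K. compose (carrier B) h f = g}"
proof -
  interpret X: induced_bimonoid B S H X f by (rule X)
  interpret Y: induced_bimonoid B S K Y g by (rule Y)
  have tm: "tmap X X Y Y h h = tmap H H K K h h" for h
    by (rule tmap_same[OF X.same X.same Y.same Y.same])
  have lin: "lin X Y = lin H K" by (rule lin_same[OF X.same Y.same])
  have pc: "compose (carrier B) h f = g \<longleftrightarrow> (\<forall>b\<in>carrier B. h (f b) = g b)" for h
  proof
    assume "\<forall>b\<in>carrier B. h (f b) = g b"
    then show "compose (carrier B) h f = g"
      by (intro extensionalityI[of _ "carrier B"]) (simp_all add: compose_eq fe)
  next
    assume c: "compose (carrier B) h f = g"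
    show "\<forall>b\<in>carrier B. h (f b) = g b" by (simp add: compose_eq flip: c)
  qed
  have bm: "bimod_map B X Y h" if "h \<in> bimod_hom B X Y" for h
    using that by (rule X.bimod_map_of_hom[OF _ X.spX Y.spX])
  show ?thesis
  proof (intro equalityI subsetI)
    fix h assume h: "h \<in> bimonoid_hom B X Y"
    then have hb: "h \<in> bimod_hom B X Y" and hu: "\<forall>b\<in>carrier B. h (f b) = g b"
      and hm: "\<forall>t\<in>carrier (circ B X X). h (hmult X t) = hmult Y (omap B X X Y Y h h t)"
      and hc: "\<forall>x\<in>carrier H. bcomult K (h x) = tmap H H K K h h (bcomult H x) \<and> bcounit K (h x) = bcounit H x"
      unfolding bimonoid_hom_def comon_hom_def tm using selX selY by simp_all
    have hl: "h \<in> lin H K" using hb lin by (simp add: bimod_hom_def)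
    then have hlm: "lmap H K h" by (simp add: lin_iff_lmap)
    have "h (amult H x y) = amult K (h x) (h y)" if xy: "x \<in> carrier H" "y \<in> carrier H" for x y
    proof -
      have "opure B X X x y \<in> carrier (circ B X X)" using xy by simp
      then have "h (hmult X (opure B X X x y)) = hmult Y (omap B X X Y Y h h (opure B X X x y))" using hm by blast
      then show ?thesis
        using xy by (simp add: X.hmult_pure Y.hmult_pure X.omap_pure[OF bm[OF hb] bm[OF hb]] lmap_closed[OF hlm])
    qed
    moreover have "h (aone H) = aone K"
      using bspec[OF hu aone_closed[OF X.algebra]] by (simp add: alg_map_one[OF X.fa] alg_map_one[OF Y.fa])
    ultimately show "h \<in> {h \<in> bialg_hom H K. compose (carrier B) h f = g}"
      using hl hc hu by (simp add: bialg_hom_def pc)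
  next
    fix h assume "h \<in> {h \<in> bialg_hom H K. compose (carrier B) h f = g}"
    then have h: "h \<in> bialg_hom H K" and hu: "\<forall>b\<in>carrier B. h (f b) = g b" by (auto simp: pc)
    have hl: "h \<in> lin H K" using h by (simp add: bialg_hom_def)
    then have hlm: "lmap H K h" by (simp add: lin_iff_lmap)
    have hb: "h \<in> bimod_hom B X Y"
      unfolding bimod_hom_def lin using hl hu
      by (simp add: X.lact_X X.ract_X Y.lact_X Y.ract_X lmap_closed[OF hlm] bialg_hom_mult[OF h])
    note b = bm[OF hb]
    have "\<forall>t\<in>carrier (ospace B X X). h (hmult X t) = hmult Y (omap B X X Y Y h h t)"
    proof (rule tspace_eqI[where U = K])
      have "lmap (ospace B X X) H (hmult X)" using X.hmult_lmap by simp
      then show "lmap (ospace B X X) K (\<lambda>t. h (hmult X t))" by (rule lmap_comp[OF hlm])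
      have "lmap (ospace B Y Y) K (hmult Y)" using Y.hmult_lmap by simp
      then show "lmap (ospace B X X) K (\<lambda>t. hmult Y (omap B X X Y Y h h t))"
        by (rule lmap_comp[OF _ X.lmap_omap[OF b b]])
    qed (simp add: X.hmult_pure Y.hmult_pure X.omap_pure[OF b b] lmap_closed[OF hlm] bialg_hom_mult[OF h])
    then show "h \<in> bimonoid_hom B X Y"
      using hb hu unfolding bimonoid_hom_def comon_hom_def tm
      by (simp add: selX selY bialg_hom_comult[OF h] bialg_hom_counit[OF h])
  qed
qed


section \<open>The isomorphism of categories\<close>

lemma is_category_coslice:
  assumes C: "is_category C" and A: "A \<in> Obj C"
  shows "is_category (coslice C A)"
  using assms unfolding is_category_def coslice_def by (auto simp: split_beta)

text \<open>Both functors are the identity on arrows, and the category laws of \<open>D\<close> are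
  pulled back along \<open>G\<close>; the laws for internal groups thus come from those of Hopf
  algebras.\<close>

lemma isomorphic_categories_transport:
  assumes C: "is_category C"
    and G: "\<And>X. X \<in> Obj D \<Longrightarrow> G X \<in> Obj C" and F: "\<And>Y. Y \<in> Obj C \<Longrightarrow> F Y \<in> Obj D"
    and GF: "\<And>Y. Y \<in> Obj C \<Longrightarrow> G (F Y) = Y" and FG: "\<And>X. X \<in> Obj D \<Longrightarrow> F (G X) = X"
    and hom: "\<And>X Y. X \<in> Obj D \<Longrightarrow> Y \<in> Obj D \<Longrightarrow> Hom D X Y = Hom C (G X) (G Y)"
    and id: "\<And>X. X \<in> Obj D \<Longrightarrow> Id D X = Id C (G X)"
    and comp: "\<And>X Y Z. X \<in> Obj D \<Longrightarrow> Y \<in> Obj D \<Longrightarrow> Z \<in> Obj D \<Longrightarrow> Comp D X Y Z = Comp C (G X) (G Y) (G Z)"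
  shows "isomorphic_categories C D"
proof -
  have "is_category D"
    using C unfolding is_category_def by (simp add: hom id comp G)
  moreover have "is_functor C D F (\<lambda>_ _ f. f)"
    unfolding is_functor_def by (simp add: F hom id comp GF)
  moreover have "is_functor D C G (\<lambda>_ _ f. f)"
    unfolding is_functor_def by (simp add: G hom id comp)
  ultimately show ?thesis
    unfolding isomorphic_categories_def using C GF FG
    by (intro conjI exI[of _ F] exI[of _ "\<lambda>_ _ f. f"] exI[of _ G]) simp_all
qed

lemma is_category_TrHopf: "is_category (TrHopf :: (('k::field, 'a) bialg \<times> ('k, 'a, 'a) tens, 'a \<Rightarrow> 'a) precategory)"
proof -
  have bi: "is_bialgebra H" if "is_triangular H R" for H :: "('k, 'a) bialg" and R
    using triangular_hopf[OF that] by (simp add: is_hopf_algebra_def)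
  have cl: "R \<in> carrier (tensor H H)" if "is_triangular H R" for H :: "('k, 'a) bialg" and R
    using triangular_invertible[OF that] by (simp add: alg_invertible_def)
  have id: "(\<lambda>x\<in>carrier H. x) \<in> bialg_hom H H" "tmap H H H H (\<lambda>x\<in>carrier H. x) (\<lambda>x\<in>carrier H. x) R = R"
    if R: "is_triangular H R" for H :: "('k, 'a) bialg" and R
    using bialg_hom_id[OF bi[OF R]] tmap_id[OF cl[OF R]]
      tmap_cong[of H "\<lambda>x\<in>carrier H. x" "\<lambda>x. x" H "\<lambda>x\<in>carrier H. x" "\<lambda>x. x" H H R] by simp_all
  have comp: "compose (carrier A) g f \<in> bialg_hom A K \<and> tmap A A K K (compose (carrier A) g f) (compose (carrier A) g f) P =
      tmap H H K K g g (tmap A A H H f f P)"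
    if "is_triangular A P" "is_triangular H R" "is_triangular K Q" "f \<in> bialg_hom A H" "g \<in> bialg_hom H K"
    for A H K :: "('k, 'a) bialg" and P R Q f g
    using that bialg_hom_compose[of f A H g K] tmap_compose[of A H f K g P] bialg_hom_lmap[of f A H] bialg_hom_lmap[of g H K]
    by (simp add: bi cl)
  have ext: "f \<in> extensional (carrier A)" "\<And>x. x \<in> carrier A \<Longrightarrow> f x \<in> carrier H" if "f \<in> bialg_hom A H" for A H :: "('k, 'a) bialg" and f
    using that by (auto simp: bialg_hom_def lin_def PiE_iff)
  have unit: "compose (carrier A) f (\<lambda>x\<in>carrier A. x) = f" "compose (carrier A) (\<lambda>x\<in>carrier H. x) f = f"
    if "f \<in> bialg_hom A H" for A H :: "('k, 'a) bialg" and f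
    using ext[OF that] by (intro extensionalityI[of _ "carrier A"]; simp add: compose_eq)+
  have assoc: "compose (carrier A) h (compose (carrier A) g f) = compose (carrier A) (compose (carrier H) h g) f"
    if "f \<in> bialg_hom A H" for A H :: "('k, 'a) bialg" and f g h
    using ext[OF that] by (intro extensionalityI[of _ "carrier A"]; simp add: compose_eq)
  show ?thesis
    unfolding is_category_def TrHopf_def
    by (auto simp: id unit comp intro: assoc)
qed

theorem corollary4p19:
  fixes B :: "('k::field, 'a) bialg" and S :: "('k, 'a, 'a) tens"
  assumes "is_triangular B S"
  shows "isomorphic_categories
    (coslice (TrHopf :: (('k, 'a) bialg \<times> ('k, 'a, 'a) tens, 'a \<Rightarrow> 'a) precategory) (B, S))
    (Grp_Comon_coc B S :: (('k, 'a, 'a) bimon, 'a \<Rightarrow> 'a) precategory)"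
proof (rule isomorphic_categories_transport)
  let ?C = "coslice (TrHopf :: (('k, 'a) bialg \<times> ('k, 'a, 'a) tens, 'a \<Rightarrow> 'a) precategory) (B, S)"
  let ?D = "Grp_Comon_coc B S :: (('k, 'a, 'a) bimon, 'a \<Rightarrow> 'a) precategory"
  \<comment> \<open>An arrow out of \<open>(B, S)\<close> preserves the triangular structures, which
    forces \<open>R = (f \<otimes> f)(S)\<close>. So \<open>R\<close> carries no information of its
    own, and \<open>F\<close> may forget it.\<close>
  define G where "G = (\<lambda>X :: ('k, 'a, 'a) bimon.
    ((group_bialg B X, tmap B B (group_bialg B X) (group_bialg B X) (hunit X) (hunit X) S), hunit X))"
  define F where "F = (\<lambda>((H :: ('k, 'a) bialg, R :: ('k, 'a, 'a) tens), f). induced_bimon B H f)"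
  interpret triangular B S using assms by unfold_locales
  have objC: "((H, R), f) \<in> Obj ?C \<longleftrightarrow> is_triangular H R \<and> f \<in> bialg_hom B H \<and> tmap B B H H f f S = R" for H R f
    by (auto simp: coslice_def TrHopf_def)
  have objD: "X \<in> Obj ?D \<longleftrightarrow> is_hopf_monoid B S X" for X
    by (simp add: Grp_Comon_coc_def)
  show "is_category ?C"
    by (rule is_category_coslice[OF is_category_TrHopf]) (simp add: TrHopf_def assms)
  show "G X \<in> Obj ?C" if "X \<in> Obj ?D" for X
    using that hopf_monoid_group_bialg[OF assms, of X] unfolding objD G_def objC by blast
  show "F Y \<in> Obj ?D" if "Y \<in> Obj ?C" for Y
  proof -
    obtain H R f where Y: "Y = ((H, R), f)" by (metis surj_pair)
    show ?thesis using that hopf_monoid_induced_bimon[OF assms, of H R f] unfolding Y objC objD F_def by simp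
  qed
  show "G (F Y) = Y" if "Y \<in> Obj ?C" for Y
  proof -
    obtain H R f where Y: "Y = ((H, R), f)" by (metis surj_pair)
    have o: "is_triangular H R" "f \<in> bialg_hom B H" "tmap B B H H f f S = R" using that unfolding Y objC by blast+
    then have "is_bialgebra H" using triangular_hopf by (auto simp: is_hopf_algebra_def)
    from group_bialg_induced_bimon[OF assms this o(2)] show ?thesis unfolding Y F_def G_def using o(3) by simp
  qed
  show "F (G X) = X" if "X \<in> Obj ?D" for X
    using that induced_bimon_group_bialg[OF assms, of X] unfolding objD F_def G_def by simp
  show "Hom ?D X Y = Hom ?C (G X) (G Y)" if XY: "X \<in> Obj ?D" "Y \<in> Obj ?D" for X Y
  proof -
    note hX = hopf_monoid_group_bialg[OF assms XY(1)[unfolded objD]]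
    note hY = hopf_monoid_group_bialg[OF assms XY(2)[unfolded objD]]
    let ?H = "group_bialg B X" and ?K = "group_bialg B Y" and ?f = "hunit X" and ?g = "hunit Y"
    have bi: "is_bialgebra ?H" "is_bialgebra ?K" using hX(4) hY(4) by (simp_all only: is_hopf_algebra_def)
    have fe: "?f \<in> extensional (carrier B)" "?g \<in> extensional (carrier B)"
      using hX(5) hY(5) by (auto simp: bialg_hom_def lin_def PiE_iff)
    have "Hom ?D X Y = {h \<in> bialg_hom ?H ?K. compose (carrier B) h ?f = ?g}"
      using bimonoid_hom_eq[OF hX(1) hY(1) bi _ _ _ _ _ _ _ _ _ _ fe] hX(2,3) hY(2,3)
      by (simp add: Grp_Comon_coc_def)
    \<comment> \<open>Preservation of \<open>R\<close> is automatic under \<open>(B, S)\<close>: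
      both structures are images of \<open>S\<close>, and \<open>h f = g\<close>. Hence a bimonoid
      morphism, which knows nothing of \<open>R\<close>, is already a morphism of the
      coslice.\<close>
    moreover have "tmap ?H ?H ?K ?K h h (tmap B B ?H ?H ?f ?f S) = tmap B B ?K ?K ?g ?g S"
      if "h \<in> bialg_hom ?H ?K" "compose (carrier B) h ?f = ?g" for h
      using tmap_compose[OF bialg_hom_lmap[OF hX(5) bialgebra bi(1)] bialg_hom_lmap[OF that(1) bi] S_closed] that(2) by simp
    ultimately show ?thesis
      unfolding G_def coslice_def TrHopf_def by auto
  qed
  show "Id ?D X = Id ?C (G X)" if "X \<in> Obj ?D" for X
    by (simp add: G_def coslice_def TrHopf_def Grp_Comon_coc_def)
  show "Comp ?D X Y Z = Comp ?C (G X) (G Y) (G Z)" for X Y Z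
    by (simp add: G_def coslice_def TrHopf_def Grp_Comon_coc_def)
qed

end
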